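(* There exists a numerical constant $c>0$ such that the following holds for every $\rho\in(0,1)$, every $n\in\mathbb{N}$, $n\ge 1$, all measurable sets $A,B\subset\mathbb{R}^n$ and every measurable set $\Theta\subset A\times B\subset\mathbb{R}^{2n}$ for which the set $A+_\Theta B$ is measurable. Suppose that $$\rho\le\left(\frac{\lambda(B)}{\lambda(A)}\right)^{1/n}\le\rho^{-1}$$ (in particular, $\lambda(A)$ and $\lambda(B)$ are positive and finite) and that $$\lambda(\Theta)\ge\bigl(1-c\min\{\rho\sqrt{n},1\}\bigr)\,\lambda(A)\,\lambda(B).$$ Then $$\lambda(A+_\Theta B)^{2/n}\ge\lambda(A)^{2/n}+\lambda(B)^{2/n}.$$
   Context: $\lambda$ denotes Lebesgue measure in the appropriate dimension ($\mathbb{R}^n$ for $A$, $B$, $A+_\Theta B$; $\mathbb{R}^{2n}$ for $\Theta$). For $\Theta\subset A\times B$, the restricted (to $\Theta$) Minkowski sum of $A$ and $B$ is $$A+_\Theta B=\{x+y:(x,y)\in\Theta\}.$$ All sets are assumed to be measurable. *)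

theory Defs
  imports "HOL-Analysis.Analysis"
begin

text \<open>The constant of the theorem is independent of the dimension, so the dimension cannot be a
  type. A point of \<open>\<real>\<^sup>n\<close> is an element of \<open>\<Pi>\<^sub>E i\<in>{..<n}. UNIV\<close>,
  i.e. a function that takes the value \<open>undefined\<close> outside \<open>{..<n}\<close>. As for the
  library's \<^const>\<open>lebesgue\<close>, Lebesgue measure is the completion of its Borel version.\<close>

definition lebesgue_n :: "nat \<Rightarrow> (nat \<Rightarrow> real) measure" where
  "lebesgue_n n = completion (\<Pi>\<^sub>M i\<in>{..<n}. lborel)"

text \<open>Lebesgue measure on \<open>\<real>\<^sup>2\<^sup>n\<close>, which is identified with \<open>\<real>\<^sup>n \<times> \<real>\<^sup>n\<close>. The
  completion is taken after forming the product: the product of two complete measures is in general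
  not complete, and \<open>lebesgue_n n \<Otimes>\<^sub>M lebesgue_n n\<close> would admit too few sets.\<close>

definition lebesgue_2n :: "nat \<Rightarrow> ((nat \<Rightarrow> real) \<times> (nat \<Rightarrow> real)) measure" where
  "lebesgue_2n n = completion ((\<Pi>\<^sub>M i\<in>{..<n}. lborel) \<Otimes>\<^sub>M (\<Pi>\<^sub>M i\<in>{..<n}. lborel))"

text \<open>Addition in \<open>\<real>\<^sup>n\<close>; pointwise addition on \<open>nat \<Rightarrow> real\<close> would leave the
  carrier of extensional functions.\<close>

definition vec_add :: "nat \<Rightarrow> (nat \<Rightarrow> real) \<Rightarrow> (nat \<Rightarrow> real) \<Rightarrow> (nat \<Rightarrow> real)" where
  "vec_add n x y = (\<lambda>i\<in>{..<n}. x i + y i)"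

text \<open>\<open>A +\<^sub>\<Theta> B\<close> depends on \<open>\<Theta>\<close> only.\<close>

definition restricted_sum ::
  "nat \<Rightarrow> ((nat \<Rightarrow> real) \<times> (nat \<Rightarrow> real)) set \<Rightarrow> (nat \<Rightarrow> real) set" where
  "restricted_sum n \<Theta> = {vec_add n x y | x y. (x, y) \<in> \<Theta>}"

text \<open>Powers with values in \<open>[0, \<infinity>]\<close>, for exponents \<open>p > 0\<close>. They are needed because
  \<open>A +\<^sub>\<Theta> B\<close> may have infinite measure even when \<open>A\<close> and \<open>B\<close> have finite
  measure, and \<^const>\<open>measure\<close> is \<open>0\<close> on such sets.\<close>

definition ennpowr :: "ennreal \<Rightarrow> real \<Rightarrow> ennreal" where
  "ennpowr x p = (if x = \<infinity> then \<infinity> else ennreal (enn2real x powr p))"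

end

theory Submission
  imports Defs "HOL-Probability.Probability"
begin

text \<open>
Write \<open>a\<^sup>n = \<lambda>(A)\<close>, \<open>b\<^sup>n = \<lambda>(B)\<close>, \<open>\<alpha> = a / \<surd>(a\<^sup>2 + b\<^sup>2)\<close>, \<open>\<beta> = b / \<surd>(a\<^sup>2 + b\<^sup>2)\<close>. Let \<open>S\<close>, \<open>T\<close> be triangular monotone maps
that transport the standard Gaussian measure to the uniform measures on \<open>A\<close> and \<open>B\<close>. In the rotated
coordinates \<open>z = \<alpha>u + \<beta>v\<close>, \<open>w = \<alpha>v - \<beta>u\<close>, for fixed \<open>w\<close> the map \<open>z \<mapsto> S(u) + T(v)\<close> is injective, and
by the weighted AM-GM inequality its Jacobian is at least a multiple of the Gaussian densities to the
powers \<open>\<alpha>\<^sup>2\<close> and \<open>\<beta>\<^sup>2\<close>. Integrating over \<open>w\<close> gives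
\<open>\<lambda>(A +\<^sub>\<Theta> B) \<ge> (a\<^sup>2 + b\<^sup>2)\<^bsup>n/2\<^esup> E[1\<^sub>D exp (\<alpha>\<beta> u\<bullet>v)]\<close>, where \<open>D\<close> is the preimage of \<open>\<Theta>\<close>. If \<open>\<alpha>\<beta>\<surd>n\<close> is bounded below and
\<open>D\<close> has probability close to \<open>1\<close>, the expectation is at least \<open>1\<close>, because the variance of \<open>u\<bullet>v\<close> is \<open>n\<close>.
For unions of grid cells the transport maps are products on boxes, so the argument becomes an induction
over the coordinates; compact inner approximation reduces the general case to this one.

If \<open>\<tau> = (b / a)\<surd>n\<close> is small and the conclusion fails, then \<open>h \<mapsto> \<lambda>(A - (A - h))\<close>, which is subadditive, is
\<open>O(c\<tau> + \<tau>\<^sup>2) \<lambda>(A)\<close> on a translate \<open>H\<close> of at least half of \<open>B\<close>. Hence it is small on the dilate \<open>kH\<close> with \<open>k\<close> of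
order \<open>1 / \<tau>\<close>, so that \<open>A\<close> contains a restricted sum of \<open>A\<close> and \<open>kH\<close> along almost all pairs. This
contradicts the first case, applied to \<open>A\<close> and \<open>kH\<close>.
\<close>

section \<open>Gaussian preliminaries\<close>


text \<open>Without the restriction to D, the expectation of exp (\<alpha>\<beta> u\<bullet>v) is (1
  - \<alpha>^2\<beta>^2)^(-n/2), which exceeds the required value 1 by an amount of order
  n\<alpha>^2\<beta>^2. By Cauchy-Schwarz, discarding the complement of D costs the square root of
  its probability. So if \<alpha>\<beta>\<surd>n \<ge> \<delta>, a complement of order \<delta>^4 is
  affordable. When \<tau> is small, the hypothesis permits a complement of order \<tau>, far more
  than \<tau>^4, and the direct argument breaks down; this is the obstacle behind the second half.
  There the loss per translation is of order c\<tau> + \<tau>^2, so that 1/\<tau> translations lose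
  only c + \<tau> up to constants: a complement linear in \<tau> is what the iteration tolerates.
  The dilation by 1/\<tau> is chosen because it brings the quantity corresponding to \<tau> back to
  order 1, where the direct argument works with the fixed value \<delta> = 1/4. Grid cells make the
  conditional one-dimensional transports explicit, so the only change of variables is on the real
  line and no regularity of transport maps enters.\<close>

definition gauss :: "real measure" where
  "gauss = density lborel (\<lambda>x. ennreal (std_normal_density x))"

lemma sets_gauss [measurable_cong, simp]: "sets gauss = sets borel"
  by (simp add: gauss_def)

lemma space_gauss [simp]: "space gauss = UNIV"
  by (simp add: gauss_def)

lemma prob_space_gauss: "prob_space gauss"
  unfolding gauss_def by (rule prob_space_normal_density) simp

lemma real_distribution_gauss: "real_distribution gauss"
  using prob_space_gauss by (auto simp: real_distribution_def real_distribution_axioms_def)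

lemma nn_integral_gauss_pair:
  assumes [measurable]: "F \<in> borel_measurable (borel \<Otimes>\<^sub>M borel)"
  shows "(\<integral>\<^sup>+x. F x \<partial>(gauss \<Otimes>\<^sub>M gauss)) =
    (\<integral>\<^sup>+u. \<integral>\<^sup>+v. ennreal (std_normal_density u * std_normal_density v) * F (u, v) \<partial>lborel \<partial>lborel)"
proof -
  interpret G: prob_space gauss by (rule prob_space_gauss)
  have "(\<integral>\<^sup>+x. F x \<partial>(gauss \<Otimes>\<^sub>M gauss)) = (\<integral>\<^sup>+u. \<integral>\<^sup>+v. F (u, v) \<partial>gauss \<partial>gauss)"
    by (rule G.nn_integral_fst[symmetric]) simp
  also have "\<dots> = (\<integral>\<^sup>+u. ennreal (std_normal_density u) *
      (\<integral>\<^sup>+v. ennreal (std_normal_density v) * F (u, v) \<partial>lborel) \<partial>lborel)"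
    unfolding gauss_def by (subst nn_integral_density; simp add: nn_integral_density)
  also have "\<dots> = (\<integral>\<^sup>+u. \<integral>\<^sup>+v. ennreal (std_normal_density u * std_normal_density v) * F (u, v) \<partial>lborel \<partial>lborel)"
    by (simp add: nn_integral_cmult[symmetric] ennreal_mult' mult.assoc)
  finally show ?thesis .
qed

lemma nn_integral_normal_density:
  assumes "\<sigma> > 0" shows "(\<integral>\<^sup>+x. ennreal (normal_density \<mu> \<sigma> x) \<partial>lborel) = 1"
  using assms by (subst nn_integral_eq_integral) auto

lemma nn_integral_gauss_exp:
  "(\<integral>\<^sup>+u. ennreal (std_normal_density u * exp (s * u)) \<partial>lborel) = ennreal (exp (s\<^sup>2 / 2))"
proof -
  have "std_normal_density u * exp (s * u) = exp (s\<^sup>2 / 2) * normal_density s 1 u" for u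
    by (simp add: normal_density_def exp_add[symmetric] power2_eq_square field_simps)
  then show ?thesis
    by (simp add: ennreal_mult' nn_integral_cmult nn_integral_normal_density)
qed

text \<open>Integrating out v leaves exp ((s u)^2 / 2), which only widens the Gaussian in u to
  variance 1 / (1 - s^2). The formula serves with s = q for means, s = 2q for second moments and s =
  \<alpha>\<beta> for integrability.\<close>

lemma nn_integral_gauss_pair_exp:
  assumes s: "s\<^sup>2 < 1"
  shows "(\<integral>\<^sup>+x. ennreal (exp (s * fst x * snd x)) \<partial>(gauss \<Otimes>\<^sub>M gauss)) = ennreal (1 / sqrt (1 - s\<^sup>2))"
proof -
  have eq: "std_normal_density u * exp ((s * u)\<^sup>2 / 2) =
      1 / sqrt (1 - s\<^sup>2) * normal_density 0 (1 / sqrt (1 - s\<^sup>2)) u" for u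
  proof -
    have "-(u\<^sup>2) / 2 + (s * u)\<^sup>2 / 2 = - u\<^sup>2 / (2 * (1 / sqrt (1 - s\<^sup>2))\<^sup>2)"
      using s by (simp add: power_divide power_mult_distrib field_simps)
    moreover have "sqrt (2 * pi * (1 / sqrt (1 - s\<^sup>2))\<^sup>2) = sqrt (2 * pi) / sqrt (1 - s\<^sup>2)"
      using s by (simp add: power_divide real_sqrt_divide)
    ultimately show ?thesis
      using s by (simp add: normal_density_def exp_add[symmetric])
  qed
  have "(\<integral>\<^sup>+x. ennreal (exp (s * fst x * snd x)) \<partial>(gauss \<Otimes>\<^sub>M gauss)) =
     (\<integral>\<^sup>+u. \<integral>\<^sup>+v. ennreal (std_normal_density u * std_normal_density v) * ennreal (exp (s * u * v)) \<partial>lborel \<partial>lborel)"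
    by (subst nn_integral_gauss_pair) auto
  also have "\<dots> = (\<integral>\<^sup>+u. ennreal (std_normal_density u) *
      (\<integral>\<^sup>+v. ennreal (std_normal_density v * exp ((s * u) * v)) \<partial>lborel) \<partial>lborel)"
    by (simp add: nn_integral_cmult[symmetric] ennreal_mult' mult.assoc)
  also have "\<dots> = (\<integral>\<^sup>+u. ennreal (std_normal_density u * exp ((s * u)\<^sup>2 / 2)) \<partial>lborel)"
    by (simp only: nn_integral_gauss_exp) (simp add: ennreal_mult')
  also have "\<dots> = ennreal (1 / sqrt (1 - s\<^sup>2)) * (\<integral>\<^sup>+u. ennreal (normal_density 0 (1 / sqrt (1 - s\<^sup>2)) u) \<partial>lborel)"
    unfolding eq using s
    by (subst nn_integral_cmult[symmetric], simp) (rule nn_integral_cong, subst ennreal_mult'[symmetric], auto)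
  also have "\<dots> = ennreal (1 / sqrt (1 - s\<^sup>2))"
    using s by (simp add: nn_integral_normal_density)
  finally show ?thesis .
qed

lemma has_bochner_integral_gauss_pair_exp:
  assumes s: "s\<^sup>2 < 1"
  shows "has_bochner_integral (gauss \<Otimes>\<^sub>M gauss) (\<lambda>x. exp (s * fst x * snd x)) (1 / sqrt (1 - s\<^sup>2))"
  using s by (intro has_bochner_integral_nn_integral) (auto simp: nn_integral_gauss_pair_exp[OF s])

section \<open>The Gaussian distribution function\<close>

abbreviation "Phi \<equiv> cdf gauss"

lemma Phi_diff:
  assumes "x \<le> y" shows "Phi y - Phi x = integral {x..y} std_normal_density"
proof (cases "x = y")
  case False
  then have xy: "x < y" using assms by simp
  interpret real_distribution gauss by (rule real_distribution_gauss)
  have int: "set_integrable lborel {x..y} std_normal_density"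
    unfolding set_integrable_def by (rule integrable_mult_indicator) auto
  have "Phi y - Phi x = measure gauss {x<..y}" by (rule cdf_diff_eq[OF xy])
  also have "\<dots> = (LINT u:{x<..y}|lborel. std_normal_density u)"
    unfolding measure_def gauss_def set_lebesgue_integral_def
    by (subst emeasure_density; simp)
       (subst integral_eq_nn_integral; auto intro!: arg_cong[where f=enn2real] nn_integral_cong simp: indicator_def)
  also have "\<dots> = (LINT u:{x..y}|lborel. std_normal_density u)"
    unfolding set_lebesgue_integral_def
    by (rule integral_cong_AE; simp)
       (rule AE_I[where N="{x}"], auto simp: indicator_def)
  also have "\<dots> = integral {x..y} std_normal_density"
    using int by (simp add: set_borel_integral_eq_integral)
  finally show ?thesis .
qed simp

lemma Phi_deriv: "(Phi has_real_derivative std_normal_density u) (at u)"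
proof -
  have "((\<lambda>x. integral {u-1..x} std_normal_density) has_real_derivative std_normal_density u) (at u within {u-1..u+1})"
    by (rule integral_has_real_derivative) (auto intro!: continuous_intros simp: normal_density_def)
  then have "((\<lambda>x. integral {u-1..x} std_normal_density) has_real_derivative std_normal_density u) (at u)"
    by (simp add: at_within_Icc_at)
  then have "((\<lambda>x. integral {u-1..x} std_normal_density + Phi (u-1)) has_real_derivative std_normal_density u) (at u)"
    by (auto intro!: derivative_eq_intros)
  then show ?thesis
    by (rule has_field_derivative_transform_within_open[OF _ open_greaterThan[of "u-1"]])
      (auto simp: Phi_diff[symmetric])
qed

lemma Phi_strict_mono: "x < y \<Longrightarrow> Phi x < Phi y"
  by (rule DERIV_pos_imp_increasing) (auto intro!: exI Phi_deriv simp: normal_density_pos)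

lemma Phi_cont: "continuous_on S Phi"
  by (meson DERIV_isCont Phi_deriv continuous_at_imp_continuous_on)

lemma Phi_range: "0 < Phi u" "Phi u < 1"
proof -
  interpret real_distribution gauss by (rule real_distribution_gauss)
  show "0 < Phi u" using Phi_strict_mono[of "u-1" u] cdf_nonneg[of "u-1"] by simp
  show "Phi u < 1" using Phi_strict_mono[of u "u+1"] cdf_bounded_prob[of "u+1"] by simp
qed

lemma measurable_Phi [measurable]: "Phi \<in> borel_measurable borel"
  by (rule borel_measurable_continuous_onI) (rule Phi_cont)

lemma Phi_quantile:
  assumes "0 < t" "t < 1" obtains q where "Phi q = t"
proof -
  interpret real_distribution gauss by (rule real_distribution_gauss)
  obtain y where y: "Phi y > t"
    using order_tendstoD(1)[OF cdf_lim_at_top_prob assms(2)] by (auto simp: eventually_at_top_linorder)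
  obtain x where x: "Phi x < t"
    using order_tendstoD(2)[OF cdf_lim_at_bot assms(1)] by (auto simp: eventually_at_bot_linorder)
  have "x < y" using x y Phi_strict_mono[of y x] by (cases x y rule: linorder_cases) auto
  then have "\<exists>q\<ge>x. q \<le> y \<and> Phi q = t"
    using x y by (intro IVT') (auto intro: Phi_cont)
  then show ?thesis using that by blast
qed

text \<open>Probability integral transform: \<open>Phi\<close> carries \<open>gauss\<close> to the
  uniform measure on (0, 1). The levels 0 and 1 have no quantile and are treated apart.\<close>

lemma measure_Phi_less:
  assumes "0 \<le> t" "t \<le> 1" shows "measure gauss {u. Phi u < t} = t"
proof -
  interpret real_distribution gauss by (rule real_distribution_gauss)
  consider "t = 0" | "t = 1" | "0 < t" "t < 1" using assms by force
  then show ?thesis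
  proof cases
    case 1
    then have "{u. Phi u < t} = {}" using Phi_range(1) by (auto simp: less_imp_le not_less)
    then show ?thesis using 1 by simp
  next
    case 2
    then have "{u. Phi u < t} = space gauss" using Phi_range(2) by auto
    then show ?thesis using 2 prob_space by simp
  next
    case 3
    then obtain q where q: "Phi q = t" using Phi_quantile by blast
    have "{u. Phi u < t} = {..<q}"
      using Phi_strict_mono q by (auto simp: not_less) (metis linorder_neqE_linordered_idom order_less_asym)
    moreover have "measure gauss {..<q} = Phi q"
    proof -
      have "isCont Phi q" by (rule DERIV_isCont[OF Phi_deriv])
      then have 0: "measure gauss {q} = 0" by (simp add: isCont_cdf)
      have "measure gauss ({..<q} \<union> {q}) = measure gauss {..<q} + measure gauss {q}"
        by (rule finite_measure_Union) auto
      moreover have "{..<q} \<union> {q} = {..q}" by auto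
      ultimately show ?thesis unfolding cdf_def using 0 by simp
    qed
    ultimately show ?thesis using q by simp
  qed
qed

lemma measure_Phi_interval:
  assumes "0 \<le> s" "s \<le> t" "t \<le> 1" shows "measure gauss {u. s \<le> Phi u \<and> Phi u < t} = t - s"
proof -
  interpret real_distribution gauss by (rule real_distribution_gauss)
  have "{u. s \<le> Phi u \<and> Phi u < t} = {u. Phi u < t} - {u. Phi u < s}" by auto
  also have "measure gauss \<dots> = measure gauss {u. Phi u < t} - measure gauss {u. Phi u < s}"
    using assms by (intro finite_measure_Diff) auto
  finally show ?thesis using assms by (simp add: measure_Phi_less)
qed

section \<open>Monotone transport in dimension one\<close>


definition cum :: "int set \<Rightarrow> (int \<Rightarrow> real) \<Rightarrow> int \<Rightarrow> real" where
  "cum I f i = sum f {k \<in> I. k < i}"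

text \<open>The Gaussian strip that monotone transport sends to the cell \<open>[i, i + 1)\<close> of mass \<open>f i\<close>.\<close>

definition strip :: "int set \<Rightarrow> (int \<Rightarrow> real) \<Rightarrow> int \<Rightarrow> real set" where
  "strip I f i = {u. cum I f i \<le> Phi u \<and> Phi u < cum I f i + f i}"

definition strip_index :: "int set \<Rightarrow> (int \<Rightarrow> real) \<Rightarrow> real \<Rightarrow> int" where
  "strip_index I f u = (THE i. i \<in> I \<and> u \<in> strip I f i)"

text \<open>On the strip of \<open>i\<close> the quotient runs through [0, 1). Hence this is
  \<open>Phi\<close> followed by the quantile function of the density with value \<open>f i\<close>
  on [i, i + 1): the increasing map from \<open>gauss\<close> to that density, which jumps over
  missing cells.\<close>

definition transport :: "int set \<Rightarrow> (int \<Rightarrow> real) \<Rightarrow> real \<Rightarrow> real" where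
  "transport I f u = (let i = strip_index I f u in real_of_int i + (Phi u - cum I f i) / f i)"

definition weights :: "int set \<Rightarrow> (int \<Rightarrow> real) \<Rightarrow> bool" where
  "weights I f \<longleftrightarrow> finite I \<and> (\<forall>i\<in>I. 0 < f i) \<and> sum f I = 1"

lemma cum_step:
  assumes "weights I f" "i \<in> I" "k \<in> I" "i < k" shows "cum I f i + f i \<le> cum I f k"
proof -
  have "cum I f i + f i = sum f (insert i {k \<in> I. k < i})"
    using assms by (simp add: cum_def weights_def add.commute)
  also have "\<dots> \<le> sum f {j \<in> I. j < k}"
    using assms by (intro sum_mono2) (auto simp: weights_def less_imp_le)
  finally show ?thesis by (simp add: cum_def)
qed

lemma cum_bounds:
  assumes "weights I f" "i \<in> I" shows "0 \<le> cum I f i" "cum I f i + f i \<le> 1"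
proof -
  show "0 \<le> cum I f i" unfolding cum_def
    by (rule sum_nonneg) (use assms in \<open>auto simp: weights_def less_imp_le\<close>)
  have "cum I f i + f i = sum f (insert i {k \<in> I. k < i})"
    using assms by (simp add: cum_def weights_def add.commute)
  also have "\<dots> \<le> sum f I"
    using assms by (intro sum_mono2) (auto simp: weights_def less_imp_le)
  finally show "cum I f i + f i \<le> 1" using assms by (simp add: weights_def)
qed

text \<open>Adding the elements in increasing order does not change \<open>cum\<close> at earlier
  ones, and the interval of a new largest element begins at the old total mass.\<close>

lemma cum_cover:
  assumes "finite I" "0 \<le> t" "t < sum f I"
  shows "\<exists>i\<in>I. cum I f i \<le> t \<and> t < cum I f i + f i"
  using assms
proof (induction I rule: finite_linorder_max_induct)
  case (insert b A)
  show ?case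
  proof (cases "t < sum f A")
    case True
    then obtain i where i: "i \<in> A" "cum A f i \<le> t" "t < cum A f i + f i"
      using insert by blast
    have "{k \<in> insert b A. k < i} = {k \<in> A. k < i}" using i insert.hyps by auto
    then have "cum (insert b A) f i = cum A f i" by (simp add: cum_def)
    then show ?thesis using i by (metis insertCI)
  next
    case False
    have "{k \<in> insert b A. k < b} = A" using insert.hyps by auto
    then have "cum (insert b A) f b = sum f A" by (simp add: cum_def)
    moreover have "b \<notin> A" using insert.hyps by auto
    ultimately show ?thesis using False insert by (auto simp: add.commute)
  qed
qed simp

lemma strip_unique:
  assumes "weights I f" "i \<in> I" "k \<in> I" "u \<in> strip I f i" "u \<in> strip I f k" shows "i = k"
  using assms cum_step[OF assms(1,2,3)] cum_step[OF assms(1,3,2)]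
  by (cases i k rule: linorder_cases) (auto simp: strip_def)

lemma strip_index:
  assumes "weights I f"
  shows "strip_index I f u \<in> I" "u \<in> strip I f (strip_index I f u)"
proof -
  have "\<exists>i. i \<in> I \<and> u \<in> strip I f i"
    using cum_cover[of I "Phi u" f] assms Phi_range[of u] by (auto simp: weights_def strip_def less_imp_le)
  then have "\<exists>!i. i \<in> I \<and> u \<in> strip I f i" using strip_unique[OF assms] by blast
  from theI'[OF this] show "strip_index I f u \<in> I" "u \<in> strip I f (strip_index I f u)"
    by (auto simp: strip_index_def)
qed

lemma strip_index_eq:
  assumes "weights I f" "i \<in> I" "u \<in> strip I f i" shows "strip_index I f u = i"
  using strip_unique[OF assms(1) strip_index(1)[OF assms(1)] assms(2) strip_index(2)[OF assms(1)] assms(3)] .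

lemma strip_sets [measurable]: "strip I f i \<in> sets borel"
  unfolding strip_def by measurable

lemma measure_strip:
  assumes "weights I f" "i \<in> I" shows "measure gauss (strip I f i) = f i"
proof -
  have "0 < f i" using assms by (auto simp: weights_def)
  then have "measure gauss {u. cum I f i \<le> Phi u \<and> Phi u < cum I f i + f i} = cum I f i + f i - cum I f i"
    using cum_bounds[OF assms] by (intro measure_Phi_interval) linarith+
  then show ?thesis by (simp add: strip_def)
qed

text \<open>The strips partition the line. This turns sums over cells into functions on Gaussian
  space that depend only on the index of the strip.\<close>

lemma sum_indicator_strip:
  assumes "weights I f"
  shows "(\<Sum>i\<in>I. indicator (strip I f i) u * c i) = (c (strip_index I f u) :: real)"
proof -
  have "(\<Sum>i\<in>I. indicator (strip I f i) u * c i) = (\<Sum>i\<in>I. if i = strip_index I f u then c i else 0)"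
  proof (intro sum.cong refl)
    fix i assume i: "i \<in> I"
    have "u \<in> strip I f i \<longleftrightarrow> i = strip_index I f u"
      using strip_index_eq[OF assms i, of u] strip_index(2)[OF assms, of u] by auto
    then show "indicator (strip I f i) u * c i = (if i = strip_index I f u then c i else 0)"
      by (cases "u \<in> strip I f i") simp_all
  qed
  also have "\<dots> = c (strip_index I f u)"
    using assms strip_index(1)[OF assms] by (simp add: weights_def)
  finally show ?thesis .
qed

lemma transport_bounds:
  assumes "weights I f"
  shows "real_of_int (strip_index I f u) \<le> transport I f u"
    "transport I f u < real_of_int (strip_index I f u) + 1"
  using strip_index[OF assms, of u] assms
  by (auto simp: transport_def Let_def strip_def weights_def)

lemma transport_strict_mono:
  assumes w: "weights I f" and uv: "u < v" shows "transport I f u < transport I f v"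
proof -
  let ?i = "strip_index I f u" and ?k = "strip_index I f v"
  have P: "Phi u < Phi v" using uv by (rule Phi_strict_mono)
  note i = strip_index[OF w, of u] and k = strip_index[OF w, of v]
  consider "?i = ?k" | "?i < ?k" | "?k < ?i" by linarith
  then show ?thesis
  proof cases
    case 1
    then show ?thesis using P w i(1)
      by (auto simp: transport_def Let_def weights_def divide_strict_right_mono)
  next
    case 2
    then have "real_of_int ?i + 1 \<le> real_of_int ?k" by linarith
    then show ?thesis using transport_bounds(2)[OF w, of u] transport_bounds(1)[OF w, of v] by linarith
  next
    case 3
    then have "cum I f ?k + f ?k \<le> cum I f ?i" using cum_step[OF w k(1) i(1)] by simp
    then show ?thesis using i(2) k(2) P by (simp add: strip_def)
  qed
qed

lemma transport_deriv:
  assumes w: "weights I f" and u: "Phi u \<notin> cum I f ` I"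
  shows "(transport I f has_real_derivative std_normal_density u / f (strip_index I f u)) (at u)"
proof -
  define i where "i = strip_index I f u"
  note i = strip_index[OF w, of u, folded i_def]
  \<comment> \<open>Away from the left end, which the hypothesis excludes, u lies in the open strip,
    where the index is constant and the transport is affine in \<open>Phi\<close>.\<close>
  define O' where "O' = Phi -` {cum I f i <..< cum I f i + f i}"
  have o: "open O'" unfolding O'_def
    using continuous_open_preimage[OF Phi_cont open_UNIV, of "{cum I f i <..< cum I f i + f i}"] by simp
  have uo: "u \<in> O'"
  proof -
    have "cum I f i \<noteq> Phi u" using i(1) u by (metis imageI)
    then show ?thesis using i by (auto simp: O'_def strip_def less_le)
  qed
  have e: "real_of_int i + (Phi x - cum I f i) / f i = transport I f x" if "x \<in> O'" for x
  proof -
    have "x \<in> strip I f i" using that by (auto simp: O'_def strip_def)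
    then have "strip_index I f x = i" by (rule strip_index_eq[OF w i(1)])
    then show ?thesis by (simp add: transport_def)
  qed
  have "f i \<noteq> 0" using i(1) w by (force simp: weights_def)
  then have "((\<lambda>x. real_of_int i + (Phi x - cum I f i) / f i) has_real_derivative std_normal_density u / f i) (at u)"
    by (auto intro!: derivative_eq_intros Phi_deriv)
  then show ?thesis
    unfolding i_def[symmetric] by (rule has_field_derivative_transform_within_open[OF _ o uo e])
qed

lemma finite_Phi_vimage: "finite X \<Longrightarrow> finite {u. Phi u \<in> X}"
proof -
  assume X: "finite X"
  have "inj Phi"
  proof (rule injI)
    fix x y assume "Phi x = Phi y" then show "x = y"
      using Phi_strict_mono[of x y] Phi_strict_mono[of y x] by (cases x y rule: linorder_cases) simp_all
  qed
  then have "finite (Phi -` X)" using X by (intro finite_vimageI) 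
  then show ?thesis by (simp add: vimage_def)
qed

text \<open>With w = \<alpha>v - \<beta>u fixed, the sum G of the two transports strictly increases
  with u, and the long factor is its derivative off finitely many points. Since G u lies in the cell
  i + j or i + j + 1, \<open>F i j\<close> is at most the value at G u of the step function equal to
  \<open>M l\<close> on [l, l + 1). Change of variables then bounds the integral by that of the step
  function; injectivity of G prevents double counting.\<close>

lemma transport_slice:
  fixes F :: "int \<Rightarrow> int \<Rightarrow> real" and M :: "int \<Rightarrow> real"
  assumes wf: "weights I f" and wg: "weights J g"
    and \<alpha>: "\<alpha> > 0" and \<beta>: "\<beta> > 0"
    and L: "finite L" "\<And>i j. i \<in> I \<Longrightarrow> j \<in> J \<Longrightarrow> i + j \<in> L \<and> i + j + 1 \<in> L"
    and M0: "\<And>l. l \<in> L \<Longrightarrow> 0 \<le> M l"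
    and FM: "\<And>i j. i \<in> I \<Longrightarrow> j \<in> J \<Longrightarrow> F i j \<le> M (i + j) \<and> F i j \<le> M (i + j + 1)"
  shows "(\<integral>\<^sup>+u. ennreal (F (strip_index I f u) (strip_index J g ((\<beta> * u + w) / \<alpha>)) *
      (std_normal_density u / f (strip_index I f u) + \<beta> / \<alpha> *
       (std_normal_density ((\<beta> * u + w) / \<alpha>) / g (strip_index J g ((\<beta> * u + w) / \<alpha>))))) \<partial>lborel)
    \<le> ennreal (sum M L)"
proof -
  let ?v = "\<lambda>u. (\<beta> * u + w) / \<alpha>"
  let ?D = "\<lambda>u. std_normal_density u / f (strip_index I f u) + \<beta> / \<alpha> * (std_normal_density (?v u) / g (strip_index J g (?v u)))"
  let ?G = "\<lambda>u. transport I f u + transport J g (?v u)"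
  define h where "h s = (\<Sum>l\<in>L. M l * indicator {real_of_int l..<real_of_int l + 1} s)" for s
  define bad where "bad = {u. Phi u \<in> cum I f ` I} \<union> ?v -` {v. Phi v \<in> cum J g ` J}"
  have fin: "finite bad"
  proof -
    have "inj ?v" using \<alpha> \<beta> by (auto intro!: injI)
    moreover have "finite {v. Phi v \<in> cum J g ` J}" "finite {u. Phi u \<in> cum I f ` I}"
      using wf wg by (auto simp: weights_def intro!: finite_Phi_vimage)
    ultimately show ?thesis unfolding bad_def by (intro finite_UnI finite_vimageI)
  qed
  define S where "S = - bad"
  have S: "S \<in> sets lebesgue" using finite_imp_closed[OF fin] unfolding S_def
    by (intro sets_completionI_sets) (auto simp: open_Compl)
  have mono: "?G u < ?G v" if "u < v" for u v
  proof -
    have "?v u < ?v v" using that \<alpha> \<beta> by (simp add: divide_strict_right_mono)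
    then show ?thesis using transport_strict_mono[OF wf that] transport_strict_mono[OF wg] by (simp add: add_strict_mono)
  qed
  have inj: "inj_on ?G S"
  proof (rule inj_onI)
    fix x y assume "?G x = ?G y" then show "x = y"
      using mono[of x y] mono[of y x] by (cases x y rule: linorder_cases) simp_all
  qed
  have der: "(?G has_real_derivative ?D u) (at u within S)" if "u \<in> S" for u
  proof -
    have "Phi u \<notin> cum I f ` I" "Phi (?v u) \<notin> cum J g ` J" using that by (auto simp: S_def bad_def)
    note d = transport_deriv[OF wf this(1)] transport_deriv[OF wg this(2)]
    have "(?v has_real_derivative \<beta> / \<alpha>) (at u)"
      using \<alpha> by (auto intro!: derivative_eq_intros)
    from DERIV_chain2[OF d(2) this] have "((\<lambda>u. transport J g (?v u)) has_real_derivative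
        \<beta> / \<alpha> * (std_normal_density (?v u) / g (strip_index J g (?v u)))) (at u)"
      by (simp add: mult.commute)
    from DERIV_add[OF d(1) this] show ?thesis
      by (rule has_field_derivative_at_within)
  qed
  have D0: "0 \<le> ?D u" for u
  proof -
    have "0 < f (strip_index I f u)" "0 < g (strip_index J g (?v u))"
      using strip_index(1)[OF wf] strip_index(1)[OF wg] wf wg by (auto simp: weights_def)
    then show ?thesis using \<alpha> \<beta>
      by (intro add_nonneg_nonneg mult_nonneg_nonneg divide_nonneg_nonneg) (auto simp: less_imp_le)
  qed
  have h0: "0 \<le> h s" for s unfolding h_def using M0 by (auto intro!: sum_nonneg)
  have hM: "h s = M l" if "l \<in> L" "real_of_int l \<le> s" "s < real_of_int l + 1" for s l
  proof -
    have "h s = (\<Sum>k\<in>L. if k = l then M k else 0)"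
      unfolding h_def using that by (intro sum.cong) (auto simp: indicator_def)
    then show ?thesis using that L by simp
  qed
  have hint: "integrable lborel h" and hval: "(LINT s|lborel. h s) = sum M L"
  proof -
    have "has_bochner_integral lborel h (\<Sum>l\<in>L. M l * measure lborel {real_of_int l..<real_of_int l + 1})"
      unfolding h_def by (intro has_bochner_integral_sum has_bochner_integral_mult_right has_bochner_integral_real_indicator) auto
    then show "integrable lborel h" "(LINT s|lborel. h s) = sum M L"
      by (auto simp: has_bochner_integral_iff)
  qed
  have hleb: "integrable lebesgue h" "(LINT s|lebesgue. h s) = sum M L"
    using hint hval by (auto simp: integrable_completion integral_completion)
  have GS: "?G ` S \<in> sets lebesgue"
  proof (rule differentiable_image_in_sets_lebesgue[OF S])
    show "?G differentiable_on S"
      unfolding differentiable_on_def real_differentiable_def by (intro ballI exI) (rule der)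
  qed simp
  have hGS: "h absolutely_integrable_on (?G ` S)"
    unfolding set_integrable_def using hleb(1) GS by (rule integrable_mult_indicator[rotated])
  have *: "(\<lambda>u. \<bar>?D u\<bar> * h (?G u)) absolutely_integrable_on S \<and>
      integral S (\<lambda>u. \<bar>?D u\<bar> * h (?G u)) = integral (?G ` S) h"
    using has_absolute_integral_change_of_variables_1'[where g'="?D", OF S der inj, of h "integral (?G ` S) h"] hGS
    by simp
  have "integral (?G ` S) h = (LINT s:?G ` S|lebesgue. h s)"
    using set_lebesgue_integral_eq_integral(2)[OF hGS] by simp
  also have "\<dots> \<le> (LINT s|lebesgue. h s)"
    unfolding set_lebesgue_integral_def using hGS hleb(1) h0
    by (intro integral_mono) (auto simp: set_integrable_def indicator_def)
  finally have le: "integral (?G ` S) h \<le> sum M L" using hleb by simp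
  have "(\<integral>\<^sup>+u. ennreal (F (strip_index I f u) (strip_index J g (?v u)) * ?D u) \<partial>lborel)
      = (\<integral>\<^sup>+u. ennreal (F (strip_index I f u) (strip_index J g (?v u)) * ?D u) \<partial>lebesgue)"
    by (rule nn_integral_completion[symmetric])
  also have "\<dots> \<le> (\<integral>\<^sup>+u. ennreal (indicat_real S u *\<^sub>R (\<bar>?D u\<bar> * h (?G u))) \<partial>lebesgue)"
  proof (rule nn_integral_mono_AE, rule AE_I')
    show "bad \<in> null_sets lebesgue"
      using finite_imp_null_set_lborel[OF fin] by (rule null_sets_completionI)
    show "{u \<in> space lebesgue. \<not> ennreal (F (strip_index I f u) (strip_index J g (?v u)) * ?D u)
        \<le> ennreal (indicat_real S u *\<^sub>R (\<bar>?D u\<bar> * h (?G u)))} \<subseteq> bad"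
    proof (intro subsetI, rule ccontr)
      fix u assume a: "u \<in> {u \<in> space lebesgue. \<not> ennreal (F (strip_index I f u) (strip_index J g (?v u)) * ?D u)
        \<le> ennreal (indicat_real S u *\<^sub>R (\<bar>?D u\<bar> * h (?G u)))}" and "u \<notin> bad"
      let ?i = "strip_index I f u" and ?j = "strip_index J g (?v u)"
      have ij: "?i \<in> I" "?j \<in> J" using strip_index wf wg by auto
      have "F ?i ?j \<le> h (?G u)"
      proof (cases "?G u < real_of_int (?i + ?j) + 1")
        case True
        then have "h (?G u) = M (?i + ?j)"
          using transport_bounds(1)[OF wf, of u] transport_bounds(1)[OF wg, of "?v u"] L(2)[OF ij]
          by (intro hM) auto
        then show ?thesis using FM[OF ij] by simp
      next
        case False
        then have "h (?G u) = M (?i + ?j + 1)"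
          using transport_bounds(2)[OF wf, of u] transport_bounds(2)[OF wg, of "?v u"] L(2)[OF ij]
          by (intro hM) auto
        then show ?thesis using FM[OF ij] by simp
      qed
      then have "F ?i ?j * ?D u \<le> indicat_real S u *\<^sub>R (\<bar>?D u\<bar> * h (?G u))"
        using D0[of u] \<open>u \<notin> bad\<close> by (simp add: S_def mult_right_mono mult.commute)
      then show False using a by (auto intro: ennreal_leI)
    qed
  qed
  also have "\<dots> = ennreal (LINT u|lebesgue. indicat_real S u *\<^sub>R (\<bar>?D u\<bar> * h (?G u)))"
    using * h0 by (intro nn_integral_eq_integral) (auto simp: set_integrable_def)
  also have "(LINT u|lebesgue. indicat_real S u *\<^sub>R (\<bar>?D u\<bar> * h (?G u))) = integral (?G ` S) h"
    using set_lebesgue_integral_eq_integral(2)[OF conjunct1[OF *]] * by (simp add: set_lebesgue_integral_def)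
  finally show ?thesis using ennreal_leI[OF le] by (rule order_trans)
qed


text \<open>Weighted AM-GM with weights \<alpha>^2 and \<beta>^2, multiplied by the Gaussian density
  at w = \<alpha>v - \<beta>u. By the identity \<alpha>^2 u^2 + \<beta>^2 v^2 + w^2 = u^2 + v^2 -
  2\<alpha>\<beta>uv the powers of the densities recombine into the joint density of u and v, and
  the cross term is the origin of exp (\<alpha>\<beta>uv).\<close>

lemma gaussian_amgm:
  fixes \<alpha> \<beta> u v f g :: real
  assumes \<alpha>: "\<alpha> > 0" and \<beta>: "\<beta> > 0" and ab: "\<alpha>\<^sup>2 + \<beta>\<^sup>2 = 1" and f: "f > 0" and g: "g > 0"
  shows "\<alpha> powr (-\<alpha>\<^sup>2) * \<beta> powr (-\<beta>\<^sup>2) * f powr (-\<alpha>\<^sup>2) * g powr (-\<beta>\<^sup>2) *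
      (std_normal_density u * std_normal_density v * exp (\<alpha> * \<beta> * u * v))
    \<le> \<alpha> * (std_normal_density (\<alpha> * v - \<beta> * u) *
        (std_normal_density u / f + \<beta> / \<alpha> * (std_normal_density v / g)))"
proof -
  let ?n = std_normal_density and ?k = "1 / sqrt (2 * pi)"
  have k: "?k > 0" by simp
  have n: "?n x > 0" for x by (simp add: normal_density_pos)
  have np: "?n x powr a = ?k powr a * exp (- a * x\<^sup>2 / 2)" for x a
    unfolding std_normal_density_def
    by (subst powr_mult) (simp_all add: powr_def ln_exp)
  \<comment> \<open>Dividing by \<alpha> and \<beta> inside the means makes the arithmetic mean
    equal to \<alpha> times the derivative of the slice map.\<close>
  have *: "(?n u / (f * \<alpha>)) powr \<alpha>\<^sup>2 * (?n v / (g * \<beta>)) powr \<beta>\<^sup>2 \<le>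
      \<alpha>\<^sup>2 * (?n u / (f * \<alpha>)) + \<beta>\<^sup>2 * (?n v / (g * \<beta>))"
    using \<alpha> \<beta> ab f g n by (intro Youngs_inequality_0) auto
  have lhs: "(?n u / (f * \<alpha>)) powr \<alpha>\<^sup>2 * (?n v / (g * \<beta>)) powr \<beta>\<^sup>2 =
     \<alpha> powr (-\<alpha>\<^sup>2) * \<beta> powr (-\<beta>\<^sup>2) * f powr (-\<alpha>\<^sup>2) * g powr (-\<beta>\<^sup>2) * (?n u powr \<alpha>\<^sup>2 * ?n v powr \<beta>\<^sup>2)"
    using \<alpha> \<beta> f g n[of u] n[of v] by (simp add: powr_divide powr_mult powr_minus divide_simps)
  have rhs: "\<alpha>\<^sup>2 * (?n u / (f * \<alpha>)) + \<beta>\<^sup>2 * (?n v / (g * \<beta>)) = \<alpha> * (?n u / f + \<beta> / \<alpha> * (?n v / g))"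
    using \<alpha> \<beta> f g by (simp add: power2_eq_square field_simps)
  have "?n u powr \<alpha>\<^sup>2 * ?n v powr \<beta>\<^sup>2 * ?n (\<alpha> * v - \<beta> * u) =
      ?k powr \<alpha>\<^sup>2 * ?k powr \<beta>\<^sup>2 * ?k * exp (- \<alpha>\<^sup>2 * u\<^sup>2 / 2 + - \<beta>\<^sup>2 * v\<^sup>2 / 2 + - (\<alpha> * v - \<beta> * u)\<^sup>2 / 2)"
    unfolding np exp_add by (simp add: std_normal_density_def)
  also have "?k powr \<alpha>\<^sup>2 * ?k powr \<beta>\<^sup>2 = ?k"
    using ab k by (simp add: powr_add[symmetric] del: powr_divide)
  also have "- \<alpha>\<^sup>2 * u\<^sup>2 / 2 + - \<beta>\<^sup>2 * v\<^sup>2 / 2 + - (\<alpha> * v - \<beta> * u)\<^sup>2 / 2 =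
      - u\<^sup>2 / 2 + - v\<^sup>2 / 2 + \<alpha> * \<beta> * u * v"
  proof -
    have "\<alpha>\<^sup>2 * u\<^sup>2 + \<beta>\<^sup>2 * v\<^sup>2 + (\<alpha> * v - \<beta> * u)\<^sup>2 = (\<alpha>\<^sup>2 + \<beta>\<^sup>2) * (u\<^sup>2 + v\<^sup>2) - 2 * (\<alpha> * \<beta> * u * v)"
      by (simp add: power2_eq_square algebra_simps)
    then show ?thesis unfolding ab by (simp add: field_simps)
  qed
  also have "?k * ?k * exp (- u\<^sup>2 / 2 + - v\<^sup>2 / 2 + \<alpha> * \<beta> * u * v) = ?n u * ?n v * exp (\<alpha> * \<beta> * u * v)"
    unfolding std_normal_density_def exp_add by simp
  finally have e: "?n u powr \<alpha>\<^sup>2 * ?n v powr \<beta>\<^sup>2 * ?n (\<alpha> * v - \<beta> * u) = ?n u * ?n v * exp (\<alpha> * \<beta> * u * v)" .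
  have "\<alpha> powr (-\<alpha>\<^sup>2) * \<beta> powr (-\<beta>\<^sup>2) * f powr (-\<alpha>\<^sup>2) * g powr (-\<beta>\<^sup>2) *
      (?n u powr \<alpha>\<^sup>2 * ?n v powr \<beta>\<^sup>2) * ?n (\<alpha> * v - \<beta> * u)
    \<le> \<alpha> * (?n u / f + \<beta> / \<alpha> * (?n v / g)) * ?n (\<alpha> * v - \<beta> * u)"
    using *[unfolded lhs rhs] by (rule mult_right_mono) simp
  then show ?thesis unfolding e[symmetric] by (simp add: mult_ac)
qed

section \<open>Averaging over slices, and the one-dimensional inequality\<close>

lemma measurable_strip_index [measurable]:
  assumes w: "weights I f" shows "strip_index I f \<in> borel \<rightarrow>\<^sub>M count_space UNIV"
proof (subst measurable_count_space_eq2_countable, intro conjI ballI)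
  fix i
  show "strip_index I f -` {i} \<inter> space borel \<in> sets borel"
  proof (cases "i \<in> I")
    case True
    have "u \<in> strip I f i \<longleftrightarrow> strip_index I f u = i" for u
      using strip_index_eq[OF w True, of u] strip_index(2)[OF w, of u] by auto
    then have "strip_index I f -` {i} \<inter> space borel = strip I f i" by auto
    then show ?thesis by simp
  next
    case False
    then have "strip_index I f -` {i} \<inter> space borel = {}" using strip_index(1)[OF w] by auto
    then show ?thesis by simp
  qed
qed auto

lemma measurable_strip_index2:
  assumes w: "weights I f" "weights J g" and a: "a \<in> borel_measurable M" and b: "b \<in> borel_measurable M"
  shows "(\<lambda>x. F (strip_index I f (a x)) (strip_index J g (b x)) :: real) \<in> borel_measurable M"
  by (rule measurable_compose_countable[OF measurable_compose_countable])
    (auto intro: measurable_compose[OF a measurable_strip_index[OF w(1)]]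
       measurable_compose[OF b measurable_strip_index[OF w(2)]])

text \<open>The slice bound is averaged against the Gaussian density of w. After
  \<open>gaussian_amgm\<close>, the substitution w = \<alpha>v - \<beta>u absorbs the factor
  \<alpha> as its Jacobian. Once the integrals are interchanged, every slice contributes at most
  \<open>sum M L\<close>, and the density of w has mass 1.\<close>

lemma transport_average:
  fixes F :: "int \<Rightarrow> int \<Rightarrow> real" and M :: "int \<Rightarrow> real"
  assumes wf: "weights I f" and wg: "weights J g"
    and \<alpha>: "\<alpha> > 0" and \<beta>: "\<beta> > 0" and ab: "\<alpha>\<^sup>2 + \<beta>\<^sup>2 = 1"
    and L: "finite L" "\<And>i j. i \<in> I \<Longrightarrow> j \<in> J \<Longrightarrow> i + j \<in> L \<and> i + j + 1 \<in> L"
    and M0: "\<And>l. l \<in> L \<Longrightarrow> 0 \<le> M l"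
    and F0: "\<And>i j. i \<in> I \<Longrightarrow> j \<in> J \<Longrightarrow> 0 \<le> F i j"
    and FM: "\<And>i j. i \<in> I \<Longrightarrow> j \<in> J \<Longrightarrow> F i j \<le> M (i + j) \<and> F i j \<le> M (i + j + 1)"
  defines "W \<equiv> \<lambda>i j. F i j * (\<alpha> powr (-\<alpha>\<^sup>2) * \<beta> powr (-\<beta>\<^sup>2) * f i powr (-\<alpha>\<^sup>2) * g j powr (-\<beta>\<^sup>2))"
  shows "(\<integral>\<^sup>+x. ennreal (W (strip_index I f (fst x)) (strip_index J g (snd x)) * exp (\<alpha> * \<beta> * fst x * snd x))
      \<partial>(gauss \<Otimes>\<^sub>M gauss)) \<le> ennreal (sum M L)"
proof -
  let ?n = std_normal_density
  let ?i = "strip_index I f" and ?j = "strip_index J g"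
  define E where "E u v = F (?i u) (?j v) * (?n u / f (?i u) + \<beta> / \<alpha> * (?n v / g (?j v)))" for u v
  have fpos: "0 < f (?i u)" and gpos: "0 < g (?j u)" for u
    using strip_index(1)[OF wf] strip_index(1)[OF wg] wf wg by (auto simp: weights_def)
  have F0': "0 \<le> F (?i u) (?j v)" for u v
    using strip_index(1)[OF wf] strip_index(1)[OF wg] F0 by auto
  have E0: "0 \<le> E u v" for u v
    unfolding E_def using fpos[of u] gpos[of v] \<alpha> \<beta> F0'[of u v]
    by (intro mult_nonneg_nonneg add_nonneg_nonneg divide_nonneg_nonneg) auto
  have Emeas: "(\<lambda>x. E (a x) (b x)) \<in> borel_measurable N"
    if [measurable]: "a \<in> borel_measurable N" "b \<in> borel_measurable N" for a b and N :: "'b measure"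
  proof -
    have [measurable]: "(\<lambda>x. F (?i (a x)) (?j (b x))) \<in> borel_measurable N"
      "(\<lambda>x. f (?i (a x))) \<in> borel_measurable N" "(\<lambda>x. g (?j (b x))) \<in> borel_measurable N"
      using measurable_strip_index2[OF wf wg that, of F] measurable_strip_index2[OF wf wg that, of "\<lambda>i j. f i"]
        measurable_strip_index2[OF wf wg that, of "\<lambda>i j. g j"] by auto
    show ?thesis unfolding E_def by measurable
  qed
  have Wmeas: "(\<lambda>x. W (?i (fst x)) (?j (snd x)) * exp (\<alpha> * \<beta> * fst x * snd x)) \<in> borel_measurable (borel \<Otimes>\<^sub>M borel)"
    by (intro borel_measurable_times measurable_strip_index2[OF wf wg]) measurable
  have "(\<integral>\<^sup>+x. ennreal (W (?i (fst x)) (?j (snd x)) * exp (\<alpha> * \<beta> * fst x * snd x)) \<partial>(gauss \<Otimes>\<^sub>M gauss))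
     = (\<integral>\<^sup>+u. \<integral>\<^sup>+v. ennreal (?n u * ?n v) * ennreal (W (?i u) (?j v) * exp (\<alpha> * \<beta> * u * v)) \<partial>lborel \<partial>lborel)"
    using Wmeas by (subst nn_integral_gauss_pair) auto
  also have "\<dots> \<le> (\<integral>\<^sup>+u. \<integral>\<^sup>+v. ennreal \<alpha> * (ennreal (?n (\<alpha> * v - \<beta> * u)) * ennreal (E u v)) \<partial>lborel \<partial>lborel)"
  proof (intro nn_integral_mono)
    fix u v
    have "F (?i u) (?j v) * (\<alpha> powr (-\<alpha>\<^sup>2) * \<beta> powr (-\<beta>\<^sup>2) * f (?i u) powr (-\<alpha>\<^sup>2) * g (?j v) powr (-\<beta>\<^sup>2) *
      (?n u * ?n v * exp (\<alpha> * \<beta> * u * v)))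
      \<le> F (?i u) (?j v) * (\<alpha> * (?n (\<alpha> * v - \<beta> * u) * (?n u / f (?i u) + \<beta> / \<alpha> * (?n v / g (?j v)))))"
      by (intro mult_left_mono gaussian_amgm \<alpha> \<beta> ab fpos gpos F0')
    then have "?n u * ?n v * (W (?i u) (?j v) * exp (\<alpha> * \<beta> * u * v)) \<le> \<alpha> * (?n (\<alpha> * v - \<beta> * u) * E u v)"
      unfolding W_def E_def by (simp add: mult_ac)
    then show "ennreal (?n u * ?n v) * ennreal (W (?i u) (?j v) * exp (\<alpha> * \<beta> * u * v))
       \<le> ennreal \<alpha> * (ennreal (?n (\<alpha> * v - \<beta> * u)) * ennreal (E u v))"
      using \<alpha> by (simp add: ennreal_mult'[symmetric] ennreal_leI)
  qed
  also have "\<dots> = (\<integral>\<^sup>+u. \<integral>\<^sup>+w. ennreal (?n w) * ennreal (E u ((\<beta> * u + w) / \<alpha>)) \<partial>lborel \<partial>lborel)"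
  proof (rule nn_integral_cong)
    fix u :: real
    have [measurable]: "(\<lambda>w. E u ((\<beta> * u + w) / \<alpha>)) \<in> borel_measurable borel" "(\<lambda>v. E u v) \<in> borel_measurable borel"
      by (rule Emeas; simp)+
    have eq: "(\<beta> * u + (- \<beta> * u + \<alpha> * v)) / \<alpha> = v" for v using \<alpha> by simp
    have "(\<integral>\<^sup>+w. ennreal (?n w) * ennreal (E u ((\<beta> * u + w) / \<alpha>)) \<partial>lborel) = ennreal \<bar>\<alpha>\<bar> *
      (\<integral>\<^sup>+v. ennreal (?n (- \<beta> * u + \<alpha> * v)) * ennreal (E u ((\<beta> * u + (- \<beta> * u + \<alpha> * v)) / \<alpha>)) \<partial>lborel)"
      using \<alpha> by (intro nn_integral_real_affine) auto
    also have "\<dots> = (\<integral>\<^sup>+v. ennreal \<alpha> * (ennreal (?n (\<alpha> * v - \<beta> * u)) * ennreal (E u v)) \<partial>lborel)"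
      unfolding eq using \<alpha> by (simp add: nn_integral_cmult)
    finally show "(\<integral>\<^sup>+v. ennreal \<alpha> * (ennreal (?n (\<alpha> * v - \<beta> * u)) * ennreal (E u v)) \<partial>lborel) =
       (\<integral>\<^sup>+w. ennreal (?n w) * ennreal (E u ((\<beta> * u + w) / \<alpha>)) \<partial>lborel)" ..
  qed
  also have "\<dots> = (\<integral>\<^sup>+w. \<integral>\<^sup>+u. ennreal (?n w) * ennreal (E u ((\<beta> * u + w) / \<alpha>)) \<partial>lborel \<partial>lborel)"
  proof (rule lborel_pair.Fubini')
    have "(\<lambda>x. E (snd x) ((\<beta> * snd x + fst x) / \<alpha>)) \<in> borel_measurable (lborel \<Otimes>\<^sub>M lborel)"
      by (rule Emeas) measurable
    then show "(\<lambda>(w, u). ennreal (?n w) * ennreal (E u ((\<beta> * u + w) / \<alpha>))) \<in> borel_measurable (lborel \<Otimes>\<^sub>M lborel)"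
      by (simp add: split_beta')
  qed
  also have "\<dots> = (\<integral>\<^sup>+w. ennreal (?n w) * (\<integral>\<^sup>+u. ennreal (E u ((\<beta> * u + w) / \<alpha>)) \<partial>lborel) \<partial>lborel)"
  proof (rule nn_integral_cong)
    fix w :: real
    have "(\<lambda>u. E u ((\<beta> * u + w) / \<alpha>)) \<in> borel_measurable borel" by (rule Emeas; simp)
    then show "(\<integral>\<^sup>+u. ennreal (?n w) * ennreal (E u ((\<beta> * u + w) / \<alpha>)) \<partial>lborel)
      = ennreal (?n w) * (\<integral>\<^sup>+u. ennreal (E u ((\<beta> * u + w) / \<alpha>)) \<partial>lborel)"
      by (intro nn_integral_cmult) simp
  qed
  also have "\<dots> \<le> (\<integral>\<^sup>+w. ennreal (?n w) * ennreal (sum M L) \<partial>lborel)"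
    unfolding E_def
    by (intro nn_integral_mono mult_left_mono
      transport_slice[where F=F and M=M and L=L, OF wf wg \<alpha> \<beta> L M0 FM]) auto
  also have "\<dots> = ennreal (sum M L)"
    by (simp add: nn_integral_multc nn_integral_normal_density)
  finally show ?thesis .
qed

text \<open>The tangent at x = 1 to the convex function \<open>x powr \<theta>\<close>, obtained
  from Young's inequality with second factor 1. Summed or integrated, it is the form of Jensen's
  inequality used below.\<close>

lemma bernoulli_powr:
  fixes x \<theta> :: real
  assumes "x \<ge> 0" "\<theta> \<ge> 1" shows "1 + \<theta> * (x - 1) \<le> x powr \<theta>"
proof (cases "x = 0")
  case False
  then have "(x powr \<theta>) powr (1 / \<theta>) * 1 powr (1 - 1 / \<theta>) \<le> 1 / \<theta> * x powr \<theta> + (1 - 1 / \<theta>) * 1"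
    using assms by (intro Youngs_inequality_0) auto
  moreover have "1 / \<theta> * x powr \<theta> + (1 - 1 / \<theta>) * 1 = (x powr \<theta> + \<theta> - 1) / \<theta>"
    using assms by (simp add: field_simps)
  moreover have "(x powr \<theta>) powr (1 / \<theta>) = x" using assms by (simp add: powr_powr)
  ultimately have "x \<le> (x powr \<theta> + \<theta> - 1) / \<theta>" by simp
  then have "x * \<theta> \<le> x powr \<theta> + \<theta> - 1" using assms by (simp add: pos_le_divide_eq)
  then show ?thesis by (simp add: algebra_simps)
qed (use assms in auto)

text \<open>The numbers \<open>k i j\<close> are the averages of \<open>exp (q u v)\<close> over products of strips. The exponent \<open>q \<le> \<alpha>\<beta>\<close> is a free
  parameter since the second moment of \<open>exp (\<alpha>\<beta> u v)\<close> may be infinite; Jensen's inequality recovers the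
  exponent \<open>\<alpha>\<beta>\<close>.\<close>

lemma one_dimensional:
  fixes \<alpha> \<beta> q :: real
  assumes wf: "weights I f" and wg: "weights J g"
    and \<alpha>: "\<alpha> > 0" and \<beta>: "\<beta> > 0" and ab: "\<alpha>\<^sup>2 + \<beta>\<^sup>2 = 1"
    and q: "0 < q" "q \<le> \<alpha> * \<beta>" "4 * q\<^sup>2 < 1"
  obtains k :: "int \<Rightarrow> int \<Rightarrow> real" where
    "\<And>i j. i \<in> I \<Longrightarrow> j \<in> J \<Longrightarrow> 0 \<le> k i j"
    "(\<Sum>i\<in>I. \<Sum>j\<in>J. f i * g j * k i j) = 1 / sqrt (1 - q\<^sup>2)"
    "(\<Sum>i\<in>I. \<Sum>j\<in>J. f i * g j * (k i j)\<^sup>2) \<le> 1 / sqrt (1 - 4 * q\<^sup>2)"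
    "\<And>F M L. finite L \<Longrightarrow> (\<And>i j. i \<in> I \<Longrightarrow> j \<in> J \<Longrightarrow> i + j \<in> L \<and> i + j + 1 \<in> L) \<Longrightarrow>
      (\<And>l. l \<in> L \<Longrightarrow> 0 \<le> M l) \<Longrightarrow> (\<And>i j. i \<in> I \<Longrightarrow> j \<in> J \<Longrightarrow> 0 \<le> F i j) \<Longrightarrow>
      (\<And>i j. i \<in> I \<Longrightarrow> j \<in> J \<Longrightarrow> F i j \<le> M (i + j) \<and> F i j \<le> M (i + j + 1)) \<Longrightarrow>
      (\<Sum>i\<in>I. \<Sum>j\<in>J. F i j * (\<alpha> powr (-\<alpha>\<^sup>2) * \<beta> powr (-\<beta>\<^sup>2)) * f i powr (\<beta>\<^sup>2) * g j powr (\<alpha>\<^sup>2)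
         * k i j powr (\<alpha> * \<beta> / q)) \<le> sum M L"
proof -
  let ?N = "gauss \<Otimes>\<^sub>M gauss"
  let ?\<theta> = "\<alpha> * \<beta> / q"
  interpret G: prob_space gauss by (rule prob_space_gauss)
  interpret NP: prob_space ?N by (intro prob_space_pair prob_space_gauss)
  define C where "C i j = strip I f i \<times> strip J g j" for i j
  define X where "X s x = exp (s * fst x * snd x)" for s :: real and x :: "real \<times> real"
  define k where "k i j = (LINT x|?N. indicator (C i j) x * X q x) / (f i * g j)" for i j
  have Cm [measurable]: "C i j \<in> sets ?N" for i j
    unfolding C_def by (intro pair_measureI) auto
  have Cint: "integrable ?N (\<lambda>x. indicat_real (C i j) x)" for i j
    by (rule integrable_real_indicator[OF Cm]) (simp add: NP.emeasure_eq_measure)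
  have Csp: "C i j \<inter> space ?N = C i j" for i j
    using sets.sets_into_space[OF Cm, of i j] by (simp add: Int_absorb2)
  have fg: "0 < f i" "0 < g j" if "i \<in> I" "j \<in> J" for i j
    using that wf wg by (auto simp: weights_def)
  have mC: "measure ?N (C i j) = f i * g j" if "i \<in> I" "j \<in> J" for i j
    unfolding C_def using measure_strip[OF wf that(1)] measure_strip[OF wg that(2)]
    unfolding measure_def by (subst G.emeasure_pair_measure_Times) (auto simp: enn2real_mult)
  have part: "(\<Sum>i\<in>I. \<Sum>j\<in>J. indicator (C i j) x * c i j) =
      (c (strip_index I f (fst x)) (strip_index J g (snd x)) :: real)" for x c
  proof -
    have "(\<Sum>i\<in>I. \<Sum>j\<in>J. indicator (C i j) x * c i j) =
      (\<Sum>i\<in>I. indicator (strip I f i) (fst x) * (\<Sum>j\<in>J. indicator (strip J g j) (snd x) * c i j))"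
      unfolding C_def by (cases x) (simp add: indicator_times sum_distrib_left mult.assoc)
    then show ?thesis unfolding sum_indicator_strip[OF wg] sum_indicator_strip[OF wf] .
  qed
  have Xm [measurable]: "X s \<in> borel_measurable ?N" for s unfolding X_def by measurable
  have X0: "0 < X s x" for s x by (simp add: X_def)
  have X: "has_bochner_integral ?N (X s) (1 / sqrt (1 - s\<^sup>2))" if "s\<^sup>2 < 1" for s
    unfolding X_def by (rule has_bochner_integral_gauss_pair_exp[OF that])
  have Xint: "integrable ?N (X s)" if "s\<^sup>2 < 1" for s
    using X[OF that] by (simp add: has_bochner_integral_iff)
  have CXint: "integrable ?N (\<lambda>x. indicator (C i j) x * X s x)" if "s\<^sup>2 < 1" for s i j
    using integrable_mult_indicator[OF Cm Xint[OF that]] by simp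
  have total: "(\<Sum>i\<in>I. \<Sum>j\<in>J. LINT x|?N. indicator (C i j) x * X s x) = 1 / sqrt (1 - s\<^sup>2)"
    if s: "s\<^sup>2 < 1" for s
  proof -
    have "(\<Sum>i\<in>I. \<Sum>j\<in>J. LINT x|?N. indicator (C i j) x * X s x) =
        (LINT x|?N. (\<Sum>i\<in>I. \<Sum>j\<in>J. indicator (C i j) x * X s x))"
      using CXint[OF s] by (simp add: Bochner_Integration.integral_sum)
    also have "\<dots> = (LINT x|?N. X s x)"
      by (intro Bochner_Integration.integral_cong refl) (rule part)
    finally show ?thesis using X[OF s] by (simp add: has_bochner_integral_iff)
  qed
  have q1: "q\<^sup>2 < 1" using q zero_le_power2[of q] by linarith
  have q2: "(2 * q)\<^sup>2 < 1" using q by (simp add: power_mult_distrib)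
  have "2 * (\<alpha> * \<beta>) \<le> 1" using ab sum_squares_bound[of \<alpha> \<beta>] by simp
  moreover have ab0: "0 < \<alpha> * \<beta>" using \<alpha> \<beta> by simp
  ultimately have p1: "(\<alpha> * \<beta>)\<^sup>2 < 1" by (subst power2_less_1_iff) (simp add: abs_less_iff)
  have kf: "f i * g j * k i j = (LINT x|?N. indicator (C i j) x * X q x)" if "i \<in> I" "j \<in> J" for i j
    using fg[OF that] by (simp add: k_def)
  have k0: "0 \<le> k i j" if "i \<in> I" "j \<in> J" for i j
    unfolding k_def using fg[OF that] X0[of q]
    by (intro divide_nonneg_pos integral_nonneg_AE) (auto simp: less_imp_le)
  \<comment> \<open>The variance of \<open>X q\<close> on a cell is nonnegative, and the square of
    \<open>X q\<close> is \<open>X (2 * q)\<close>.\<close>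
  have sq: "f i * g j * (k i j)\<^sup>2 \<le> (LINT x|?N. indicator (C i j) x * X (2 * q) x)" if ij: "i \<in> I" "j \<in> J" for i j
  proof -
    have "0 \<le> (LINT x|?N. indicator (C i j) x * (X q x - k i j)\<^sup>2)"
      by (intro integral_nonneg_AE) auto
    also have "(\<lambda>x. indicator (C i j) x * (X q x - k i j)\<^sup>2) = (\<lambda>x. indicator (C i j) x * X (2 * q) x -
        2 * k i j * (indicator (C i j) x * X q x) + (k i j)\<^sup>2 * indicator (C i j) x)"
      by (rule ext) (simp add: X_def power2_diff exp_double[symmetric] algebra_simps power2_eq_square exp_add[symmetric])
    also have "(LINT x|?N. \<dots> x) = (LINT x|?N. indicator (C i j) x * X (2 * q) x) -
        2 * k i j * (f i * g j * k i j) + (k i j)\<^sup>2 * (f i * g j)"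
      using CXint[OF q1, of i j] CXint[OF q2, of i j] kf[OF ij] mC[OF ij]
      by (simp add: Cint Csp)
    finally show ?thesis by (simp add: power2_eq_square algebra_simps)
  qed
  have th: "1 \<le> ?\<theta>" using q by simp
  \<comment> \<open>Jensen's inequality on a cell: the power \<theta> is bounded below by its
    tangent at the mean \<open>k i j\<close>, and \<open>X q\<close> to the power \<theta> is
    \<open>X (\<alpha> * \<beta>)\<close>.\<close>
  have pw: "f i * g j * k i j powr ?\<theta> \<le> (LINT x|?N. indicator (C i j) x * X (\<alpha> * \<beta>) x)" if ij: "i \<in> I" "j \<in> J" for i j
  proof (cases "k i j = 0")
    case True
    then show ?thesis using X0 th by (auto intro!: integral_nonneg_AE simp: less_imp_le)
  next
    case False
    then have kp: "0 < k i j" using k0[OF ij] by simp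
    have pt: "k i j powr ?\<theta> * (1 - ?\<theta> + ?\<theta> / k i j * X q x) \<le> X (\<alpha> * \<beta>) x" for x
    proof -
      have "k i j powr ?\<theta> * (1 + ?\<theta> * (X q x / k i j - 1)) \<le> k i j powr ?\<theta> * (X q x / k i j) powr ?\<theta>"
        using kp X0[of q x] th by (intro mult_left_mono bernoulli_powr) auto
      also have "\<dots> = X q x powr ?\<theta>" using kp X0[of q x] by (simp add: powr_divide)
      also have "\<dots> = X (\<alpha> * \<beta>) x" using q by (simp add: X_def powr_def)
      finally show ?thesis by (simp add: algebra_simps)
    qed
    have "f i * g j * k i j powr ?\<theta> = k i j powr ?\<theta> * ((1 - ?\<theta>) * (f i * g j) + ?\<theta> / k i j * (f i * g j * k i j))"
      using kp by (simp add: algebra_simps)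
    also have "\<dots> = (LINT x|?N. k i j powr ?\<theta> * ((1 - ?\<theta>) * indicator (C i j) x + ?\<theta> / k i j * (indicator (C i j) x * X q x)))"
      using CXint[OF q1, of i j] kf[OF ij] mC[OF ij]
      by (simp add: Cint Csp)
    also have "\<dots> \<le> (LINT x|?N. indicator (C i j) x * X (\<alpha> * \<beta>) x)"
    proof (rule integral_mono)
      show "integrable ?N (\<lambda>x. k i j powr ?\<theta> * ((1 - ?\<theta>) * indicator (C i j) x + ?\<theta> / k i j * (indicator (C i j) x * X q x)))"
        using CXint[OF q1, of i j] by (simp add: Cint Csp)
      show "integrable ?N (\<lambda>x. indicator (C i j) x * X (\<alpha> * \<beta>) x)" by (rule CXint[OF p1])
      show "k i j powr ?\<theta> * ((1 - ?\<theta>) * indicator (C i j) x + ?\<theta> / k i j * (indicator (C i j) x * X q x))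
        \<le> indicator (C i j) x * X (\<alpha> * \<beta>) x" for x
        using pt[of x] by (cases "x \<in> C i j") auto
    qed
    finally show ?thesis .
  qed
  show ?thesis
  proof (rule that[of k])
    show "(\<Sum>i\<in>I. \<Sum>j\<in>J. f i * g j * k i j) = 1 / sqrt (1 - q\<^sup>2)"
      using total[OF q1] kf by simp
    have "(\<Sum>i\<in>I. \<Sum>j\<in>J. f i * g j * (k i j)\<^sup>2) \<le> (\<Sum>i\<in>I. \<Sum>j\<in>J. LINT x|?N. indicator (C i j) x * X (2 * q) x)"
      by (intro sum_mono sq)
    then show "(\<Sum>i\<in>I. \<Sum>j\<in>J. f i * g j * (k i j)\<^sup>2) \<le> 1 / sqrt (1 - 4 * q\<^sup>2)"
      using total[OF q2] by (simp add: power_mult_distrib)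
    fix F M and L :: "int set"
    assume L: "finite L" "\<And>i j. i \<in> I \<Longrightarrow> j \<in> J \<Longrightarrow> i + j \<in> L \<and> i + j + 1 \<in> L"
      and M0: "\<And>l. l \<in> L \<Longrightarrow> 0 \<le> (M l :: real)" and F0: "\<And>i j. i \<in> I \<Longrightarrow> j \<in> J \<Longrightarrow> 0 \<le> (F i j :: real)"
      and FM: "\<And>i j. i \<in> I \<Longrightarrow> j \<in> J \<Longrightarrow> F i j \<le> M (i + j) \<and> F i j \<le> M (i + j + 1)"
    let ?W = "\<lambda>i j. F i j * (\<alpha> powr (-\<alpha>\<^sup>2) * \<beta> powr (-\<beta>\<^sup>2) * f i powr (-\<alpha>\<^sup>2) * g j powr (-\<beta>\<^sup>2))"
    have W0: "0 \<le> ?W i j" if "i \<in> I" "j \<in> J" for i j using F0[OF that] by simp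
    \<comment> \<open>The exponent turns positive because the mass \<open>f i\<close> of the strip
      multiplies the AM-GM factor \<open>f i powr (-\<alpha>\<^sup>2)\<close>. This positive power
      is what telescopes in the induction over the coordinates.\<close>
    have fb: "f i powr (\<beta>\<^sup>2) = f i powr (-\<alpha>\<^sup>2) * f i" if "i \<in> I" for i
    proof -
      have "0 < f i" using that wf by (auto simp: weights_def)
      moreover have "\<beta>\<^sup>2 = -\<alpha>\<^sup>2 + 1" using ab by simp
      ultimately show ?thesis by (simp only: powr_add powr_one)
    qed
    have ga: "g i powr (\<alpha>\<^sup>2) = g i powr (-\<beta>\<^sup>2) * g i" if "i \<in> J" for i
    proof -
      have "0 < g i" using that wg by (auto simp: weights_def)
      moreover have "\<alpha>\<^sup>2 = -\<beta>\<^sup>2 + 1" using ab by simp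
      ultimately show ?thesis by (simp only: powr_add powr_one)
    qed
    have "(\<Sum>i\<in>I. \<Sum>j\<in>J. F i j * (\<alpha> powr (-\<alpha>\<^sup>2) * \<beta> powr (-\<beta>\<^sup>2)) * f i powr (\<beta>\<^sup>2) * g j powr (\<alpha>\<^sup>2) * k i j powr ?\<theta>)
      = (\<Sum>i\<in>I. \<Sum>j\<in>J. ?W i j * (f i * g j * k i j powr ?\<theta>))"
      by (intro sum.cong refl) (simp only: fb ga mult_ac)
    also have "\<dots> \<le> (\<Sum>i\<in>I. \<Sum>j\<in>J. ?W i j * (LINT x|?N. indicator (C i j) x * X (\<alpha> * \<beta>) x))"
      by (intro sum_mono mult_left_mono pw W0)
    also have "\<dots> = (LINT x|?N. (\<Sum>i\<in>I. \<Sum>j\<in>J. indicator (C i j) x * (?W i j * X (\<alpha> * \<beta>) x)))"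
    proof -
      have e: "indicator (C i j) x * (?W i j * X (\<alpha> * \<beta>) x) = ?W i j * (indicator (C i j) x * X (\<alpha> * \<beta>) x)" for i j x
        by (simp only: mult_ac)
      show ?thesis unfolding e using CXint[OF p1]
        by (simp add: Bochner_Integration.integral_sum del: mult_cancel_left)
    qed
    also have "\<dots> \<le> sum M L"
    proof -
      have i: "integrable ?N (\<lambda>x. \<Sum>i\<in>I. \<Sum>j\<in>J. indicator (C i j) x * (?W i j * X (\<alpha> * \<beta>) x))"
      proof -
        have e: "indicator (C i j) x * (?W i j * X (\<alpha> * \<beta>) x) = ?W i j * (indicator (C i j) x * X (\<alpha> * \<beta>) x)" for i j x
          by (simp only: mult_ac)
        show ?thesis unfolding e using CXint[OF p1]
          by (intro Bochner_Integration.integrable_sum integrable_mult_right)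
      qed
      have "ennreal (LINT x|?N. (\<Sum>i\<in>I. \<Sum>j\<in>J. indicator (C i j) x * (?W i j * X (\<alpha> * \<beta>) x))) =
        (\<integral>\<^sup>+x. ennreal (\<Sum>i\<in>I. \<Sum>j\<in>J. indicator (C i j) x * (?W i j * X (\<alpha> * \<beta>) x)) \<partial>?N)"
        using F0 order_less_imp_le[OF X0] by (intro nn_integral_eq_integral[symmetric] i AE_I2 sum_nonneg mult_nonneg_nonneg) auto
      also have "\<dots> \<le> ennreal (sum M L)"
        unfolding part X_def by (rule transport_average[where F=F and M=M and L=L, OF wf wg \<alpha> \<beta> ab L M0 F0 FM])
      finally show ?thesis using M0 by (simp add: sum_nonneg)
    qed
    finally show "(\<Sum>i\<in>I. \<Sum>j\<in>J. F i j * (\<alpha> powr (-\<alpha>\<^sup>2) * \<beta> powr (-\<beta>\<^sup>2)) * f i powr (\<beta>\<^sup>2) * g j powr (\<alpha>\<^sup>2)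
         * k i j powr ?\<theta>) \<le> sum M L" .
  qed (rule k0)
qed

section \<open>The inequality for subsets of the integer grid\<close>


text \<open>The sum of the half-open unit cells at \<open>x\<close> and \<open>y\<close> is the union of the unit cells at all \<open>z\<close> with \<open>near_sum x y z\<close>.\<close>

definition near_sum :: "int list \<Rightarrow> int list \<Rightarrow> int list \<Rightarrow> bool" where
  "near_sum x y z \<longleftrightarrow> length x = length z \<and> length y = length z \<and>
    (\<forall>m<length z. z ! m = x ! m + y ! m \<or> z ! m = x ! m + y ! m + 1)"

definition grid_sum :: "(int list \<times> int list) set \<Rightarrow> int list set" where
  "grid_sum \<Theta> = {z. \<exists>x y. (x, y) \<in> \<Theta> \<and> near_sum x y z}"

definition fiber :: "int \<Rightarrow> int list set \<Rightarrow> int list set" where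
  "fiber i I = {x. i # x \<in> I}"

lemma near_sum_Cons:
  "near_sum (i # x) (j # y) (k # z) \<longleftrightarrow> (k = i + j \<or> k = i + j + 1) \<and> near_sum x y z"
  by (auto simp: near_sum_def All_less_Suc2)

lemma near_sum_Nil [simp]: "near_sum [] [] z \<longleftrightarrow> z = []"
  by (auto simp: near_sum_def)

lemma finite_near_sum: "finite {z. near_sum x y z}"
proof (induction x arbitrary: y)
  case Nil
  have "{z. near_sum [] y z} \<subseteq> {[]}" by (auto simp: near_sum_def)
  then show ?case by (rule finite_subset) simp
next
  case (Cons i x)
  show ?case
  proof (cases y)
    case Nil
    have "{z. near_sum (i # x) y z} = {}" using Nil by (auto simp: near_sum_def)
    then show ?thesis by (metis finite.emptyI)
  next
    case (Cons j y')
    have "{z. near_sum (i # x) y z} \<subseteq> (\<lambda>(k, z). k # z) ` ({i + j, i + j + 1} \<times> {z. near_sum x y' z})"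
    proof
      fix z assume "z \<in> {z. near_sum (i # x) y z}"
      then have z: "near_sum (i # x) (j # y') z" using Cons by simp
      then obtain k z' where "z = k # z'" by (cases z) (auto simp: near_sum_def)
      then show "z \<in> (\<lambda>(k, z). k # z) ` ({i + j, i + j + 1} \<times> {z. near_sum x y' z})"
        using z by (auto simp: near_sum_Cons)
    qed
    then show ?thesis by (rule finite_subset) (use Cons.IH in simp)
  qed
qed

lemma finite_grid_sum: "finite \<Theta> \<Longrightarrow> finite (grid_sum \<Theta>)"
proof -
  assume "finite \<Theta>"
  moreover have "grid_sum \<Theta> = (\<Union>(x, y)\<in>\<Theta>. {z. near_sum x y z})" by (auto simp: grid_sum_def)
  ultimately show ?thesis using finite_near_sum by auto
qed

lemma finite_fiber: "finite I \<Longrightarrow> finite (fiber i I)"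
  using finite_vimageI[of I "(#) i"] by (simp add: fiber_def vimage_def)

lemma sum_fiber:
  assumes "finite I" "\<And>x. x \<in> I \<Longrightarrow> x \<noteq> []"
  shows "sum \<phi> I = (\<Sum>i\<in>hd ` I. \<Sum>x\<in>fiber i I. \<phi> (i # x))"
proof -
  have "sum \<phi> I = (\<Sum>i\<in>hd ` I. sum \<phi> {x \<in> I. hd x = i})"
    using assms by (intro sum.group[symmetric]) auto
  also have "\<dots> = (\<Sum>i\<in>hd ` I. \<Sum>x\<in>fiber i I. \<phi> (i # x))"
  proof (rule sum.cong[OF refl])
    fix i
    show "sum \<phi> {x \<in> I. hd x = i} = (\<Sum>x\<in>fiber i I. \<phi> (i # x))"
      by (rule sum.reindex_bij_witness[of _ "(#) i" tl])
        (use assms(2) in \<open>auto simp: fiber_def neq_Nil_conv\<close>)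
  qed
  finally show ?thesis .
qed

lemma sum_fiber2:
  assumes "finite I" "\<And>x. x \<in> I \<Longrightarrow> x \<noteq> []" "finite J" "\<And>x. x \<in> J \<Longrightarrow> x \<noteq> []"
  shows "(\<Sum>x\<in>I. \<Sum>y\<in>J. \<phi> x y) =
    (\<Sum>i\<in>hd ` I. \<Sum>j\<in>hd ` J. \<Sum>x\<in>fiber i I. \<Sum>y\<in>fiber j J. \<phi> (i # x) (j # y))"
proof -
  have "(\<Sum>x\<in>I. \<Sum>y\<in>J. \<phi> x y) = (\<Sum>i\<in>hd ` I. \<Sum>x\<in>fiber i I. \<Sum>j\<in>hd ` J. \<Sum>y\<in>fiber j J. \<phi> (i # x) (j # y))"
    by (rule trans[OF sum_fiber[OF assms(1,2)]], assumption)
      (rule sum.cong[OF refl], rule sum.cong[OF refl], rule sum_fiber[OF assms(3,4)])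
  also have "\<dots> = (\<Sum>i\<in>hd ` I. \<Sum>j\<in>hd ` J. \<Sum>x\<in>fiber i I. \<Sum>y\<in>fiber j J. \<phi> (i # x) (j # y))"
    by (rule sum.cong[OF refl], rule sum.swap)
  finally show ?thesis .
qed

text \<open>The weights are the law of the first coordinate of a uniformly chosen element of
  \<open>I\<close>.\<close>

lemma weights_fiber:
  assumes "finite I" "\<And>x. x \<in> I \<Longrightarrow> x \<noteq> []" "I \<noteq> {}"
  shows "weights (hd ` I) (\<lambda>i. real (card (fiber i I)) / real (card I))"
proof -
  have pos: "0 < card (fiber i I)" if i: "i \<in> hd ` I" for i
  proof -
    obtain x where "x \<in> I" "hd x = i" using i by auto
    then have "tl x \<in> fiber i I" using assms(2)[of x] by (auto simp: fiber_def)
    then show ?thesis using finite_fiber[OF assms(1)] by (auto simp: card_gt_0_iff)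
  qed
  have "(\<Sum>i\<in>hd ` I. real (card (fiber i I))) = real (card I)"
    using sum_fiber[OF assms(1,2), of "\<lambda>_. 1 :: real"] by simp
  then show ?thesis using assms pos
    by (auto simp: weights_def sum_divide_distrib[symmetric] card_gt_0_iff)
qed

text \<open>The triangular transport, one coordinate at a time: first coordinates are transported
  according to their marginal laws, the remaining ones by induction inside each pair of fibers. The
  number \<open>r x y\<close> stands for the average of exp (q u\<bullet>v) over the product strips
  belonging to x and y, so it is a product of the one-dimensional averages \<open>k\<close>. It is
  chosen before \<Theta>, since its moments must not depend on the subset of pairs.\<close>

lemma discrete_tensor:
  fixes \<alpha> \<beta> q :: real
  assumes \<alpha>: "\<alpha> > 0" and \<beta>: "\<beta> > 0" and ab: "\<alpha>\<^sup>2 + \<beta>\<^sup>2 = 1"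
    and q: "0 < q" "q \<le> \<alpha> * \<beta>" "4 * q\<^sup>2 < 1"
    and I: "finite I" "I \<noteq> {}" "\<And>x. x \<in> I \<Longrightarrow> length x = n"
    and J: "finite J" "J \<noteq> {}" "\<And>x. x \<in> J \<Longrightarrow> length x = n"
  shows "\<exists>r. (\<forall>x\<in>I. \<forall>y\<in>J. 0 \<le> r x y) \<and>
    (\<Sum>x\<in>I. \<Sum>y\<in>J. r x y) = (1 / sqrt (1 - q\<^sup>2)) ^ n * (real (card I) * real (card J)) \<and>
    (\<Sum>x\<in>I. \<Sum>y\<in>J. (r x y)\<^sup>2) \<le> (1 / sqrt (1 - 4 * q\<^sup>2)) ^ n * (real (card I) * real (card J)) \<and>
    (\<forall>\<Theta>. \<Theta> \<subseteq> I \<times> J \<longrightarrow> (\<alpha> powr (-\<alpha>\<^sup>2) * \<beta> powr (-\<beta>\<^sup>2)) ^ n * real (card I) powr (-\<beta>\<^sup>2) * real (card J) powr (-\<alpha>\<^sup>2) *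
      (\<Sum>x\<in>I. \<Sum>y\<in>J. if (x, y) \<in> \<Theta> then r x y powr (\<alpha> * \<beta> / q) else 0) \<le> real (card (grid_sum \<Theta>)))"
  using I J
proof (induction n arbitrary: I J)
  case 0
  then have IJ: "I = {[]}" "J = {[]}" by auto
  have "grid_sum {([], [])} = {[]}" by (auto simp: grid_sum_def)
  then have g: "Suc 0 \<le> card (grid_sum \<Theta>)" if "([], []) \<in> \<Theta>" "\<Theta> \<subseteq> {([], [])}" for \<Theta>
  proof -
    have "\<Theta> = {([], [])}" using that by blast
    then show ?thesis using \<open>grid_sum {([], [])} = {[]}\<close> by simp
  qed
  show ?case unfolding IJ
    by (rule exI[of _ "\<lambda>x y. 1"]) (use g in simp)
next
  case (Suc n)
  let ?\<theta> = "\<alpha> * \<beta> / q" and ?\<kappa> = "\<alpha> powr (-\<alpha>\<^sup>2) * \<beta> powr (-\<beta>\<^sup>2)"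
  let ?m1 = "1 / sqrt (1 - q\<^sup>2)" and ?m2 = "1 / sqrt (1 - 4 * q\<^sup>2)"
  have ne: "\<And>x. x \<in> I \<Longrightarrow> x \<noteq> []" "\<And>x. x \<in> J \<Longrightarrow> x \<noteq> []" using Suc.prems by fastforce+
  note finI = Suc.prems(1) and finJ = Suc.prems(4)
  let ?cI = "\<lambda>i. real (card (fiber i I))" and ?cJ = "\<lambda>j. real (card (fiber j J))"
  define f where "f i = ?cI i / real (card I)" for i
  define g where "g j = ?cJ j / real (card J)" for j
  have wf: "weights (hd ` I) f" unfolding f_def by (rule weights_fiber[OF finI ne(1) Suc.prems(2)])
  have wg: "weights (hd ` J) g" unfolding g_def by (rule weights_fiber[OF finJ ne(2) Suc.prems(5)])
  have cI: "0 < real (card I)" and cJ: "0 < real (card J)" using Suc.prems by (auto simp: card_gt_0_iff)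
  have cIi: "?cI i = f i * real (card I)" and cJj: "?cJ j = g j * real (card J)" for i j
    using cI cJ by (auto simp: f_def g_def)
  have fpos: "0 < f i" if "i \<in> hd ` I" for i using wf that by (auto simp: weights_def)
  have gpos: "0 < g i" if "i \<in> hd ` J" for i using wg that by (auto simp: weights_def)
  obtain k where k: "\<And>i j. i \<in> hd ` I \<Longrightarrow> j \<in> hd ` J \<Longrightarrow> 0 \<le> k i j"
    "(\<Sum>i\<in>hd ` I. \<Sum>j\<in>hd ` J. f i * g j * k i j) = ?m1"
    "(\<Sum>i\<in>hd ` I. \<Sum>j\<in>hd ` J. f i * g j * (k i j)\<^sup>2) \<le> ?m2"
    "\<And>F M L. finite L \<Longrightarrow> (\<And>i j. i \<in> hd ` I \<Longrightarrow> j \<in> hd ` J \<Longrightarrow> i + j \<in> L \<and> i + j + 1 \<in> L) \<Longrightarrow>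
      (\<And>l. l \<in> L \<Longrightarrow> 0 \<le> M l) \<Longrightarrow> (\<And>i j. i \<in> hd ` I \<Longrightarrow> j \<in> hd ` J \<Longrightarrow> 0 \<le> F i j) \<Longrightarrow>
      (\<And>i j. i \<in> hd ` I \<Longrightarrow> j \<in> hd ` J \<Longrightarrow> F i j \<le> M (i + j) \<and> F i j \<le> M (i + j + 1)) \<Longrightarrow>
      (\<Sum>i\<in>hd ` I. \<Sum>j\<in>hd ` J. F i j * ?\<kappa> * f i powr (\<beta>\<^sup>2) * g j powr (\<alpha>\<^sup>2) * k i j powr ?\<theta>) \<le> sum M L"
    by (rule one_dimensional[OF wf wg \<alpha> \<beta> ab q]) blast
  define P where "P i j r \<longleftrightarrow> (\<forall>x\<in>fiber i I. \<forall>y\<in>fiber j J. 0 \<le> r x y) \<and>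
    (\<Sum>x\<in>fiber i I. \<Sum>y\<in>fiber j J. r x y) = ?m1 ^ n * (?cI i * ?cJ j) \<and>
    (\<Sum>x\<in>fiber i I. \<Sum>y\<in>fiber j J. (r x y)\<^sup>2) \<le> ?m2 ^ n * (?cI i * ?cJ j) \<and>
    (\<forall>\<Theta>. \<Theta> \<subseteq> fiber i I \<times> fiber j J \<longrightarrow> ?\<kappa> ^ n * ?cI i powr (-\<beta>\<^sup>2) * ?cJ j powr (-\<alpha>\<^sup>2) *
      (\<Sum>x\<in>fiber i I. \<Sum>y\<in>fiber j J. if (x, y) \<in> \<Theta> then r x y powr ?\<theta> else 0) \<le> real (card (grid_sum \<Theta>)))" for i j and r :: "int list \<Rightarrow> int list \<Rightarrow> real"
  have IH: "\<exists>r. P i j r" if i: "i \<in> hd ` I" and j: "j \<in> hd ` J" for i j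
    unfolding P_def
  proof (intro Suc.IH finite_fiber finI finJ)
    show "fiber i I \<noteq> {}" using fpos[OF i] by (auto simp: f_def)
    show "fiber j J \<noteq> {}" using gpos[OF j] by (auto simp: g_def)
  qed (use Suc.prems in \<open>fastforce simp: fiber_def\<close>)+
  define R where "R i j = (SOME r. P i j r)" for i j
  have RP: "P i j (R i j)" if "i \<in> hd ` I" "j \<in> hd ` J" for i j
    unfolding R_def by (rule someI_ex[OF IH[OF that]])
  have R: "\<And>i j x y. i \<in> hd ` I \<Longrightarrow> j \<in> hd ` J \<Longrightarrow> x \<in> fiber i I \<Longrightarrow> y \<in> fiber j J \<Longrightarrow> 0 \<le> R i j x y"
    "\<And>i j. i \<in> hd ` I \<Longrightarrow> j \<in> hd ` J \<Longrightarrow> (\<Sum>x\<in>fiber i I. \<Sum>y\<in>fiber j J. R i j x y) = ?m1 ^ n * (?cI i * ?cJ j)"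
    "\<And>i j. i \<in> hd ` I \<Longrightarrow> j \<in> hd ` J \<Longrightarrow> (\<Sum>x\<in>fiber i I. \<Sum>y\<in>fiber j J. (R i j x y)\<^sup>2) \<le> ?m2 ^ n * (?cI i * ?cJ j)"
    "\<And>i j \<Theta>. i \<in> hd ` I \<Longrightarrow> j \<in> hd ` J \<Longrightarrow> \<Theta> \<subseteq> fiber i I \<times> fiber j J \<Longrightarrow> ?\<kappa> ^ n * ?cI i powr (-\<beta>\<^sup>2) * ?cJ j powr (-\<alpha>\<^sup>2) *
      (\<Sum>x\<in>fiber i I. \<Sum>y\<in>fiber j J. if (x, y) \<in> \<Theta> then R i j x y powr ?\<theta> else 0) \<le> real (card (grid_sum \<Theta>))"
    using RP unfolding P_def by blast+
  define r where "r x y = k (hd x) (hd y) * R (hd x) (hd y) (tl x) (tl y)" for x y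
  have sum2: "(\<Sum>x\<in>I. \<Sum>y\<in>J. \<phi> x y) =
    (\<Sum>i\<in>hd ` I. \<Sum>j\<in>hd ` J. \<Sum>x\<in>fiber i I. \<Sum>y\<in>fiber j J. \<phi> (i # x) (j # y))" for \<phi> :: "_ \<Rightarrow> _ \<Rightarrow> real"
    by (rule sum_fiber2[OF finI ne(1) finJ ne(2)])
  have mono1: "(\<Sum>i\<in>hd ` I. \<Sum>j\<in>hd ` J. c * (real (card I) * real (card J)) * (f i * g j * w i j)) =
      c * (\<Sum>i\<in>hd ` I. \<Sum>j\<in>hd ` J. f i * g j * w i j) * (real (card I) * real (card J))" for c w
    by (simp add: sum_distrib_left sum_distrib_right mult_ac)
  have "(\<Sum>x\<in>I. \<Sum>y\<in>J. r x y) =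
      (\<Sum>i\<in>hd ` I. \<Sum>j\<in>hd ` J. k i j * (\<Sum>x\<in>fiber i I. \<Sum>y\<in>fiber j J. R i j x y))"
    unfolding sum2 by (simp add: r_def sum_distrib_left)
  also have "\<dots> = (\<Sum>i\<in>hd ` I. \<Sum>j\<in>hd ` J. ?m1 ^ n * (real (card I) * real (card J)) * (f i * g j * k i j))"
    by (intro sum.cong refl) (simp only: R(2) cIi cJj mult_ac)
  finally have r1: "(\<Sum>x\<in>I. \<Sum>y\<in>J. r x y) = ?m1 ^ Suc n * (real (card I) * real (card J))"
    unfolding mono1 k(2) by (simp add: mult_ac)
  have "(\<Sum>x\<in>I. \<Sum>y\<in>J. (r x y)\<^sup>2) =
      (\<Sum>i\<in>hd ` I. \<Sum>j\<in>hd ` J. (k i j)\<^sup>2 * (\<Sum>x\<in>fiber i I. \<Sum>y\<in>fiber j J. (R i j x y)\<^sup>2))"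
    unfolding sum2 by (simp add: r_def sum_distrib_left power_mult_distrib)
  also have "\<dots> \<le> (\<Sum>i\<in>hd ` I. \<Sum>j\<in>hd ` J. (k i j)\<^sup>2 * (?m2 ^ n * (?cI i * ?cJ j)))"
    by (intro sum_mono mult_left_mono R(3)) auto
  also have "\<dots> = (\<Sum>i\<in>hd ` I. \<Sum>j\<in>hd ` J. ?m2 ^ n * (real (card I) * real (card J)) * (f i * g j * (k i j)\<^sup>2))"
    by (intro sum.cong refl) (simp only: cIi cJj mult_ac)
  also have "\<dots> = ?m2 ^ n * (\<Sum>i\<in>hd ` I. \<Sum>j\<in>hd ` J. f i * g j * (k i j)\<^sup>2) * (real (card I) * real (card J))"
    by (rule mono1)
  also have "\<dots> \<le> ?m2 ^ n * ?m2 * (real (card I) * real (card J))"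
    using q(3) by (intro mult_right_mono mult_left_mono k(3)) auto
  finally have r2: "(\<Sum>x\<in>I. \<Sum>y\<in>J. (r x y)\<^sup>2) \<le> ?m2 ^ Suc n * (real (card I) * real (card J))"
    by (simp add: mult_ac)
  have r3: "?\<kappa> ^ Suc n * real (card I) powr (-\<beta>\<^sup>2) * real (card J) powr (-\<alpha>\<^sup>2) *
      (\<Sum>x\<in>I. \<Sum>y\<in>J. if (x, y) \<in> \<Theta> then r x y powr ?\<theta> else 0) \<le> real (card (grid_sum \<Theta>))"
    if \<Theta>: "\<Theta> \<subseteq> I \<times> J" for \<Theta>
  proof -
    define T where "T i j = {(x, y). (i # x, j # y) \<in> \<Theta>}" for i j
    have T: "T i j \<subseteq> fiber i I \<times> fiber j J" for i j using \<Theta> by (auto simp: T_def fiber_def)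
    define F where "F i j = real (card (grid_sum (T i j)))" for i j
    define M where "M l = real (card (fiber l (grid_sum \<Theta>)))" for l
    define L where "L = (\<lambda>(i, j). i + j) ` (hd ` I \<times> hd ` J) \<union> (\<lambda>(i, j). i + j + 1) ` (hd ` I \<times> hd ` J)"
    have fin\<Theta>: "finite \<Theta>" using \<Theta> finI finJ by (meson finite_SigmaI finite_subset)
    have fing: "finite (grid_sum \<Theta>)" by (rule finite_grid_sum[OF fin\<Theta>])
    \<comment> \<open>Prefixing either i + j or i + j + 1 embeds the sum over a pair of fibers into
      the sum over \<Theta>. Both embeddings are needed, because \<open>one_dimensional\<close> asks
      for a bound by both values of \<open>M\<close>.\<close>
    have sub: "grid_sum (T i j) \<subseteq> fiber (i + j) (grid_sum \<Theta>)" "grid_sum (T i j) \<subseteq> fiber (i + j + 1) (grid_sum \<Theta>)" for i j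
      by (auto simp: grid_sum_def fiber_def T_def) (metis near_sum_Cons)+
    have FM: "F i j \<le> M (i + j) \<and> F i j \<le> M (i + j + 1)" for i j
      unfolding F_def M_def by (intro conjI of_nat_mono card_mono sub finite_fiber[OF fing])
    have main: "(\<Sum>i\<in>hd ` I. \<Sum>j\<in>hd ` J. F i j * ?\<kappa> * f i powr (\<beta>\<^sup>2) * g j powr (\<alpha>\<^sup>2) * k i j powr ?\<theta>) \<le> sum M L"
      using finI finJ FM by (intro k(4)) (auto simp: L_def M_def F_def)
    have "sum M L \<le> real (card (grid_sum \<Theta>))"
    proof -
      have "sum M L = real (\<Sum>l\<in>L. card ((#) l ` fiber l (grid_sum \<Theta>)))"
        unfolding M_def by (simp add: card_image)
      also have "(\<Sum>l\<in>L. card ((#) l ` fiber l (grid_sum \<Theta>))) = card (\<Union>l\<in>L. (#) l ` fiber l (grid_sum \<Theta>))"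
        using finI finJ finite_fiber[OF fing] by (intro card_UN_disjoint[symmetric]) (auto simp: L_def)
      also have "\<dots> \<le> card (grid_sum \<Theta>)" using fing by (intro card_mono) (auto simp: fiber_def)
      finally show ?thesis by simp
    qed
    moreover have "?\<kappa> ^ Suc n * real (card I) powr (-\<beta>\<^sup>2) * real (card J) powr (-\<alpha>\<^sup>2) *
        (\<Sum>x\<in>I. \<Sum>y\<in>J. if (x, y) \<in> \<Theta> then r x y powr ?\<theta> else 0) \<le>
      (\<Sum>i\<in>hd ` I. \<Sum>j\<in>hd ` J. F i j * ?\<kappa> * f i powr (\<beta>\<^sup>2) * g j powr (\<alpha>\<^sup>2) * k i j powr ?\<theta>)"
    proof -
      define V where "V i j = (\<Sum>x\<in>fiber i I. \<Sum>y\<in>fiber j J. if (x, y) \<in> T i j then R i j x y powr ?\<theta> else 0)" for i j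
      have e1: "(\<Sum>x\<in>I. \<Sum>y\<in>J. if (x, y) \<in> \<Theta> then r x y powr ?\<theta> else 0) =
        (\<Sum>i\<in>hd ` I. \<Sum>j\<in>hd ` J. k i j powr ?\<theta> * V i j)"
        unfolding sum2 V_def sum_distrib_left
        by (intro sum.cong refl) (auto simp: r_def T_def powr_mult k(1) R(1))
      have "?\<kappa> ^ Suc n * real (card I) powr (-\<beta>\<^sup>2) * real (card J) powr (-\<alpha>\<^sup>2) *
        (\<Sum>x\<in>I. \<Sum>y\<in>J. if (x, y) \<in> \<Theta> then r x y powr ?\<theta> else 0) =
        (\<Sum>i\<in>hd ` I. \<Sum>j\<in>hd ` J. (?\<kappa> ^ n * real (card I) powr (-\<beta>\<^sup>2) * real (card J) powr (-\<alpha>\<^sup>2) * V i j) * (?\<kappa> * k i j powr ?\<theta>))"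
        unfolding e1 sum_distrib_left by (intro sum.cong refl) (simp only: power_Suc mult_ac)
      also have "\<dots> \<le> (\<Sum>i\<in>hd ` I. \<Sum>j\<in>hd ` J. (F i j * f i powr (\<beta>\<^sup>2) * g j powr (\<alpha>\<^sup>2)) * (?\<kappa> * k i j powr ?\<theta>))"
      proof (intro sum_mono mult_right_mono)
        fix i j assume i: "i \<in> hd ` I" and j: "j \<in> hd ` J"
        \<comment> \<open>A fiber has \<open>f i\<close> times the cardinality of \<open>I\<close>,
          so the negative powers of the full cardinalities are those of the fibers times exactly the
          powers of \<open>f\<close> and \<open>g\<close> supplied by dimension one.\<close>
        have e: "real (card I) powr (-\<beta>\<^sup>2) = ?cI i powr (-\<beta>\<^sup>2) * f i powr (\<beta>\<^sup>2)"
          "real (card J) powr (-\<alpha>\<^sup>2) = ?cJ j powr (-\<alpha>\<^sup>2) * g j powr (\<alpha>\<^sup>2)"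
          using fpos[OF i] gpos[OF j] cI cJ by (auto simp: cIi cJj powr_mult powr_minus)
        have "?\<kappa> ^ n * ?cI i powr (-\<beta>\<^sup>2) * ?cJ j powr (-\<alpha>\<^sup>2) * V i j * (f i powr (\<beta>\<^sup>2) * g j powr (\<alpha>\<^sup>2)) \<le> F i j * (f i powr (\<beta>\<^sup>2) * g j powr (\<alpha>\<^sup>2))"
          unfolding V_def F_def by (intro mult_right_mono R(4)[OF i j T]) auto
        then show "?\<kappa> ^ n * real (card I) powr (-\<beta>\<^sup>2) * real (card J) powr (-\<alpha>\<^sup>2) * V i j \<le> F i j * f i powr (\<beta>\<^sup>2) * g j powr (\<alpha>\<^sup>2)"
          unfolding e by (simp only: mult_ac)
      qed auto
      also have "\<dots> = (\<Sum>i\<in>hd ` I. \<Sum>j\<in>hd ` J. F i j * ?\<kappa> * f i powr (\<beta>\<^sup>2) * g j powr (\<alpha>\<^sup>2) * k i j powr ?\<theta>)"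
        by (intro sum.cong refl) (simp only: mult_ac)
      finally show ?thesis .
    qed
    ultimately show ?thesis using main by linarith
  qed
  have r0: "0 \<le> r x y" if "x \<in> I" "y \<in> J" for x y
  proof -
    have "hd x \<in> hd ` I" "hd y \<in> hd ` J" "tl x \<in> fiber (hd x) I" "tl y \<in> fiber (hd y) J"
      using that ne by (auto simp: fiber_def)
    then show ?thesis unfolding r_def by (intro mult_nonneg_nonneg k(1) R(1))
  qed
  show ?case using r0 r1 r2 r3 by (intro exI[of _ r]) blast
qed

text \<open>The total of r exceeds the number of pairs by at least the factor 1 + \<delta>^2/2, and
  its second moment is at most twice that number. Removing a proportion \<delta>^4/8 of the pairs
  therefore loses at most \<delta>^2/2 times their number, so the total over \<Theta> alone still
  reaches the number of all pairs. Jensen's inequality then passes to the power \<theta>. The last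
  hypothesis says that \<delta> / sqrt n \<le> \<alpha>\<beta>.\<close>

lemma discrete_restricted_sum:
  fixes \<delta> :: real
  assumes n: "1 \<le> n" and \<delta>: "0 < \<delta>" "\<delta>\<^sup>2 \<le> 1 / 8"
    and I: "finite I" "I \<noteq> {}" "\<And>x. x \<in> I \<Longrightarrow> length x = n"
    and J: "finite J" "J \<noteq> {}" "\<And>x. x \<in> J \<Longrightarrow> length x = n"
    and \<Theta>: "\<Theta> \<subseteq> I \<times> J" "(1 - \<delta> ^ 4 / 8) * (real (card I) * real (card J)) \<le> real (card \<Theta>)"
  defines "a \<equiv> real (card I) powr (1 / n)" and "b \<equiv> real (card J) powr (1 / n)"
  assumes ab: "\<delta> * (a\<^sup>2 + b\<^sup>2) \<le> a * b * sqrt n"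
  shows "(a\<^sup>2 + b\<^sup>2) powr (n / 2) \<le> real (card (grid_sum \<Theta>))"
proof -
  have cI: "0 < real (card I)" and cJ: "0 < real (card J)" using I J by (auto simp: card_gt_0_iff)
  then have a: "0 < a" and b: "0 < b" by (auto simp: a_def b_def)
  have n0: "0 < real n" using n by simp
  define c where "c = sqrt (a\<^sup>2 + b\<^sup>2)"
  have s0: "0 < a\<^sup>2 + b\<^sup>2" using a b by (simp add: add_pos_pos)
  have c: "0 < c" "c\<^sup>2 = a\<^sup>2 + b\<^sup>2" using s0 by (auto simp: c_def)
  define \<alpha> where "\<alpha> = a / c"
  define \<beta> where "\<beta> = b / c"
  have \<alpha>: "\<alpha> > 0" and \<beta>: "\<beta> > 0" using a b c by (auto simp: \<alpha>_def \<beta>_def)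
  have sq: "\<alpha>\<^sup>2 + \<beta>\<^sup>2 = 1" using c(1) s0
    by (simp add: \<alpha>_def \<beta>_def power_divide add_divide_distrib[symmetric] c(2)[symmetric] del: c)
  \<comment> \<open>Scaled so that n q^2 = \<delta>^2, which controls the n-th powers of the
    one-dimensional moments uniformly in n.\<close>
  define q where "q = \<delta> / sqrt n"
  have q0: "0 < q" using \<delta> n0 by (simp add: q_def)
  have qq: "real n * q\<^sup>2 = \<delta>\<^sup>2" using n0 by (simp add: q_def power_divide)
  have q1: "q \<le> \<alpha> * \<beta>"
  proof -
    have "\<alpha> * \<beta> = a * b / c\<^sup>2" by (simp add: \<alpha>_def \<beta>_def power2_eq_square)
    then have "\<alpha> * \<beta> = a * b / (a\<^sup>2 + b\<^sup>2)" by (simp only: c(2))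
    then show ?thesis using ab n0 s0 by (simp add: q_def field_simps)
  qed
  have qle: "q\<^sup>2 \<le> \<delta>\<^sup>2"
  proof -
    have "1 * q\<^sup>2 \<le> real n * q\<^sup>2" using n by (intro mult_right_mono) auto
    then show ?thesis using qq by simp
  qed
  then have q2: "4 * q\<^sup>2 < 1" using \<delta> by linarith
  let ?N = "real (card I) * real (card J)" and ?\<theta> = "\<alpha> * \<beta> / q"
  let ?m1 = "1 / sqrt (1 - q\<^sup>2)" and ?m2 = "1 / sqrt (1 - 4 * q\<^sup>2)"
  obtain r where r0': "\<forall>x\<in>I. \<forall>y\<in>J. 0 \<le> r x y"
    and r1: "(\<Sum>x\<in>I. \<Sum>y\<in>J. r x y) = ?m1 ^ n * ?N"
    and r2: "(\<Sum>x\<in>I. \<Sum>y\<in>J. (r x y)\<^sup>2) \<le> ?m2 ^ n * ?N"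
    and r3': "\<forall>\<Theta>. \<Theta> \<subseteq> I \<times> J \<longrightarrow> (\<alpha> powr (-\<alpha>\<^sup>2) * \<beta> powr (-\<beta>\<^sup>2)) ^ n * real (card I) powr (-\<beta>\<^sup>2) * real (card J) powr (-\<alpha>\<^sup>2) *
      (\<Sum>x\<in>I. \<Sum>y\<in>J. if (x, y) \<in> \<Theta> then r x y powr ?\<theta> else 0) \<le> real (card (grid_sum \<Theta>))"
    by (rule exE[OF discrete_tensor[where I=I and J=J and n=n, OF \<alpha> \<beta> sq q0 q1 q2 I J]])
      (assumption | elim conjE | rule that)+
  note r0 = r0'[rule_format] and r3 = r3'[rule_format, OF \<Theta>(1)]
  \<comment> \<open>For x = q^2, the estimate (1 + x/2)^2 (1 - x) \<le> 1 bounds a single factor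
    from below. Bernoulli's inequality then turns the n-th power into n q^2 = \<delta>^2.\<close>
  have m1: "1 + \<delta>\<^sup>2 / 2 \<le> ?m1 ^ n"
  proof -
    define x where "x = q\<^sup>2"
    have x: "0 \<le> x" "x < 1" using q2 by (auto simp: x_def)
    have "(2 + x)\<^sup>2 * (1 - x) = 4 - (3 * x\<^sup>2 + x * x\<^sup>2)"
      by (simp add: power2_eq_square algebra_simps)
    also have "\<dots> \<le> 4" using mult_nonneg_nonneg[OF x(1) zero_le_power2[of x]] zero_le_power2[of x] by linarith
    finally have "((2 + x) / 2)\<^sup>2 * (1 - x) \<le> 1" by (simp add: power_divide)
    then have "((2 + x) / 2)\<^sup>2 \<le> 1 / (1 - x)" using x(2) by (simp add: pos_le_divide_eq)
    moreover have "(2 + x) / 2 = 1 + x / 2" by simp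
    ultimately have "(1 + q\<^sup>2 / 2)\<^sup>2 \<le> 1 / (1 - q\<^sup>2)" unfolding x_def by simp
    then have "sqrt ((1 + q\<^sup>2 / 2)\<^sup>2) \<le> sqrt (1 / (1 - q\<^sup>2))" by (rule real_sqrt_le_mono)
    then have "1 + q\<^sup>2 / 2 \<le> ?m1" by (simp add: real_sqrt_divide add_nonneg_nonneg)
    then have "(1 + q\<^sup>2 / 2) ^ n \<le> ?m1 ^ n" by (intro power_mono) (auto simp: add_nonneg_nonneg)
    moreover have "1 + real n * (q\<^sup>2 / 2) \<le> (1 + q\<^sup>2 / 2) ^ n"
      by (rule Bernoulli_inequality) (use zero_le_power2[of q] in linarith)
    ultimately show ?thesis using qq by simp
  qed
  \<comment> \<open>Bernoulli again: (1 - 4 q^2)^n is at least 1 - 4\<delta>^2, hence at least 1/4,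
    and its square root is at least 1/2.\<close>
  have m2: "?m2 ^ n \<le> 2"
  proof -
    have "1 + real n * (- (4 * q\<^sup>2)) \<le> (1 + - (4 * q\<^sup>2)) ^ n"
      by (rule Bernoulli_inequality) (use q2 in simp)
    then have "1 / 4 \<le> (1 - 4 * q\<^sup>2) ^ n" using qq \<delta> by (simp add: algebra_simps)
    then have "sqrt (1 / 4) \<le> sqrt ((1 - 4 * q\<^sup>2) ^ n)" by (rule real_sqrt_le_mono)
    moreover have "sqrt (1 / 4) = 1 / 2" by (simp add: real_sqrt_divide)
    ultimately have "1 / 2 \<le> sqrt (1 - 4 * q\<^sup>2) ^ n" by (simp add: real_sqrt_power)
    then have "1 / sqrt (1 - 4 * q\<^sup>2) ^ n \<le> 1 / (1 / 2)" by (intro divide_left_mono) auto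
    then show ?thesis by (simp only: power_one_over) simp
  qed
  have fin: "finite \<Theta>" using \<Theta>(1) I(1) J(1) by (meson finite_SigmaI finite_subset)
  have card: "(\<Sum>x\<in>I. \<Sum>y\<in>J. if (x, y) \<in> \<Theta> then 1 else 0) = real (card \<Theta>)"
  proof -
    have "(\<Sum>x\<in>I. \<Sum>y\<in>J. if (x, y) \<in> \<Theta> then 1 else 0) = (\<Sum>z\<in>I \<times> J. if z \<in> \<Theta> then 1 else 0 :: real)"
      by (simp add: sum.cartesian_product)
    also have "\<dots> = (\<Sum>z\<in>\<Theta>. 1)"
      using \<Theta>(1) I(1) J(1) by (subst sum.inter_restrict[symmetric]) (auto simp: Int_absorb1)
    finally show ?thesis by simp
  qed
  have off: "(\<Sum>x\<in>I. \<Sum>y\<in>J. if (x, y) \<in> \<Theta> then 0 else r x y) \<le> \<delta>\<^sup>2 / 2 * ?N"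
  proof -
    have "(\<Sum>x\<in>I. \<Sum>y\<in>J. if (x, y) \<in> \<Theta> then 0 else r x y) \<le>
       (\<Sum>x\<in>I. \<Sum>y\<in>J. \<delta>\<^sup>2 / 8 * (r x y)\<^sup>2 + 2 / \<delta>\<^sup>2 * (1 - (if (x, y) \<in> \<Theta> then 1 else 0)))"
    proof (intro sum_mono)
      fix x y
      \<comment> \<open>Cauchy-Schwarz in the form r \<le> (\<delta>^2/8) r^2 + 2/\<delta>^2. With
        these coefficients the second moment and the missing pairs each contribute at most
        \<delta>^2/4 times \<open>?N\<close>.\<close>
      have "0 \<le> (\<delta>\<^sup>2 * r x y - 4)\<^sup>2 / (8 * \<delta>\<^sup>2)" by simp
      also have "\<dots> = \<delta>\<^sup>2 / 8 * (r x y)\<^sup>2 + 2 / \<delta>\<^sup>2 - r x y"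
        using \<delta>(1) by (simp add: power2_eq_square field_simps)
      finally show "(if (x, y) \<in> \<Theta> then 0 else r x y) \<le>
        \<delta>\<^sup>2 / 8 * (r x y)\<^sup>2 + 2 / \<delta>\<^sup>2 * (1 - (if (x, y) \<in> \<Theta> then 1 else 0))" by simp
    qed
    also have "\<dots> = \<delta>\<^sup>2 / 8 * (\<Sum>x\<in>I. \<Sum>y\<in>J. (r x y)\<^sup>2) +
        2 / \<delta>\<^sup>2 * (\<Sum>x\<in>I. \<Sum>y\<in>J. 1 - (if (x, y) \<in> \<Theta> then 1 else 0))"
      by (simp only: sum.distrib sum_distrib_left)
    also have "\<dots> = \<delta>\<^sup>2 / 8 * (\<Sum>x\<in>I. \<Sum>y\<in>J. (r x y)\<^sup>2) + 2 / \<delta>\<^sup>2 * (?N - card \<Theta>)"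
      unfolding card[symmetric] sum_subtractf by simp
    also have "\<dots> \<le> \<delta>\<^sup>2 / 8 * (2 * ?N) + 2 / \<delta>\<^sup>2 * (\<delta> ^ 4 / 8 * ?N)"
    proof (intro add_mono mult_left_mono)
      show "(\<Sum>x\<in>I. \<Sum>y\<in>J. (r x y)\<^sup>2) \<le> 2 * ?N"
        using r2 mult_right_mono[OF m2, of ?N] by simp
      show "?N - card \<Theta> \<le> \<delta> ^ 4 / 8 * ?N" using \<Theta>(2) by (simp add: algebra_simps)
    qed auto
    also have "\<dots> = \<delta>\<^sup>2 / 2 * ?N" using \<delta>(1) by (simp add: field_simps power2_eq_square power4_eq_xxxx)
    finally show ?thesis .
  qed
  let ?on = "\<Sum>x\<in>I. \<Sum>y\<in>J. if (x, y) \<in> \<Theta> then r x y else 0"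
  have "(\<Sum>x\<in>I. \<Sum>y\<in>J. r x y) = ?on + (\<Sum>x\<in>I. \<Sum>y\<in>J. if (x, y) \<in> \<Theta> then 0 else r x y)"
    unfolding sum.distrib[symmetric] by (intro sum.cong refl) simp
  moreover have "(1 + \<delta>\<^sup>2 / 2) * ?N \<le> ?m1 ^ n * ?N" using m1 by (intro mult_right_mono) auto
  ultimately have on: "?N \<le> ?on" using off r1 by (simp add: algebra_simps)
  have cT: "real (card \<Theta>) \<le> ?N"
    using card_mono[OF _ \<Theta>(1)] I(1) J(1) by (simp add: card_cartesian_product flip: of_nat_mult)
  have th: "1 \<le> ?\<theta>" using q0 q1 by simp
  \<comment> \<open>The tangents at 1, summed over \<Theta>, give card \<Theta> + \<theta>
    (\<open>?on\<close> - card \<Theta>). As \<open>?on\<close> \<ge> \<open>?N\<close> \<ge> card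
    \<Theta> and \<theta> \<ge> 1, this is at least \<open>?N\<close>.\<close>
  have "?N \<le> real (card \<Theta>) + 1 * (?on - real (card \<Theta>))" using on by simp
  also have "\<dots> \<le> real (card \<Theta>) + ?\<theta> * (?on - real (card \<Theta>))"
    using th on cT by (intro add_left_mono mult_right_mono) auto
  also have "\<dots> = (\<Sum>x\<in>I. \<Sum>y\<in>J. (if (x, y) \<in> \<Theta> then 1 else 0) + ?\<theta> * ((if (x, y) \<in> \<Theta> then r x y else 0) - (if (x, y) \<in> \<Theta> then 1 else 0)))"
    unfolding card[symmetric] by (simp only: sum.distrib sum_distrib_left[symmetric] sum_subtractf)
  also have "\<dots> \<le> (\<Sum>x\<in>I. \<Sum>y\<in>J. if (x, y) \<in> \<Theta> then r x y powr ?\<theta> else 0)"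
    using bernoulli_powr[OF r0 th] by (intro sum_mono) auto
  finally have S: "?N \<le> (\<Sum>x\<in>I. \<Sum>y\<in>J. if (x, y) \<in> \<Theta> then r x y powr ?\<theta> else 0)" .
  let ?K = "(\<alpha> powr (-\<alpha>\<^sup>2) * \<beta> powr (-\<beta>\<^sup>2)) ^ n * real (card I) powr (-\<beta>\<^sup>2) * real (card J) powr (-\<alpha>\<^sup>2)"
  have an: "real (card I) = a ^ n" "real (card J) = b ^ n"
    using cI cJ n0 a b by (auto simp: a_def b_def powr_realpow[symmetric] powr_powr)
  have "(a\<^sup>2 + b\<^sup>2) powr (n / 2) = c ^ n"
  proof -
    have "c powr 2 = a\<^sup>2 + b\<^sup>2" using c by simp
    then have "(a\<^sup>2 + b\<^sup>2) powr (n / 2) = (c powr 2) powr (n / 2)" by simp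
    also have "\<dots> = c powr n" by (simp add: powr_powr)
    finally show ?thesis using c(1) by (simp add: powr_realpow)
  qed
  \<comment> \<open>Here c = a / \<alpha> = b / \<beta>, so splitting c along the exponents
    \<alpha>^2 + \<beta>^2 = 1 produces the AM-GM prefactor.\<close>
  also have "\<dots> = (c powr (\<alpha>\<^sup>2 + \<beta>\<^sup>2)) ^ n" using c(1) by (simp add: sq)
  also have "\<dots> = ((a / \<alpha>) powr \<alpha>\<^sup>2 * (b / \<beta>) powr \<beta>\<^sup>2) ^ n"
    using a b c(1) by (simp add: \<alpha>_def \<beta>_def powr_add)
  also have "\<dots> = (\<alpha> powr (-\<alpha>\<^sup>2) * \<beta> powr (-\<beta>\<^sup>2) * a powr (\<alpha>\<^sup>2) * b powr (\<beta>\<^sup>2)) ^ n"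
    using a b \<alpha> \<beta> by (simp add: powr_divide powr_minus field_simps)
  also have "\<dots> = ?K * ?N"
  proof -
    have s: "\<alpha>\<^sup>2 = 1 + - \<beta>\<^sup>2" "\<beta>\<^sup>2 = 1 + - \<alpha>\<^sup>2" using sq by auto
    have e: "a powr (1 + - \<beta>\<^sup>2) = a * a powr (- \<beta>\<^sup>2)" "b powr (1 + - \<alpha>\<^sup>2) = b * b powr (- \<alpha>\<^sup>2)"
      using a b by (simp_all only: powr_add powr_one order_less_imp_le)
    have p: "(x ^ n) powr y = (x powr y) ^ n" if "0 < x" for x y :: real
      using that by (simp add: powr_realpow[symmetric] powr_powr mult.commute)
    have e': "a powr (\<alpha>\<^sup>2) = a * a powr (- \<beta>\<^sup>2)" "b powr (\<beta>\<^sup>2) = b * b powr (- \<alpha>\<^sup>2)"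
      by (subst s(1), rule e(1)) (subst s(2), rule e(2))
    show ?thesis unfolding e' an p[OF a] p[OF b] by (simp only: power_mult_distrib mult_ac)
  qed
  also have "\<dots> \<le> ?K * (\<Sum>x\<in>I. \<Sum>y\<in>J. if (x, y) \<in> \<Theta> then r x y powr ?\<theta> else 0)"
    by (intro mult_left_mono S) auto
  finally show ?thesis using r3 by linarith
qed

section \<open>Approximation by grid cells\<close>


abbreviation lborel_n :: "nat \<Rightarrow> (nat \<Rightarrow> real) measure" where
  "lborel_n n \<equiv> \<Pi>\<^sub>M i\<in>{..<n}. lborel"

lemma product_sigma_finite_lborel: "product_sigma_finite (\<lambda>_::nat. lborel :: real measure)"
  by unfold_locales

lemma sigma_finite_lborel_n: "sigma_finite_measure (lborel_n n)"
proof -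
  interpret product_sigma_finite "\<lambda>_::nat. lborel :: real measure" by (rule product_sigma_finite_lborel)
  show ?thesis by (rule sigma_finite) simp
qed

lemma space_lborel_n: "space (lborel_n n) = extensional {..<n}"
  by (simp add: space_PiM PiE_UNIV_domain PiE_def)

lemma emeasure_lborel_n_box:
  assumes "\<And>i. i < n \<Longrightarrow> S i \<in> sets borel"
  shows "emeasure (lborel_n n) (\<Pi>\<^sub>E i\<in>{..<n}. S i) = (\<Prod>i<n. emeasure lborel (S i))"
proof -
  interpret product_sigma_finite "\<lambda>_::nat. lborel :: real measure" by (rule product_sigma_finite_lborel)
  show ?thesis using assms by (intro emeasure_PiM) auto
qed

lemma tendsto_fun:
  fixes f :: "'b \<Rightarrow> 'a \<Rightarrow> 'c::topological_space"
  assumes "\<And>i. ((\<lambda>c. f c i) \<longlongrightarrow> l i) F"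
  shows "(f \<longlongrightarrow> l) F"
  using limitin_componentwise[of "\<lambda>_. euclidean" UNIV f l F] assms
  by (simp add: euclidean_product_topology)

text \<open>This compares the finite product \<sigma>-algebra with the Borel sets of the topological
  space nat \<Rightarrow> real, where compactness and inner regularity live. Coordinates from n on
  are the constant \<open>undefined\<close> throughout the carrier.\<close>

lemma id_measurable_lborel_n: "(\<lambda>x. x) \<in> lborel_n n \<rightarrow>\<^sub>M borel"
proof (rule measurable_coordinatewise_then_product)
  fix i
  show "(\<lambda>x. x i) \<in> borel_measurable (lborel_n n)"
  proof (cases "i < n")
    case False
    have "(\<lambda>x. x i) \<in> borel_measurable (lborel_n n) \<longleftrightarrow> (\<lambda>x. undefined :: real) \<in> borel_measurable (lborel_n n)"
      using False by (intro measurable_cong) (auto simp: space_lborel_n extensional_def)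
    then show ?thesis by simp
  qed measurable
qed

lemma extensional_borel: "extensional {..<n} \<in> sets (borel :: (nat \<Rightarrow> real) measure)"
proof -
  have "extensional {..<n} = (\<Inter>i\<in>{n..}. {x::nat \<Rightarrow> real. x i = undefined})"
    by (auto simp: extensional_def)
  also have "\<dots> \<in> sets borel"
    by (intro sets.countable_INT') (auto intro!: measurable_sets_borel[OF measurable_product_coordinates])
  finally show ?thesis .
qed

lemma restrict_measurable_lborel_n: "(\<lambda>x. restrict x {..<n}) \<in> borel \<rightarrow>\<^sub>M lborel_n n"
  by (rule measurable_restrict) simp

lemma sets_lborel_n_borel:
  assumes "A \<in> sets (lborel_n n)" shows "A \<in> sets borel"
proof -
  have A: "A \<subseteq> extensional {..<n}" using sets.sets_into_space[OF assms] by (simp add: space_lborel_n)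
  then have "A = ((\<lambda>x. restrict x {..<n}) -` A \<inter> space borel) \<inter> extensional {..<n}"
    by (auto simp: extensional_restrict subset_iff)
  moreover have "(\<lambda>x. restrict x {..<n}) -` A \<inter> space borel \<in> sets borel"
    by (rule measurable_sets[OF restrict_measurable_lborel_n assms])
  ultimately show ?thesis using sets.Int[OF _ extensional_borel] by metis
qed

lemma id_measurable_lborel_2n: "(\<lambda>x. x) \<in> lborel_n n \<Otimes>\<^sub>M lborel_n n \<rightarrow>\<^sub>M borel"
proof -
  have "(\<lambda>x. (fst x, snd x)) \<in> lborel_n n \<Otimes>\<^sub>M lborel_n n \<rightarrow>\<^sub>M borel \<Otimes>\<^sub>M borel"
    by (intro measurable_Pair measurable_compose[OF measurable_fst id_measurable_lborel_n]
      measurable_compose[OF measurable_snd id_measurable_lborel_n])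
  then show ?thesis by (simp add: borel_prod)
qed

lemma sets_lborel_2n_borel:
  assumes "A \<in> sets (lborel_n n \<Otimes>\<^sub>M lborel_n n)" shows "A \<in> sets borel"
proof -
  have A: "A \<subseteq> extensional {..<n} \<times> extensional {..<n}"
    using sets.sets_into_space[OF assms] by (simp add: space_pair_measure space_lborel_n)
  let ?r = "\<lambda>x. (restrict (fst x) {..<n}, restrict (snd x) {..<n}) :: (nat \<Rightarrow> real) \<times> (nat \<Rightarrow> real)"
  have e: "A = (?r -` A \<inter> space borel) \<inter> (extensional {..<n} \<times> extensional {..<n})"
    using A by (force simp: extensional_restrict)
  have 1: "?r -` A \<inter> space (borel \<Otimes>\<^sub>M borel) \<in> sets (borel \<Otimes>\<^sub>M borel)"
    by (rule measurable_sets[OF _ assms])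
      (intro measurable_Pair measurable_compose[OF measurable_fst restrict_measurable_lborel_n]
      measurable_compose[OF measurable_snd restrict_measurable_lborel_n])
  have 2: "extensional {..<n} \<times> extensional {..<n} \<in> sets (borel \<Otimes>\<^sub>M borel :: ((nat \<Rightarrow> real) \<times> (nat \<Rightarrow> real)) measure)"
    by (intro pair_measureI extensional_borel)
  have "(?r -` A \<inter> space borel) \<inter> (extensional {..<n} \<times> extensional {..<n}) \<in> sets (borel \<Otimes>\<^sub>M borel)"
    using sets.Int[OF 1 2] by (simp add: space_pair_measure)
  then show ?thesis unfolding e[symmetric] borel_prod .
qed

text \<open>Inner regularity concerns finite Borel measures on a whole type, whereas
  \<open>M\<close> may be infinite and have a smaller carrier. So \<open>M\<close> is cut down to
  \<open>A\<close> and pushed to the Borel sets by the identity.\<close>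

lemma inner_compact:
  fixes M :: "'a::{second_countable_topology, complete_space} measure"
  assumes id: "(\<lambda>x. x) \<in> M \<rightarrow>\<^sub>M borel" and A: "A \<in> sets M" "A \<in> sets borel"
    and fin: "emeasure M A < \<infinity>" and e: "0 < e"
  obtains K where "compact K" "K \<subseteq> A" "K \<in> sets M" "measure M A \<le> measure M K + e"
proof -
  define N where "N = distr (density M (indicator A)) borel (\<lambda>x. x)"
  have id': "(\<lambda>x. x) \<in> density M (indicator A) \<rightarrow>\<^sub>M borel" using id by simp
  have sp: "A \<subseteq> space M" using A(1) by (rule sets.sets_into_space)
  have N: "emeasure N S = emeasure M (A \<inter> S)" if S: "S \<in> sets borel" for S
  proof -
    have S': "S \<inter> space M \<in> sets M" using measurable_sets[OF id S] by simp
    have "emeasure N S = emeasure (density M (indicator A)) (S \<inter> space M)"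
      unfolding N_def using S by (subst emeasure_distr[OF id']) auto
    also have "\<dots> = (\<integral>\<^sup>+x. indicator (A \<inter> S) x \<partial>M)"
      using S' A by (subst emeasure_density) (auto intro!: nn_integral_cong simp: indicator_def)
    also have "\<dots> = emeasure M (A \<inter> S)"
    proof (rule nn_integral_indicator)
      have "A \<inter> S = A \<inter> (S \<inter> space M)" using sp by auto
      then show "A \<inter> S \<in> sets M" using A S' by auto
    qed
    finally show ?thesis .
  qed
  have "emeasure N (space N) = emeasure M A" using N[of UNIV] by (simp add: N_def)
  then have "emeasure N A = (SUP K \<in> {K. K \<subseteq> A \<and> compact K}. emeasure N K)"
    using fin A by (intro inner_regular) (auto simp: N_def)
  moreover have NA: "emeasure N A = emeasure M A" using N[OF A(2)] by simp
  ultimately have SUP: "emeasure M A = (SUP K \<in> {K. K \<subseteq> A \<and> compact K}. emeasure N K)" by simp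
  \<comment> \<open>If every compact subset fell short by e, then so would the supremum of their
    measures.\<close>
  have "\<exists>K. K \<subseteq> A \<and> compact K \<and> emeasure M A \<le> emeasure N K + ennreal e"
  proof (rule ccontr)
    assume "\<not> ?thesis"
    then have le: "emeasure N K + ennreal e \<le> emeasure M A" if "K \<subseteq> A" "compact K" for K
      using that by (meson le_cases)
    have "emeasure N K \<le> emeasure M A - ennreal e" if "K \<subseteq> A" "compact K" for K
      using le[OF that] by (simp add: ennreal_le_minus_iff add.commute)
    then have "emeasure M A \<le> emeasure M A - ennreal e"
      unfolding SUP by (intro SUP_least) (auto simp: SUP)
    moreover have "ennreal e \<le> emeasure M A" using le[of "{}"] by simp
    moreover have eq: "emeasure M A = ennreal (measure M A)"
      using fin by (intro emeasure_eq_ennreal_measure) auto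
    ultimately have "ennreal (measure M A) \<le> ennreal (measure M A - e)" "ennreal e \<le> ennreal (measure M A)"
      using e by (simp_all add: ennreal_minus)
    then show False using e by (simp add: ennreal_le_iff2)
  qed
  then obtain K where K: "K \<subseteq> A" "compact K" "emeasure M A \<le> emeasure N K + ennreal e" by blast
  have Kb: "K \<in> sets borel" using K(2) by (simp add: compact_imp_closed)
  have KM: "K \<in> sets M"
  proof -
    have "K \<inter> space M \<in> sets M" using measurable_sets[OF id Kb] by simp
    moreover have "K \<inter> space M = K" using K(1) sp by auto
    ultimately show ?thesis by simp
  qed
  have "emeasure N K = emeasure M K" using N[OF Kb] K(1) by (simp add: Int_absorb1)
  moreover have "emeasure M K < \<infinity>" using emeasure_mono[OF K(1) A(1)] fin by (rule le_less_trans)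
  ultimately have "measure M A \<le> measure M K + e"
    using K(3) fin e by (simp add: emeasure_eq_ennreal_measure less_top ennreal_plus[symmetric] del: ennreal_plus)
  then show ?thesis using that K KM by blast
qed

lemma compact_lborel_n_sets:
  assumes "compact K" "K \<subseteq> extensional {..<n}" shows "K \<in> sets (lborel_n n)"
proof -
  have "(\<lambda>x. x) -` K \<inter> space (lborel_n n) \<in> sets (lborel_n n)"
    using assms(1) by (intro measurable_sets[OF id_measurable_lborel_n]) (simp add: compact_imp_closed)
  moreover have "(\<lambda>x. x) -` K \<inter> space (lborel_n n) = K" using assms(2) by (auto simp: space_lborel_n)
  ultimately show ?thesis by simp
qed

text \<open>The mesh is \<open>1 / Suc m\<close>, which avoids a junk value at \<open>m = 0\<close>.\<close>

definition cell_index :: "nat \<Rightarrow> nat \<Rightarrow> (nat \<Rightarrow> real) \<Rightarrow> int list" where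
  "cell_index m n x = map (\<lambda>i. \<lfloor>x i * real (Suc m)\<rfloor>) [0..<n]"

lemma length_cell_index [simp]: "length (cell_index m n x) = n"
  by (simp add: cell_index_def)

lemma nth_cell_index: "i < n \<Longrightarrow> cell_index m n x ! i = \<lfloor>x i * real (Suc m)\<rfloor>"
  by (simp add: cell_index_def)

definition cells :: "nat \<Rightarrow> nat \<Rightarrow> int list set \<Rightarrow> (nat \<Rightarrow> real) set" where
  "cells m n Z = {x \<in> extensional {..<n}. cell_index m n x \<in> Z}"

lemma cell_box:
  assumes "length z = n"
  shows "cells m n {z} = (\<Pi>\<^sub>E i\<in>{..<n}. {real_of_int (z ! i) / real (Suc m)..<(real_of_int (z ! i) + 1) / real (Suc m)})"
    (is "_ = ?R")
proof -
  have s: "0 < real (Suc m)" by simp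
  have "cell_index m n x = z \<longleftrightarrow> (\<forall>i<n. \<lfloor>x i * real (Suc m)\<rfloor> = z ! i)" for x
    using assms by (auto simp: list_eq_iff_nth_eq nth_cell_index)
  moreover have "\<lfloor>x i * real (Suc m)\<rfloor> = z ! i \<longleftrightarrow>
      real_of_int (z ! i) / real (Suc m) \<le> x i \<and> x i < (real_of_int (z ! i) + 1) / real (Suc m)" for x i
    unfolding floor_eq_iff pos_divide_le_eq[OF s] pos_less_divide_eq[OF s] ..
  ultimately show ?thesis by (auto simp: cells_def PiE_def Pi_def)
qed

lemma cell_measure:
  assumes "length z = n"
  shows "cells m n {z} \<in> sets (lborel_n n)"
    "emeasure (lborel_n n) (cells m n {z}) = ennreal ((1 / real (Suc m)) ^ n)"
proof -
  show "cells m n {z} \<in> sets (lborel_n n)" unfolding cell_box[OF assms] by (intro sets_PiM_I_finite) auto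
  have "emeasure (lborel_n n) (cells m n {z}) = (\<Prod>i<n. ennreal (1 / real (Suc m)))"
    unfolding cell_box[OF assms]
    by (subst emeasure_lborel_n_box) (auto intro!: prod.cong simp: divide_right_mono diff_divide_distrib[symmetric])
  then show "emeasure (lborel_n n) (cells m n {z}) = ennreal ((1 / real (Suc m)) ^ n)"
    by (simp add: ennreal_power)
qed

lemma cells_measure:
  assumes "finite Z" "\<And>z. z \<in> Z \<Longrightarrow> length z = n"
  shows "cells m n Z \<in> sets (lborel_n n)"
    "emeasure (lborel_n n) (cells m n Z) = ennreal (real (card Z) * (1 / real (Suc m)) ^ n)"
proof -
  have U: "cells m n Z = (\<Union>z\<in>Z. cells m n {z})" by (auto simp: cells_def)
  show "cells m n Z \<in> sets (lborel_n n)" unfolding U using assms cell_measure(1) by (intro sets.finite_UN) auto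
  have "emeasure (lborel_n n) (cells m n Z) = (\<Sum>z\<in>Z. emeasure (lborel_n n) (cells m n {z}))"
    unfolding U using assms cell_measure(1)
    by (intro sum_emeasure[symmetric]) (auto simp: disjoint_family_on_def cells_def)
  also have "\<dots> = (\<Sum>z\<in>Z. ennreal ((1 / real (Suc m)) ^ n))"
    using assms cell_measure(2) by (intro sum.cong) auto
  finally show "emeasure (lborel_n n) (cells m n Z) = ennreal (real (card Z) * (1 / real (Suc m)) ^ n)"
    by (simp add: ennreal_mult' ennreal_of_nat_eq_real_of_nat)
qed

lemma cells_pair_measure:
  fixes m n :: nat
  assumes "finite Z" "\<And>x y. (x, y) \<in> Z \<Longrightarrow> length x = n \<and> length y = n"
  defines "U \<equiv> {p \<in> extensional {..<n} \<times> extensional {..<n}. (cell_index m n (fst p), cell_index m n (snd p)) \<in> Z}"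
  shows "U \<in> sets (lborel_n n \<Otimes>\<^sub>M lborel_n n)"
    "emeasure (lborel_n n \<Otimes>\<^sub>M lborel_n n) U = ennreal (real (card Z) * ((1 / real (Suc m)) ^ n * (1 / real (Suc m)) ^ n))"
proof -
  interpret L: sigma_finite_measure "lborel_n n" by (rule sigma_finite_lborel_n)
  let ?c = "\<lambda>z. cells m n {fst z} \<times> cells m n {snd z}"
  have U: "U = (\<Union>z\<in>Z. ?c z)" by (force simp: cells_def U_def)
  have len: "length (fst z) = n" "length (snd z) = n" if "z \<in> Z" for z
    using assms(2)[of "fst z" "snd z"] that by auto
  have c: "?c z \<in> sets (lborel_n n \<Otimes>\<^sub>M lborel_n n)" if "z \<in> Z" for z
    using cell_measure(1) len[OF that] by (intro pair_measureI) auto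
  show "U \<in> sets (lborel_n n \<Otimes>\<^sub>M lborel_n n)" unfolding U using assms(1) c by (intro sets.finite_UN) auto
  have "emeasure (lborel_n n \<Otimes>\<^sub>M lborel_n n) U = (\<Sum>z\<in>Z. emeasure (lborel_n n \<Otimes>\<^sub>M lborel_n n) (?c z))"
    unfolding U using assms(1) c
    by (intro sum_emeasure[symmetric]) (auto simp: disjoint_family_on_def cells_def)
  also have "\<dots> = (\<Sum>z\<in>Z. ennreal ((1 / real (Suc m)) ^ n * (1 / real (Suc m)) ^ n))"
    using len by (intro sum.cong refl, subst L.emeasure_pair_measure_Times)
      (auto simp: cell_measure ennreal_mult)
  finally show "emeasure (lborel_n n \<Otimes>\<^sub>M lborel_n n) U = ennreal (real (card Z) * ((1 / real (Suc m)) ^ n * (1 / real (Suc m)) ^ n))"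
    by (simp add: ennreal_mult' ennreal_of_nat_eq_real_of_nat)
qed

lemma compact_coordinate_bound:
  assumes "compact (K :: (nat \<Rightarrow> real) set)" obtains b where "0 \<le> b" "\<And>x i. x \<in> K \<Longrightarrow> i < n \<Longrightarrow> \<bar>x i\<bar> \<le> b"
proof -
  have "\<exists>b. \<forall>x\<in>K. \<bar>x i\<bar> \<le> b" for i
  proof -
    have "compact ((\<lambda>x. x i) ` K)"
      using assms by (intro compact_continuous_image continuous_on_subset[OF continuous_on_product_coordinates]) auto
    then have "bounded ((\<lambda>x. x i) ` K)" by (rule compact_imp_bounded)
    then show ?thesis by (auto simp: bounded_iff)
  qed
  then obtain b where b: "\<And>i x. x \<in> K \<Longrightarrow> \<bar>x i\<bar> \<le> b i" by metis
  show ?thesis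
  proof (rule that[of "\<Sum>i<n. \<bar>b i\<bar>"])
    fix x i assume "x \<in> K" "i < n"
    have "\<bar>x i\<bar> \<le> \<bar>b i\<bar>" using b[OF \<open>x \<in> K\<close>, of i] by linarith
    also have "\<dots> \<le> (\<Sum>i<n. \<bar>b i\<bar>)" using \<open>i < n\<close> by (intro member_le_sum) auto
    finally show "\<bar>x i\<bar> \<le> (\<Sum>i<n. \<bar>b i\<bar>)" .
  qed (auto intro: sum_nonneg)
qed

lemma finite_cell_index: "compact K \<Longrightarrow> finite (cell_index m n ` K)"
proof -
  assume "compact K"
  then obtain b where b: "0 \<le> b" "\<And>x i. x \<in> K \<Longrightarrow> i < n \<Longrightarrow> \<bar>x i\<bar> \<le> b"
    using compact_coordinate_bound by metis
  let ?s = "real (Suc m)"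
  have "cell_index m n ` K \<subseteq> {z. set z \<subseteq> {\<lfloor>- b * ?s\<rfloor>..\<lfloor>b * ?s\<rfloor>} \<and> length z = n}"
  proof clarsimp
    fix x k assume x: "x \<in> K" and "k \<in> set (cell_index m n x)"
    then obtain i where i: "i < n" "k = \<lfloor>x i * ?s\<rfloor>" by (auto simp: cell_index_def)
    have "- b \<le> x i" "x i \<le> b" using b(2)[OF x i(1)] by auto
    then have "- b * ?s \<le> x i * ?s" "x i * ?s \<le> b * ?s" by (intro mult_right_mono; simp)+
    then have "\<lfloor>- b * ?s\<rfloor> \<le> k" "k \<le> \<lfloor>b * ?s\<rfloor>" unfolding i(2) by (intro floor_mono; simp)+
    then show "\<lfloor>- (b * (1 + real m))\<rfloor> \<le> k \<and> k \<le> \<lfloor>b * (1 + real m)\<rfloor>" by simp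
  qed
  then show ?thesis by (rule finite_subset) (rule finite_lists_length_eq, simp)
qed

text \<open>A point outside \<open>K\<close> lies in only finitely many of the cell unions, since
  otherwise points of the closed set \<open>K\<close> would converge to it. All unions lie in one
  box, so dominated convergence makes the excess over \<open>K\<close> vanish.\<close>

lemma cells_limsup:
  assumes K: "compact K" "K \<subseteq> extensional {..<n}"
    and Z: "\<And>m. finite (Z m)" "\<And>m z. z \<in> Z m \<Longrightarrow> length z = n"
    and near: "\<And>m x. x \<in> cells m n (Z m) \<Longrightarrow> \<exists>y\<in>K. \<forall>i<n. \<bar>x i - y i\<bar> \<le> 2 / real (Suc m)"
    and e: "0 < e"
  shows "\<forall>\<^sub>F m in sequentially. real (card (Z m)) * (1 / real (Suc m)) ^ n \<le> measure (lborel_n n) K + e"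
proof -
  let ?L = "lborel_n n"
  obtain b where b: "0 \<le> b" "\<And>x i. x \<in> K \<Longrightarrow> i < n \<Longrightarrow> \<bar>x i\<bar> \<le> b"
    using compact_coordinate_bound[OF K(1)] by metis
  \<comment> \<open>The margin 2 covers the largest error 2 / (m + 1), which occurs at m =
    0.\<close>
  define Q where "Q = (\<Pi>\<^sub>E i\<in>{..<n}. {-(b+2)..b+2})"
  have Qs: "Q \<in> sets ?L" unfolding Q_def by (intro sets_PiM_I_finite) auto
  have Qf: "emeasure ?L Q < \<infinity>"
  proof -
    have "emeasure ?L Q = (\<Prod>i<n. ennreal (b + 2 - - (b + 2)))"
      unfolding Q_def using b(1) by (subst emeasure_lborel_n_box) (simp_all del: ennreal_plus)
    also have "\<dots> = ennreal ((b + 2 - - (b + 2)) ^ n)"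
      using b(1) by (simp add: ennreal_power del: ennreal_plus)
    finally show ?thesis by simp
  qed
  have Ks: "K \<in> sets ?L" by (rule compact_lborel_n_sets[OF K])
  have Cs: "cells m n (Z m) \<in> sets ?L" for m using Z by (intro cells_measure) auto
  have CQ: "cells m n (Z m) \<subseteq> Q" for m
  proof
    fix x assume x: "x \<in> cells m n (Z m)"
    then obtain y where y: "y \<in> K" "\<forall>i<n. \<bar>x i - y i\<bar> \<le> 2 / real (Suc m)" using near by blast
    have "x i \<in> {-(b+2)..b+2}" if "i < n" for i
    proof -
      have "2 / real (Suc m) \<le> 2" by (simp add: divide_le_eq)
      moreover have "\<bar>x i - y i\<bar> \<le> 2 / real (Suc m)" "\<bar>y i\<bar> \<le> b" using y b(2) that by auto
      ultimately have "\<bar>x i\<bar> \<le> b + 2" by linarith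
      then show ?thesis by auto
    qed
    then show "x \<in> Q" using x by (auto simp: Q_def cells_def PiE_def)
  qed
  have KQ: "K \<subseteq> Q" using b K(2) by (force simp: Q_def PiE_def)
  have lim: "(\<lambda>m. indicat_real (cells m n (Z m) - K) x) \<longlonglongrightarrow> 0" for x
  proof (cases "x \<in> K")
    case True
    then show ?thesis by simp
  next
    case False
    \<comment> \<open>Taking x itself at the indices whose cells miss x makes y converge to x in
      every case. Eventually y leaves \<open>K\<close>, and from then on the cells do miss
      x.\<close>
    define y where "y m = (if x \<in> cells m n (Z m) then (SOME y. y \<in> K \<and> (\<forall>i<n. \<bar>x i - y i\<bar> \<le> 2 / real (Suc m))) else x)" for m
    have y: "y m \<in> K \<and> (\<forall>i<n. \<bar>x i - y m i\<bar> \<le> 2 / real (Suc m))" if "x \<in> cells m n (Z m)" for m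
    proof -
      have "\<exists>y. y \<in> K \<and> (\<forall>i<n. \<bar>x i - y i\<bar> \<le> 2 / real (Suc m))" using near[OF that] by blast
      note s = someI_ex[OF this]
      have eq: "y m = (SOME y. y \<in> K \<and> (\<forall>i<n. \<bar>x i - y i\<bar> \<le> 2 / real (Suc m)))"
        using that by (simp only: y_def if_True)
      show ?thesis unfolding eq by (rule s)
    qed
    have "y \<longlonglongrightarrow> x"
    proof (rule tendsto_fun)
      fix i
      have "\<bar>y m i - x i\<bar> \<le> 2 / real (Suc m)" for m
      proof (cases "x \<in> cells m n (Z m)")
        case True
        show ?thesis
        proof (cases "i < n")
          case True
          then show ?thesis using y[OF \<open>x \<in> cells m n (Z m)\<close>] by (simp add: abs_minus_commute)
        next
          case False
          have "y m \<in> extensional {..<n}" "x \<in> extensional {..<n}"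
            using y[OF True] K(2) True by (auto simp: cells_def)
          then have "y m i = x i" using False by (simp add: extensional_def)
          then show ?thesis by simp
        qed
      qed (simp add: y_def)
      moreover have "(\<lambda>m. 2 / real (Suc m)) \<longlonglongrightarrow> 0"
        by (rule LIMSEQ_Suc[of "\<lambda>m. 2 / real m"]) (rule lim_const_over_n)
      ultimately have "(\<lambda>m. y m i - x i) \<longlonglongrightarrow> 0"
        by (intro Lim_null_comparison[of "\<lambda>m. y m i - x i"]) auto
      then show "(\<lambda>m. y m i) \<longlonglongrightarrow> x i" by (rule LIM_zero_cancel)
    qed
    moreover have "open (- K)" using K(1) by (simp add: compact_imp_closed open_Compl)
    ultimately have "\<forall>\<^sub>F m in sequentially. y m \<in> - K" using False by (auto dest: topological_tendstoD)
    then have "\<forall>\<^sub>F m in sequentially. indicat_real (cells m n (Z m) - K) x = 0"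
      by eventually_elim (use y in \<open>auto simp: indicator_def\<close>)
    then show ?thesis by (rule tendsto_eventually)
  qed
  have "(\<lambda>m. LINT x|?L. indicat_real (cells m n (Z m) - K) x) \<longlonglongrightarrow> (LINT x|?L. 0)"
  proof (rule integral_dominated_convergence[where w="indicat_real Q"])
    show "integrable ?L (indicat_real Q)" using Qs Qf by (rule integrable_real_indicator)
    show "AE x in ?L. (\<lambda>m. indicat_real (cells m n (Z m) - K) x) \<longlonglongrightarrow> 0" using lim by simp
    show "AE x in ?L. norm (indicat_real (cells m n (Z m) - K) x) \<le> indicat_real Q x" for m
      using CQ[of m] by (auto simp: indicator_def)
  qed (use Cs Ks in auto)
  then have "(\<lambda>m. measure ?L (cells m n (Z m) - K)) \<longlonglongrightarrow> 0"
    using Cs Ks sets.sets_into_space[OF Cs] by (simp add: Int_absorb2 Diff_subset subset_trans[OF Diff_subset])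
  then have "\<forall>\<^sub>F m in sequentially. measure ?L (cells m n (Z m) - K) < e"
    using e by (rule order_tendstoD(2))
  then show ?thesis
  proof eventually_elim
    case (elim m)
    have fm: "S \<in> fmeasurable ?L" if "S \<in> sets ?L" "S \<subseteq> Q" for S
      by (rule fmeasurableI2[OF fmeasurableI[OF Qs] that(2,1)]) (use Qf in simp)
    have "real (card (Z m)) * (1 / real (Suc m)) ^ n = measure ?L (cells m n (Z m))"
      using cells_measure(2)[of "Z m" n m] Z by (simp add: measure_def)
    also have "\<dots> \<le> measure ?L (K \<union> (cells m n (Z m) - K))"
      using Cs Ks CQ[of m] KQ by (intro measure_mono_fmeasurable fm) auto
    also have "\<dots> \<le> measure ?L K + measure ?L (cells m n (Z m) - K)"
      using Cs Ks by (intro measure_Un_le) auto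
    finally show ?case using elim by simp
  qed
qed


lemma cell_index_close:
  assumes "cell_index m n x = cell_index m n y" "i < n"
  shows "\<bar>x i - y i\<bar> \<le> 2 / real (Suc m)"
proof -
  have "\<lfloor>x i * real (Suc m)\<rfloor> = \<lfloor>y i * real (Suc m)\<rfloor>"
    using assms by (metis nth_cell_index)
  then have "\<bar>x i * real (Suc m) - y i * real (Suc m)\<bar> \<le> 2" by linarith
  then have "\<bar>x i - y i\<bar> * real (Suc m) \<le> 2"
    by (simp only: left_diff_distrib[symmetric] abs_mult abs_of_nat)
  then show ?thesis by (subst pos_le_divide_eq) simp_all
qed

lemma near_sum_close:
  assumes "near_sum (cell_index m n u) (cell_index m n v) (cell_index m n x)" "i < n"
  shows "\<bar>x i - (u i + v i)\<bar> \<le> 2 / real (Suc m)"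
proof -
  let ?s = "real (Suc m)"
  have "\<lfloor>x i * ?s\<rfloor> = \<lfloor>u i * ?s\<rfloor> + \<lfloor>v i * ?s\<rfloor> \<or> \<lfloor>x i * ?s\<rfloor> = \<lfloor>u i * ?s\<rfloor> + \<lfloor>v i * ?s\<rfloor> + 1"
    using assms by (simp add: near_sum_def nth_cell_index)
  then have "\<bar>x i * ?s - (u i * ?s + v i * ?s)\<bar> \<le> 2" by linarith
  then have "\<bar>x i - (u i + v i)\<bar> * ?s \<le> 2"
    by (simp only: left_diff_distrib[symmetric] distrib_right[symmetric] abs_mult abs_of_nat)
  then show ?thesis by (subst pos_le_divide_eq) simp_all
qed

lemma continuous_vec_add: "continuous_on S (\<lambda>p. vec_add n (fst p) (snd p))"
proof (rule continuous_on_coordinatewise_then_product)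
  fix i
  have c: "continuous_on UNIV (\<lambda>x::nat \<Rightarrow> real. x i)" by (rule continuous_on_product_coordinates)
  show "continuous_on S (\<lambda>p. vec_add n (fst p) (snd p) i)"
  proof (cases "i < n")
    case True
    have "continuous_on S (\<lambda>p. fst p i)" "continuous_on S (\<lambda>p. snd p i)"
      by (rule continuous_on_compose2[OF c], rule continuous_on_fst[OF continuous_on_id], simp,
        rule continuous_on_compose2[OF c], rule continuous_on_snd[OF continuous_on_id], simp)
    then show ?thesis using True by (simp add: vec_add_def continuous_on_add)
  qed (simp add: vec_add_def)
qed

text \<open>The cells that meet a compact set overestimate its measure, but by
  \<open>cells_limsup\<close> only slightly on a fine grid. So \<Theta> is first replaced by a
  compact subset \<open>K\<close>: the cell sums of \<open>K\<close> stay within 2 / (m + 1) of its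
  image \<open>R\<close> under addition, which is compact and contained in \<open>C\<close>. For a
  set that is not compact the cells could overestimate by far more.\<close>

lemma grid_approx:
  assumes A: "A \<in> sets (lborel_n n)" "emeasure (lborel_n n) A < \<infinity>"
    and B: "B \<in> sets (lborel_n n)" "emeasure (lborel_n n) B < \<infinity>"
    and \<Theta>: "\<Theta> \<in> sets (lborel_n n \<Otimes>\<^sub>M lborel_n n)" "\<Theta> \<subseteq> A \<times> B"
    and C: "C \<in> sets (lborel_n n)" "emeasure (lborel_n n) C < \<infinity>" "restricted_sum n \<Theta> \<subseteq> C"
    and e: "0 < e"
  obtains m I J T where "finite I" "\<And>x. x \<in> I \<Longrightarrow> length x = n" "finite J" "\<And>x. x \<in> J \<Longrightarrow> length x = n"
    "T \<subseteq> I \<times> J"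
    "\<bar>real (card I) * (1 / real (Suc m)) ^ n - measure (lborel_n n) A\<bar> \<le> e"
    "\<bar>real (card J) * (1 / real (Suc m)) ^ n - measure (lborel_n n) B\<bar> \<le> e"
    "measure (lborel_n n \<Otimes>\<^sub>M lborel_n n) \<Theta> - e \<le> real (card T) * ((1 / real (Suc m)) ^ n * (1 / real (Suc m)) ^ n)"
    "real (card (grid_sum T)) * (1 / real (Suc m)) ^ n \<le> measure (lborel_n n) C + e"
proof -
  let ?L = "lborel_n n" and ?L2 = "lborel_n n \<Otimes>\<^sub>M lborel_n n"
  interpret L: sigma_finite_measure ?L by (rule sigma_finite_lborel_n)
  have ext: "S \<subseteq> extensional {..<n}" if "S \<in> sets ?L" for S
    using sets.sets_into_space[OF that] by (simp add: space_lborel_n)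
  have mono: "measure ?L S \<le> measure ?L S'" if "S \<subseteq> S'" "S \<in> sets ?L" "S' \<in> sets ?L" "emeasure ?L S' < \<infinity>" for S S'
    using that by (intro measure_mono_fmeasurable fmeasurableI) auto
  have fin\<Theta>: "emeasure ?L2 \<Theta> < \<infinity>"
  proof -
    have "emeasure ?L2 \<Theta> \<le> emeasure ?L2 (A \<times> B)" using \<Theta> A B by (intro emeasure_mono pair_measureI)
    also have "\<dots> = emeasure ?L A * emeasure ?L B" using A B by (intro L.emeasure_pair_measure_Times)
    also have "\<dots> < \<infinity>" using A B by (simp add: ennreal_mult_less_top)
    finally show ?thesis .
  qed
  obtain KA where KA: "compact KA" "KA \<subseteq> A" "KA \<in> sets ?L" "measure ?L A \<le> measure ?L KA + e / 2"
    using e by (auto intro: inner_compact[OF id_measurable_lborel_n A(1) sets_lborel_n_borel[OF A(1)] A(2), of "e/2"])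
  obtain KB where KB: "compact KB" "KB \<subseteq> B" "KB \<in> sets ?L" "measure ?L B \<le> measure ?L KB + e / 2"
    using e by (auto intro: inner_compact[OF id_measurable_lborel_n B(1) sets_lborel_n_borel[OF B(1)] B(2), of "e/2"])
  obtain K where K: "compact K" "K \<subseteq> \<Theta>" "K \<in> sets ?L2" "measure ?L2 \<Theta> \<le> measure ?L2 K + e"
    using e by (auto intro: inner_compact[OF id_measurable_lborel_2n \<Theta>(1) sets_lborel_2n_borel[OF \<Theta>(1)] fin\<Theta>, of e])
  \<comment> \<open>Adjoining the projections of \<open>K\<close> ensures that the pairs of cells
    met by \<open>K\<close> consist of cells met by \<open>P\<close> and \<open>Q\<close>.\<close>
  define P where "P = KA \<union> fst ` K"
  define Q where "Q = KB \<union> snd ` K"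
  define R where "R = (\<lambda>p. vec_add n (fst p) (snd p)) ` K"
  have "compact (fst ` K)" "compact (snd ` K)"
    by (intro compact_continuous_image K(1) continuous_on_fst continuous_on_snd continuous_on_id)+
  then have P: "compact P" "P \<subseteq> A" and Q: "compact Q" "Q \<subseteq> B"
    using KA KB K \<Theta>(2) by (auto simp: P_def Q_def intro!: compact_Un)
  have "R \<subseteq> restricted_sum n \<Theta>" using K(2) by (force simp: R_def restricted_sum_def)
  then have R: "compact R" "R \<subseteq> C"
    using K(1) C(3) by (auto simp: R_def intro!: compact_continuous_image continuous_vec_add)
  have PQR: "P \<subseteq> extensional {..<n}" "Q \<subseteq> extensional {..<n}" "R \<subseteq> extensional {..<n}"
    using P Q R ext[OF A(1)] ext[OF B(1)] ext[OF C(1)] by auto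
  note S = compact_lborel_n_sets[OF P(1) PQR(1)] compact_lborel_n_sets[OF Q(1) PQR(2)] compact_lborel_n_sets[OF R(1) PQR(3)]
  define I where "I m = cell_index m n ` P" for m
  define J where "J m = cell_index m n ` Q" for m
  define T where "T m = (\<lambda>p. (cell_index m n (fst p), cell_index m n (snd p))) ` K" for m
  have fI: "finite (I m)" and fJ: "finite (J m)" for m
    unfolding I_def J_def by (intro finite_cell_index P Q)+
  have TIJ: "T m \<subseteq> I m \<times> J m" for m by (auto simp: T_def I_def J_def P_def Q_def)
  have fT: "finite (T m)" for m using TIJ fI fJ by (meson finite_SigmaI finite_subset)
  have lenI: "length z = n" if "z \<in> I m" for z m using that by (auto simp: I_def)
  have lenJ: "length z = n" if "z \<in> J m" for z m using that by (auto simp: J_def)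
  have lenT: "length z = n" if "z \<in> grid_sum (T m)" for z m
    using that by (auto simp: grid_sum_def near_sum_def T_def)
  have e2: "0 < e / 2" using e by simp
  have E: "\<forall>\<^sub>F m in sequentially. real (card (I m)) * (1 / real (Suc m)) ^ n \<le> measure ?L P + e / 2"
    by (rule cells_limsup[OF P(1) PQR(1) fI lenI _ e2])
      (auto simp: cells_def I_def dest: cell_index_close intro!: bexI)
  have F: "\<forall>\<^sub>F m in sequentially. real (card (J m)) * (1 / real (Suc m)) ^ n \<le> measure ?L Q + e / 2"
    by (rule cells_limsup[OF Q(1) PQR(2) fJ lenJ _ e2])
      (auto simp: cells_def J_def dest: cell_index_close intro!: bexI)
  have G: "\<forall>\<^sub>F m in sequentially. real (card (grid_sum (T m))) * (1 / real (Suc m)) ^ n \<le> measure ?L R + e / 2"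
  proof (rule cells_limsup[OF R(1) PQR(3) finite_grid_sum[OF fT] lenT _ e2])
    fix m x assume "x \<in> cells m n (grid_sum (T m))"
    then obtain u v where uv: "(u, v) \<in> K" "near_sum (cell_index m n u) (cell_index m n v) (cell_index m n x)"
      by (auto simp: cells_def grid_sum_def T_def)
    then show "\<exists>y\<in>R. \<forall>i<n. \<bar>x i - y i\<bar> \<le> 2 / real (Suc m)"
      using near_sum_close[OF uv(2)]
      by (intro bexI[of _ "vec_add n u v"]) (force simp: vec_add_def R_def)+
  qed auto
  obtain m where m: "real (card (I m)) * (1 / real (Suc m)) ^ n \<le> measure ?L P + e / 2"
    "real (card (J m)) * (1 / real (Suc m)) ^ n \<le> measure ?L Q + e / 2"
    "real (card (grid_sum (T m))) * (1 / real (Suc m)) ^ n \<le> measure ?L R + e / 2"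
    using eventually_conj[OF E eventually_conj[OF F G]] by (auto simp: eventually_sequentially)
  have low: "measure ?L S \<le> real (card (cell_index m n ` S)) * (1 / real (Suc m)) ^ n" if "compact S" "S \<subseteq> extensional {..<n}" for S
  proof -
    have l: "length z = n" if "z \<in> cell_index m n ` S" for z using that by auto
    have c1: "cells m n (cell_index m n ` S) \<in> sets ?L"
      by (rule cells_measure(1)[OF finite_cell_index[OF that(1)] l])
    have c2: "emeasure ?L (cells m n (cell_index m n ` S)) = ennreal (real (card (cell_index m n ` S)) * (1 / real (Suc m)) ^ n)"
      by (rule cells_measure(2)[OF finite_cell_index[OF that(1)] l])
    have "S \<subseteq> cells m n (cell_index m n ` S)" using that(2) by (auto simp: cells_def)
    then have "measure ?L S \<le> measure ?L (cells m n (cell_index m n ` S))"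
      by (rule mono[OF _ compact_lborel_n_sets[OF that] c1]) (simp only: c2 ennreal_less_top infinity_ennreal_def)
    also have "\<dots> = real (card (cell_index m n ` S)) * (1 / real (Suc m)) ^ n"
      unfolding measure_def c2 by simp
    finally show ?thesis .
  qed
  show ?thesis
  proof (rule that[of "I m" "J m" "T m" m])
    have "measure ?L KA \<le> measure ?L P"
      by (rule mono[OF _ KA(3) S(1) le_less_trans[OF emeasure_mono[OF P(2) A(1)] A(2)]]) (simp add: P_def)
    moreover have "measure ?L P \<le> measure ?L A" using P A S by (intro mono) auto
    ultimately show "\<bar>real (card (I m)) * (1 / real (Suc m)) ^ n - measure ?L A\<bar> \<le> e"
      using m(1) low[OF P(1) PQR(1), folded I_def] KA(4) e by linarith
    have "measure ?L KB \<le> measure ?L Q"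
      by (rule mono[OF _ KB(3) S(2) le_less_trans[OF emeasure_mono[OF Q(2) B(1)] B(2)]]) (simp add: Q_def)
    moreover have "measure ?L Q \<le> measure ?L B" using Q B S by (intro mono) auto
    ultimately show "\<bar>real (card (J m)) * (1 / real (Suc m)) ^ n - measure ?L B\<bar> \<le> e"
      using m(2) low[OF Q(1) PQR(2), folded J_def] KB(4) e by linarith
    have "measure ?L R \<le> measure ?L C" using R C S by (intro mono) auto
    then show "real (card (grid_sum (T m))) * (1 / real (Suc m)) ^ n \<le> measure ?L C + e"
      using m(3) e by linarith
    let ?U = "{p \<in> extensional {..<n} \<times> extensional {..<n}. (cell_index m n (fst p), cell_index m n (snd p)) \<in> T m}"
    have lT: "length x = n \<and> length y = n" if "(x, y) \<in> T m" for x y using that by (auto simp: T_def)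
    have u: "?U \<in> sets ?L2" "emeasure ?L2 ?U = ennreal (real (card (T m)) * ((1 / real (Suc m)) ^ n * (1 / real (Suc m)) ^ n))"
      by (rule cells_pair_measure[OF fT[of m] lT]; assumption)+
    have "K \<subseteq> extensional {..<n} \<times> extensional {..<n}" using K(2) \<Theta>(2) ext[OF A(1)] ext[OF B(1)] by auto
    then have "K \<subseteq> ?U" by (auto simp: T_def)
    then have "measure ?L2 K \<le> measure ?L2 ?U"
      using K(3) u by (intro measure_mono_fmeasurable fmeasurableI) auto
    also have "\<dots> = real (card (T m)) * ((1 / real (Suc m)) ^ n * (1 / real (Suc m)) ^ n)"
      using u(2) by (simp add: measure_def)
    finally show "measure ?L2 \<Theta> - e \<le> real (card (T m)) * ((1 / real (Suc m)) ^ n * (1 / real (Suc m)) ^ n)"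
      using K(4) by linarith
  qed (use fI fJ lenI lenJ TIJ in auto)
qed

lemma discrete_scaled:
  fixes \<delta> :: real and m :: nat
  assumes n: "1 \<le> n" and \<delta>: "0 < \<delta>" "\<delta>\<^sup>2 \<le> 1 / 8"
    and I: "finite I" "\<And>x. x \<in> I \<Longrightarrow> length x = n"
    and J: "finite J" "\<And>x. x \<in> J \<Longrightarrow> length x = n"
    and T: "T \<subseteq> I \<times> J"
  defines "h \<equiv> (1 / real (Suc m)) ^ n"
  defines "x \<equiv> real (card I) * h" and "y \<equiv> real (card J) * h"
  assumes pos: "0 < x" "0 < y" and big: "(1 - \<delta> ^ 4 / 8) * (x * y) \<le> real (card T) * (h * h)"
    and ab: "\<delta> * ((x powr (1 / n))\<^sup>2 + (y powr (1 / n))\<^sup>2) \<le> x powr (1 / n) * y powr (1 / n) * sqrt n"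
  shows "((x powr (1 / n))\<^sup>2 + (y powr (1 / n))\<^sup>2) powr (n / 2) \<le> real (card (grid_sum T)) * h"
proof -
  define s where "s = 1 / real (Suc m)"
  have s: "0 < s" by (simp add: s_def)
  have h: "h = s ^ n" by (simp add: h_def s_def)
  have h0: "0 < h" using s by (simp add: h)
  have hs: "h powr (1 / n) = s"
    unfolding h using s n by (simp add: powr_realpow[symmetric] powr_powr del: powr_realpow)
  let ?a = "real (card I) powr (1 / n)" and ?b = "real (card J) powr (1 / n)"
  have x: "x powr (1 / n) = ?a * s" and y: "y powr (1 / n) = ?b * s"
    unfolding x_def y_def using h0 by (simp_all add: powr_mult hs)
  have ne: "I \<noteq> {}" "J \<noteq> {}" using pos by (auto simp: x_def y_def)
  have sq: "(x powr (1 / n))\<^sup>2 + (y powr (1 / n))\<^sup>2 = (?a\<^sup>2 + ?b\<^sup>2) * s\<^sup>2"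
    unfolding x y by (simp add: power_mult_distrib algebra_simps)
  have "(?a\<^sup>2 + ?b\<^sup>2) powr (n / 2) \<le> real (card (grid_sum T))"
  proof (rule discrete_restricted_sum[OF n \<delta> I(1) ne(1) I(2) J(1) ne(2) J(2) T])
    have "((1 - \<delta> ^ 4 / 8) * (real (card I) * real (card J))) * (h * h) \<le> real (card T) * (h * h)"
      using big unfolding x_def y_def by (simp only: mult_ac)
    then show "(1 - \<delta> ^ 4 / 8) * (real (card I) * real (card J)) \<le> real (card T)"
      using h0 by (simp only: mult_le_cancel_right_pos mult_pos_pos)
    have "(\<delta> * (?a\<^sup>2 + ?b\<^sup>2)) * s\<^sup>2 \<le> (?a * ?b * sqrt n) * s\<^sup>2"
      using ab[unfolded sq] unfolding x y by (simp only: power2_eq_square mult_ac)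
    then show "\<delta> * (?a\<^sup>2 + ?b\<^sup>2) \<le> ?a * ?b * sqrt n"
      using s by (simp only: mult_le_cancel_right_pos zero_less_power)
  qed
  then have "(?a\<^sup>2 + ?b\<^sup>2) powr (n / 2) * h \<le> real (card (grid_sum T)) * h"
    using h0 by (intro mult_right_mono) auto
  moreover have "(s\<^sup>2) powr (n / 2) = h"
  proof -
    have "(s\<^sup>2) powr (n / 2) = (s powr 2) powr (n / 2)" using s by simp
    also have "\<dots> = s powr n" by (simp add: powr_powr)
    finally show ?thesis using s by (simp add: h powr_realpow)
  qed
  ultimately show ?thesis unfolding sq by (simp add: powr_mult)
qed

text \<open>Passage to the limit in \<open>discrete_scaled\<close>. Replacing \<delta> by \<delta> /
  2 raises the tolerated loss from \<delta>^4/256 to \<delta>^4/128 and makes the ratio condition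
  strict, so both conditions survive a small perturbation of the measures.\<close>

proposition restricted_sum_large:
  fixes \<delta> :: real
  assumes n: "1 \<le> n" and \<delta>: "0 < \<delta>" "\<delta>\<^sup>2 \<le> 1 / 2"
    and A: "A \<in> sets (lborel_n n)" "emeasure (lborel_n n) A < \<infinity>" "0 < measure (lborel_n n) A"
    and B: "B \<in> sets (lborel_n n)" "emeasure (lborel_n n) B < \<infinity>" "0 < measure (lborel_n n) B"
    and \<Theta>: "\<Theta> \<in> sets (lborel_n n \<Otimes>\<^sub>M lborel_n n)" "\<Theta> \<subseteq> A \<times> B"
    and C: "C \<in> sets (lborel_n n)" "emeasure (lborel_n n) C < \<infinity>" "restricted_sum n \<Theta> \<subseteq> C"
    and big: "(1 - \<delta> ^ 4 / 256) * (measure (lborel_n n) A * measure (lborel_n n) B) \<le>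
      measure (lborel_n n \<Otimes>\<^sub>M lborel_n n) \<Theta>"
  defines "a \<equiv> measure (lborel_n n) A powr (1 / n)" and "b \<equiv> measure (lborel_n n) B powr (1 / n)"
  assumes ab: "\<delta> * (a\<^sup>2 + b\<^sup>2) \<le> a * b * sqrt n"
  shows "(a\<^sup>2 + b\<^sup>2) powr (n / 2) \<le> measure (lborel_n n) C"
proof -
  let ?L = "lborel_n n"
  let ?f = "\<lambda>x::real. x powr (1 / n)"
  let ?d = "\<delta> / 2"
  have "\<exists>x y t z. \<bar>x - measure ?L A\<bar> \<le> inverse (real (Suc k)) \<and> \<bar>y - measure ?L B\<bar> \<le> inverse (real (Suc k)) \<and>
      measure (?L \<Otimes>\<^sub>M ?L) \<Theta> - inverse (real (Suc k)) \<le> t \<and> z \<le> measure ?L C + inverse (real (Suc k)) \<and>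
      (0 < x \<longrightarrow> 0 < y \<longrightarrow> (1 - ?d ^ 4 / 8) * (x * y) \<le> t \<longrightarrow>
        ?d * ((?f x)\<^sup>2 + (?f y)\<^sup>2) \<le> ?f x * ?f y * sqrt n \<longrightarrow> ((?f x)\<^sup>2 + (?f y)\<^sup>2) powr (n / 2) \<le> z)" for k
  proof -
    have e: "0 < inverse (real (Suc k))" by simp
    have d: "0 < ?d" "?d\<^sup>2 \<le> 1 / 8" using \<delta> by (auto simp: power_divide)
    show ?thesis
    proof (rule grid_approx[OF A(1,2) B(1,2) \<Theta> C e])
      fix m I J T
      assume *: "finite I" "\<And>x. x \<in> I \<Longrightarrow> length x = n" "finite J" "\<And>x. x \<in> J \<Longrightarrow> length x = n" "T \<subseteq> I \<times> J"
        "\<bar>real (card I) * (1 / real (Suc m)) ^ n - measure ?L A\<bar> \<le> inverse (real (Suc k))"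
        "\<bar>real (card J) * (1 / real (Suc m)) ^ n - measure ?L B\<bar> \<le> inverse (real (Suc k))"
        "measure (?L \<Otimes>\<^sub>M ?L) \<Theta> - inverse (real (Suc k)) \<le> real (card T) * ((1 / real (Suc m)) ^ n * (1 / real (Suc m)) ^ n)"
        "real (card (grid_sum T)) * (1 / real (Suc m)) ^ n \<le> measure ?L C + inverse (real (Suc k))"
      show ?thesis
        by (rule exI[of _ "real (card I) * (1 / real (Suc m)) ^ n"], rule exI[of _ "real (card J) * (1 / real (Suc m)) ^ n"],
            rule exI[of _ "real (card T) * ((1 / real (Suc m)) ^ n * (1 / real (Suc m)) ^ n)"],
            rule exI[of _ "real (card (grid_sum T)) * (1 / real (Suc m)) ^ n"], intro conjI impI *(6-9))
          (rule discrete_scaled[OF n d *(1-5)])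
    qed
  qed
  then obtain x y t z where seq: "\<And>k. \<bar>x k - measure ?L A\<bar> \<le> inverse (real (Suc k))"
    "\<And>k. \<bar>y k - measure ?L B\<bar> \<le> inverse (real (Suc k))"
    "\<And>k. measure (?L \<Otimes>\<^sub>M ?L) \<Theta> - inverse (real (Suc k)) \<le> t k"
    "\<And>k. z k \<le> measure ?L C + inverse (real (Suc k))"
    and main: "\<And>k. 0 < x k \<Longrightarrow> 0 < y k \<Longrightarrow> (1 - ?d ^ 4 / 8) * (x k * y k) \<le> t k \<Longrightarrow>
        ?d * ((?f (x k))\<^sup>2 + (?f (y k))\<^sup>2) \<le> ?f (x k) * ?f (y k) * sqrt n \<Longrightarrow>
        ((?f (x k))\<^sup>2 + (?f (y k))\<^sup>2) powr (n / 2) \<le> z k"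
    by metis
  have inv0: "(\<lambda>k. inverse (real (Suc k))) \<longlonglongrightarrow> 0" by (rule LIMSEQ_inverse_real_of_nat)
  have X: "x \<longlonglongrightarrow> measure ?L A"
    by (rule LIM_zero_cancel, rule Lim_null_comparison[OF _ inv0]) (use seq(1) in auto)
  have Y: "y \<longlonglongrightarrow> measure ?L B"
    by (rule LIM_zero_cancel, rule Lim_null_comparison[OF _ inv0]) (use seq(2) in auto)
  have fX: "(\<lambda>k. ?f (x k)) \<longlonglongrightarrow> a" and fY: "(\<lambda>k. ?f (y k)) \<longlonglongrightarrow> b"
    unfolding a_def b_def using A(3) B(3) by (intro tendsto_powr X Y tendsto_const; simp)+
  have a0: "0 < a" and b0: "0 < b" using A(3) B(3) by (auto simp: a_def b_def)
  have s0: "0 < a\<^sup>2 + b\<^sup>2" using a0 b0 by (simp add: add_pos_pos)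
  \<comment> \<open>Only a lower bound on \<open>t\<close> is known, so \<open>t k\<close> is made
    to cancel: what converges is this lower bound minus the product term.\<close>
  have "(\<lambda>k. t k - (1 - ?d ^ 4 / 8) * (x k * y k) - (t k - (measure (?L \<Otimes>\<^sub>M ?L) \<Theta> - inverse (real (Suc k)))))
    \<longlonglongrightarrow> measure (?L \<Otimes>\<^sub>M ?L) \<Theta> - 0 - (1 - ?d ^ 4 / 8) * (measure ?L A * measure ?L B)"
  proof -
    have "(\<lambda>k. (measure (?L \<Otimes>\<^sub>M ?L) \<Theta> - inverse (real (Suc k))) - (1 - ?d ^ 4 / 8) * (x k * y k)) 
      \<longlonglongrightarrow> measure (?L \<Otimes>\<^sub>M ?L) \<Theta> - 0 - (1 - ?d ^ 4 / 8) * (measure ?L A * measure ?L B)"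
      by (intro tendsto_intros X Y inv0)
    then show ?thesis by (simp add: algebra_simps)
  qed
  moreover have "0 < measure (?L \<Otimes>\<^sub>M ?L) \<Theta> - 0 - (1 - ?d ^ 4 / 8) * (measure ?L A * measure ?L B)"
  proof -
    have "0 < (\<delta> ^ 4 / 256) * (measure ?L A * measure ?L B)" using \<delta> A(3) B(3) by simp
    moreover have "(1 - ?d ^ 4 / 8) * (measure ?L A * measure ?L B) =
        (1 - \<delta> ^ 4 / 256) * (measure ?L A * measure ?L B) - \<delta> ^ 4 / 256 * (measure ?L A * measure ?L B)"
      by (simp add: power_divide left_diff_distrib)
    ultimately show ?thesis using big by linarith
  qed
  ultimately have "\<forall>\<^sub>F k in sequentially. 0 < t k - (1 - ?d ^ 4 / 8) * (x k * y k) - (t k - (measure (?L \<Otimes>\<^sub>M ?L) \<Theta> - inverse (real (Suc k))))"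
    by (rule order_tendstoD(1))
  then have ev1: "\<forall>\<^sub>F k in sequentially. (1 - ?d ^ 4 / 8) * (x k * y k) \<le> t k"
    by eventually_elim (use seq(3) in \<open>smt (verit)\<close>)
  have "(\<lambda>k. ?f (x k) * ?f (y k) * sqrt n - ?d * ((?f (x k))\<^sup>2 + (?f (y k))\<^sup>2)) \<longlonglongrightarrow>
      a * b * sqrt n - ?d * (a\<^sup>2 + b\<^sup>2)"
    by (intro tendsto_intros fX fY)
  moreover have "0 < a * b * sqrt n - ?d * (a\<^sup>2 + b\<^sup>2)"
  proof -
    have "0 < ?d * (a\<^sup>2 + b\<^sup>2)" using \<delta> s0 by simp
    then show ?thesis using ab by (simp add: field_simps)
  qed
  ultimately have "\<forall>\<^sub>F k in sequentially. 0 < ?f (x k) * ?f (y k) * sqrt n - ?d * ((?f (x k))\<^sup>2 + (?f (y k))\<^sup>2)"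
    by (rule order_tendstoD(1))
  then have ev: "\<forall>\<^sub>F k in sequentially. ((?f (x k))\<^sup>2 + (?f (y k))\<^sup>2) powr (n / 2) \<le> measure ?L C + inverse (real (Suc k))"
    using ev1 order_tendstoD(1)[OF X A(3)] order_tendstoD(1)[OF Y B(3)]
  proof eventually_elim
    case (elim k)
    then have "((?f (x k))\<^sup>2 + (?f (y k))\<^sup>2) powr (n / 2) \<le> z k" by (intro main) auto
    then show ?case using seq(4)[of k] by simp
  qed
  have l: "(\<lambda>k. ((?f (x k))\<^sup>2 + (?f (y k))\<^sup>2) powr (n / 2)) \<longlonglongrightarrow> (a\<^sup>2 + b\<^sup>2) powr (n / 2)"
    using s0 a0 by (intro tendsto_powr tendsto_add tendsto_power fX fY tendsto_const) simp
  have r: "(\<lambda>k. measure ?L C + inverse (real (Suc k))) \<longlonglongrightarrow> measure ?L C + 0"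
    by (intro tendsto_intros inv0)
  show ?thesis using tendsto_le[OF sequentially_bot r l ev] by simp
qed

section \<open>Small restricted sums\<close>


definition affine_map :: "nat \<Rightarrow> real \<Rightarrow> (nat \<Rightarrow> real) \<Rightarrow> (nat \<Rightarrow> real) \<Rightarrow> nat \<Rightarrow> real" where
  "affine_map n c y x = (\<lambda>i\<in>{..<n}. c * x i + y i)"

lemma vec_add_affine: "vec_add n x y = affine_map n 1 y x"
  by (simp add: vec_add_def affine_map_def)

lemma affine_map_extensional [simp]: "affine_map n c y x \<in> extensional {..<n}"
  by (simp add: affine_map_def)

lemma measurable_affine_map [measurable]: "affine_map n c y \<in> lborel_n n \<rightarrow>\<^sub>M lborel_n n"
  unfolding affine_map_def by (intro measurable_restrict) simp

lemma emeasure_lborel_affine: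
  assumes "S \<in> sets borel" "0 < c"
  shows "ennreal c * emeasure lborel {t::real. c * t + d \<in> S} = emeasure lborel S"
proof -
  have m: "{t. c * t + d \<in> S} \<in> sets borel"
    using measurable_sets[of "\<lambda>t. c * t + d" borel borel S] assms by (simp add: vimage_def)
  have "emeasure lborel S = (\<integral>\<^sup>+t. indicator S t \<partial>lborel)" using assms by simp
  also have "\<dots> = ennreal \<bar>c\<bar> * (\<integral>\<^sup>+t. indicator S (d + c * t) \<partial>lborel)"
    using assms by (intro nn_integral_real_affine) auto
  also have "(\<lambda>t. indicator S (d + c * t)) = (indicator {t. c * t + d \<in> S} :: real \<Rightarrow> ennreal)"
    by (auto simp: indicator_def fun_eq_iff add.commute)
  finally show ?thesis using assms m by simp
qed

text \<open>On boxes the one-dimensional substitution applies in each coordinate; uniqueness of the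
  product measure extends the formula to all measurable sets.\<close>

lemma emeasure_affine_map:
  assumes S: "S \<in> sets (lborel_n n)" and c: "0 < c"
  shows "emeasure (lborel_n n) S = ennreal (c ^ n) * emeasure (lborel_n n) {x \<in> extensional {..<n}. affine_map n c y x \<in> S}"
proof -
  interpret product_sigma_finite "\<lambda>_::nat. lborel :: real measure" by (rule product_sigma_finite_lborel)
  let ?P = "scale_measure (ennreal (c ^ n)) (distr (lborel_n n) (lborel_n n) (affine_map n c y))"
  have em: "emeasure ?P X = ennreal (c ^ n) * emeasure (lborel_n n) {x \<in> extensional {..<n}. affine_map n c y x \<in> X}"
    if "X \<in> sets (lborel_n n)" for X
  proof -
    have "affine_map n c y -` X \<inter> space (lborel_n n) = {x \<in> extensional {..<n}. affine_map n c y x \<in> X}"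
      by (auto simp: space_lborel_n)
    then show ?thesis using that by (simp add: emeasure_distr)
  qed
  have "?P = lborel_n n"
  proof (rule PiM_eqI)
    fix A :: "nat \<Rightarrow> real set" assume "\<And>i. i \<in> {..<n} \<Longrightarrow> A i \<in> sets lborel"
    then have A: "\<And>i. i < n \<Longrightarrow> A i \<in> sets borel" by simp
    have box: "{x \<in> extensional {..<n}. affine_map n c y x \<in> Pi\<^sub>E {..<n} A} = (\<Pi>\<^sub>E i\<in>{..<n}. {t. c * t + y i \<in> A i})"
      by (auto simp: affine_map_def PiE_def Pi_def)
    have m: "{t. c * t + y i \<in> A i} \<in> sets borel" if "i < n" for i
      using measurable_sets[of "\<lambda>t. c * t + y i" borel borel "A i"] A[OF that] by (simp add: vimage_def)
    have cn: "ennreal (c ^ n) = (\<Prod>i<n. ennreal c)" using c by (simp add: ennreal_power)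
    have "emeasure ?P (Pi\<^sub>E {..<n} A) = (\<Prod>i<n. ennreal c) * (\<Prod>i<n. emeasure lborel {t. c * t + y i \<in> A i})"
      unfolding cn[symmetric]
      using A m by (subst em) (auto intro!: sets_PiM_I_finite simp: box emeasure_lborel_n_box)
    also have "(\<Prod>i<n. ennreal c) * (\<Prod>i<n. emeasure lborel {t. c * t + y i \<in> A i}) = (\<Prod>i<n. emeasure lborel (A i))"
      unfolding prod.distrib[symmetric] using A c by (intro prod.cong refl emeasure_lborel_affine) auto
    finally show "emeasure ?P (Pi\<^sub>E {..<n} A) = (\<Prod>i<n. emeasure lborel (A i))" .
  qed auto
  then show ?thesis using em[OF S] by simp
qed

lemma sets_affine_map:
  assumes "S \<in> sets (lborel_n n)"
  shows "{x \<in> extensional {..<n}. affine_map n c y x \<in> S} \<in> sets (lborel_n n)"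
proof -
  have "affine_map n c y -` S \<inter> space (lborel_n n) = {x \<in> extensional {..<n}. affine_map n c y x \<in> S}"
    by (auto simp: space_lborel_n)
  then show ?thesis using measurable_sets[OF measurable_affine_map assms] by metis
qed

lemma measure_affine_map:
  assumes S: "S \<in> fmeasurable (lborel_n n)" and c: "0 < c"
  shows "{x \<in> extensional {..<n}. affine_map n c y x \<in> S} \<in> fmeasurable (lborel_n n)" (is "?T \<in> _")
    "measure (lborel_n n) S = c ^ n * measure (lborel_n n) {x \<in> extensional {..<n}. affine_map n c y x \<in> S}"
proof -
  have Ss: "S \<in> sets (lborel_n n)" "emeasure (lborel_n n) S < \<infinity>" using S by (auto simp: fmeasurable_def)
  note em = emeasure_affine_map[OF Ss(1) c, of y]
  have "0 < ennreal (c ^ n)" using c by simp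
  then have "emeasure (lborel_n n) ?T < \<infinity>" using Ss(2) c unfolding em by (auto simp: ennreal_mult_less_top)
  then show "?T \<in> fmeasurable (lborel_n n)" using sets_affine_map[OF Ss(1)] by (intro fmeasurableI) auto
  show "measure (lborel_n n) S = c ^ n * measure (lborel_n n) ?T"
    unfolding measure_def em using c by (simp add: enn2real_mult)
qed

section \<open>Slices of subsets of the product\<close>

lemma pair_sigma_finite_lborel_n: "pair_sigma_finite (lborel_n n) (lborel_n n)"
  by (intro pair_sigma_finite.intro sigma_finite_lborel_n)

lemma slice_sets:
  assumes E: "E \<in> sets (lborel_n n \<Otimes>\<^sub>M lborel_n n)" shows "{x. (x, y) \<in> E} \<in> sets (lborel_n n)"
proof -
  have "(\<lambda>x. (x, y)) -` E \<in> sets (lborel_n n)" by (rule sets_Pair2[OF E])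
  then show ?thesis by (simp add: vimage_def)
qed

lemma fmeasurable_sub_Times:
  assumes E: "E \<in> sets (lborel_n n \<Otimes>\<^sub>M lborel_n n)" "E \<subseteq> A \<times> B"
    and A: "A \<in> fmeasurable (lborel_n n)" and B: "B \<in> fmeasurable (lborel_n n)"
  shows "emeasure (lborel_n n \<Otimes>\<^sub>M lborel_n n) E < \<infinity>"
proof -
  interpret L: sigma_finite_measure "lborel_n n" by (rule sigma_finite_lborel_n)
  have "emeasure (lborel_n n \<Otimes>\<^sub>M lborel_n n) E \<le> emeasure (lborel_n n \<Otimes>\<^sub>M lborel_n n) (A \<times> B)"
    using E A B by (intro emeasure_mono pair_measureI) auto
  also have "\<dots> = emeasure (lborel_n n) A * emeasure (lborel_n n) B"
    using A B by (intro L.emeasure_pair_measure_Times) auto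
  also have "\<dots> < \<infinity>" using A B by (auto simp: fmeasurable_def ennreal_mult_less_top)
  finally show ?thesis .
qed

lemma measure_slices_ge:
  assumes E: "E \<in> sets (lborel_n n \<Otimes>\<^sub>M lborel_n n)" "E \<subseteq> A \<times> B"
    and A: "A \<in> fmeasurable (lborel_n n)" and B: "B \<in> fmeasurable (lborel_n n)"
    and t: "\<And>y. y \<in> B \<Longrightarrow> t \<le> measure (lborel_n n) {x. (x, y) \<in> E}" and t0: "0 \<le> t"
  shows "t * measure (lborel_n n) B \<le> measure (lborel_n n \<Otimes>\<^sub>M lborel_n n) E"
proof -
  let ?L = "lborel_n n"
  interpret P: pair_sigma_finite ?L ?L by (rule pair_sigma_finite_lborel_n)
  have Bs: "B \<in> sets ?L" using B by auto
  have "ennreal (t * measure ?L B) = (\<integral>\<^sup>+y. ennreal t * indicator B y \<partial>?L)"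
    using Bs t0 B by (simp add: nn_integral_cmult emeasure_eq_measure2 ennreal_mult)
  also have "\<dots> \<le> (\<integral>\<^sup>+y. emeasure ?L ((\<lambda>x. (x, y)) -` E) \<partial>?L)"
  proof (intro nn_integral_mono)
    fix y
    show "ennreal t * indicator B y \<le> emeasure ?L ((\<lambda>x. (x, y)) -` E)"
    proof (cases "y \<in> B")
      case True
      have "{x. (x, y) \<in> E} \<in> fmeasurable ?L"
        using E(2) by (intro fmeasurableI2[OF A _ slice_sets[OF E(1)]]) auto
      then have "emeasure ?L {x. (x, y) \<in> E} = ennreal (measure ?L {x. (x, y) \<in> E})"
        by (rule emeasure_eq_measure2)
      then show ?thesis using t[OF True] True by (simp add: vimage_def ennreal_leI)
    qed simp
  qed
  also have "\<dots> = emeasure (?L \<Otimes>\<^sub>M ?L) E" by (rule P.emeasure_pair_measure_alt2[OF E(1), symmetric])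
  also have "\<dots> = ennreal (measure (?L \<Otimes>\<^sub>M ?L) E)"
    using fmeasurable_sub_Times[OF E A B] by (intro emeasure_eq_ennreal_measure) auto
  finally show ?thesis by simp
qed

text \<open>Markov's inequality: the fraction of \<open>A\<close> missing from a slice is at most
  \<eta> on average over \<open>B\<close>, so it exceeds 2\<eta> on at most half of
  \<open>B\<close>.\<close>

lemma many_large_slices:
  assumes E: "E \<in> sets (lborel_n n \<Otimes>\<^sub>M lborel_n n)" "E \<subseteq> A \<times> B"
    and A: "A \<in> fmeasurable (lborel_n n)" "0 < measure (lborel_n n) A" and B: "B \<in> fmeasurable (lborel_n n)"
    and \<eta>: "0 < \<eta>" "2 * \<eta> \<le> 1"
    and big: "(1 - \<eta>) * measure (lborel_n n) A * measure (lborel_n n) B \<le> measure (lborel_n n \<Otimes>\<^sub>M lborel_n n) E"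
  obtains B' where "B' \<subseteq> B" "B' \<in> sets (lborel_n n)" "measure (lborel_n n) B / 2 \<le> measure (lborel_n n) B'"
    "\<And>y. y \<in> B' \<Longrightarrow> (1 - 2 * \<eta>) * measure (lborel_n n) A \<le> measure (lborel_n n) {x. (x, y) \<in> E}"
proof -
  let ?L = "lborel_n n"
  let ?a = "measure ?L A" and ?b = "measure ?L B"
  interpret P: pair_sigma_finite ?L ?L by (rule pair_sigma_finite_lborel_n)
  have Bs: "B \<in> sets ?L" using B by auto
  have slice: "{x. (x, y) \<in> E} \<in> fmeasurable ?L" "measure ?L {x. (x, y) \<in> E} \<le> ?a" for y
  proof -
    show f: "{x. (x, y) \<in> E} \<in> fmeasurable ?L"
      using E(2) by (intro fmeasurableI2[OF A(1) _ slice_sets[OF E(1)]]) auto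
    show "measure ?L {x. (x, y) \<in> E} \<le> ?a"
      using E(2) A(1) f by (intro measure_mono_fmeasurable) auto
  qed
  have em: "emeasure ?L ((\<lambda>x. (x, y)) -` E) = ennreal (measure ?L {x. (x, y) \<in> E})" for y
    using emeasure_eq_measure2[OF slice(1)] by (simp add: vimage_def)
  have meas: "(\<lambda>y. emeasure ?L ((\<lambda>x. (x, y)) -` E)) \<in> borel_measurable ?L"
    by (rule P.measurable_emeasure_Pair2[OF E(1)])
  define G where "G = {y \<in> space ?L. ennreal ((1 - 2 * \<eta>) * ?a) \<le> emeasure ?L ((\<lambda>x. (x, y)) -` E)}"
  have G: "G \<in> sets ?L" unfolding G_def using meas by measurable
  define B' where "B' = B \<inter> G"
  have B': "B' \<in> sets ?L" "B' \<subseteq> B" using Bs G by (auto simp: B'_def)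
  have B'f: "B' \<in> fmeasurable ?L" by (rule fmeasurableI2[OF B B'(2,1)])
  let ?b' = "measure ?L B'"
  have "emeasure (?L \<Otimes>\<^sub>M ?L) E = (\<integral>\<^sup>+y. emeasure ?L ((\<lambda>x. (x, y)) -` E) \<partial>?L)"
    by (rule P.emeasure_pair_measure_alt2[OF E(1)])
  also have "\<dots> \<le> (\<integral>\<^sup>+y. ennreal ?a * indicator B' y + ennreal ((1 - 2 * \<eta>) * ?a) * indicator (B - B') y \<partial>?L)"
  proof (intro nn_integral_mono)
    fix y assume y: "y \<in> space ?L"
    consider "y \<notin> B" | "y \<in> B'" | "y \<in> B - B'" by blast
    then show "emeasure ?L ((\<lambda>x. (x, y)) -` E) \<le> ennreal ?a * indicator B' y + ennreal ((1 - 2 * \<eta>) * ?a) * indicator (B - B') y"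
    proof cases
      case 1
      then have "(\<lambda>x. (x, y)) -` E = {}" using E(2) by auto
      then show ?thesis by simp
    next
      case 2
      then show ?thesis using slice(2)[of y] by (simp add: em ennreal_leI)
    next
      case 3
      then have "y \<notin> G" by (auto simp: B'_def)
      then show ?thesis using y 3 by (simp add: G_def less_imp_le)
    qed
  qed
  also have "\<dots> = ennreal ?a * emeasure ?L B' + ennreal ((1 - 2 * \<eta>) * ?a) * emeasure ?L (B - B')"
    using B' Bs by (simp add: nn_integral_add nn_integral_cmult)
  also have "emeasure ?L B' = ennreal ?b'" by (rule emeasure_eq_measure2[OF B'f])
  also have "emeasure ?L (B - B') = ennreal (?b - ?b')"
    using emeasure_eq_measure2[OF fmeasurable.Diff[OF B B'f]] measurable_measure_Diff[OF B B'(1,2)] by simp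
  finally have "emeasure (?L \<Otimes>\<^sub>M ?L) E \<le> ennreal ?a * ennreal ?b' + ennreal ((1 - 2 * \<eta>) * ?a) * ennreal (?b - ?b')" .
  also have "\<dots> = ennreal (?a * ?b' + (1 - 2 * \<eta>) * ?a * (?b - ?b'))"
    using \<eta> measure_mono_fmeasurable[OF B'(2,1) B] by (simp add: ennreal_mult ennreal_plus)
  finally have "enn2real (emeasure (?L \<Otimes>\<^sub>M ?L) E) \<le> ?a * ?b' + (1 - 2 * \<eta>) * ?a * (?b - ?b')"
    using \<eta> measure_mono_fmeasurable[OF B'(2,1) B]
    by (intro enn2real_leI add_nonneg_nonneg mult_nonneg_nonneg) auto
  then have "measure (?L \<Otimes>\<^sub>M ?L) E \<le> ?a * ?b' + (1 - 2 * \<eta>) * ?a * (?b - ?b')"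
    by (simp only: measure_def[of "?L \<Otimes>\<^sub>M ?L"])
  with big have "0 \<le> (?a * \<eta>) * (2 * ?b' - ?b)" by (simp add: algebra_simps)
  moreover have "0 < ?a * \<eta>" using A(2) \<eta>(1) by simp
  ultimately have "0 \<le> 2 * ?b' - ?b" by (simp only: zero_le_mult_iff not_le[symmetric]) auto
  then have "?b / 2 \<le> ?b'" by simp
  moreover have "(1 - 2 * \<eta>) * ?a \<le> measure ?L {x. (x, y) \<in> E}" if "y \<in> B'" for y
  proof -
    have "ennreal ((1 - 2 * \<eta>) * ?a) \<le> ennreal (measure ?L {x. (x, y) \<in> E})"
      using that by (simp add: B'_def G_def em)
    then show ?thesis by simp
  qed
  ultimately show ?thesis using that B' by blast
qed

section \<open>The defect of a set under translation\<close>

definition defect :: "nat \<Rightarrow> (nat \<Rightarrow> real) set \<Rightarrow> (nat \<Rightarrow> real) \<Rightarrow> real" where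
  "defect n A h = measure (lborel_n n) {x \<in> A. vec_add n x h \<notin> A}"

lemma vec_add_sets:
  assumes "A \<in> sets (lborel_n n)" shows "{x \<in> extensional {..<n}. vec_add n x h \<in> A} \<in> sets (lborel_n n)"
  unfolding vec_add_affine by (rule sets_affine_map[OF assms])

lemma defect_sets:
  assumes "A \<in> sets (lborel_n n)"
  shows "{x \<in> A. vec_add n x h \<notin> A} \<in> sets (lborel_n n)" "{x \<in> A. vec_add n x h \<in> A} \<in> sets (lborel_n n)"
proof -
  have A: "A \<subseteq> extensional {..<n}" using sets.sets_into_space[OF assms] by (simp add: space_lborel_n)
  have "{x \<in> A. vec_add n x h \<notin> A} = A - {x \<in> extensional {..<n}. vec_add n x h \<in> A}"
    "{x \<in> A. vec_add n x h \<in> A} = A \<inter> {x \<in> extensional {..<n}. vec_add n x h \<in> A}" using A by auto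
  then show "{x \<in> A. vec_add n x h \<notin> A} \<in> sets (lborel_n n)" "{x \<in> A. vec_add n x h \<in> A} \<in> sets (lborel_n n)"
    using vec_add_sets[OF assms] assms by auto
qed

text \<open>If x lies in \<open>A\<close> and x + h + h' does not, then either x + h is already
  outside \<open>A\<close>, or x + h is a point of \<open>A\<close> that h' moves out. The points x
  of the second kind lie in a translate of the defect set of h'.\<close>

lemma defect_add:
  assumes A: "A \<in> fmeasurable (lborel_n n)"
  shows "defect n A (vec_add n h h') \<le> defect n A h + defect n A h'"
proof -
  let ?L = "lborel_n n"
  have As: "A \<in> sets ?L" using A by auto
  have ext: "A \<subseteq> extensional {..<n}" using sets.sets_into_space[OF As] by (simp add: space_lborel_n)
  let ?D = "\<lambda>h. {x \<in> A. vec_add n x h \<notin> A}"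
  have f: "?D h \<in> fmeasurable ?L" for h by (rule fmeasurableI2[OF A _ defect_sets(1)[OF As]]) auto
  let ?T = "{x \<in> extensional {..<n}. affine_map n 1 h x \<in> ?D h'}"
  note T = measure_affine_map[OF f[of h'], of 1 h]
  have assoc: "vec_add n x (vec_add n h h') = vec_add n (vec_add n x h) h'" for x
    by (auto simp: vec_add_def fun_eq_iff restrict_def)
  have "?D (vec_add n h h') \<subseteq> ?D h \<union> ?T" using ext by (auto simp: assoc vec_add_affine[symmetric])
  then have "defect n A (vec_add n h h') \<le> measure ?L (?D h \<union> ?T)"
    unfolding defect_def using f T by (intro measure_mono_fmeasurable) auto
  also have "\<dots> \<le> measure ?L (?D h) + measure ?L ?T"
    using f T by (intro measure_Un_le) auto
  also have "measure ?L ?T = defect n A h'" using T(2) by (simp add: defect_def)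
  finally show ?thesis by (simp add: defect_def)
qed

lemma defect_multiple:
  assumes A: "A \<in> fmeasurable (lborel_n n)"
  shows "defect n A (\<lambda>i\<in>{..<n}. real (Suc k) * h i) \<le> real (Suc k) * defect n A h"
proof (induction k)
  case 0
  have "vec_add n x (\<lambda>i\<in>{..<n}. real (Suc 0) * h i) = vec_add n x h" for x
    by (auto simp: vec_add_def fun_eq_iff restrict_def)
  then show ?case unfolding defect_def by (simp only: of_nat_Suc of_nat_0 add_0_right mult_1_left order_refl)
next
  case (Suc k)
  have "(\<lambda>i\<in>{..<n}. real (Suc (Suc k)) * h i) = vec_add n (\<lambda>i\<in>{..<n}. real (Suc k) * h i) h"
    by (auto simp: vec_add_def fun_eq_iff restrict_def algebra_simps)
  then have "defect n A (\<lambda>i\<in>{..<n}. real (Suc (Suc k)) * h i) \<le>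
      defect n A (\<lambda>i\<in>{..<n}. real (Suc k) * h i) + defect n A h"
    using defect_add[OF A] by metis
  moreover have "real (Suc (Suc k)) * defect n A h = real (Suc k) * defect n A h + defect n A h"
    by (simp add: algebra_simps)
  ultimately show ?case using Suc by linarith
qed


text \<open>Two large parts of \<open>A\<close>, moved by y and y' into the same \<open>C\<close>,
  must overlap when \<open>C\<close> is hardly larger than \<open>A\<close>. In this way a small
  restricted sum makes \<open>A\<close> almost invariant under translation by y - y'.\<close>

lemma defect_difference:
  assumes A: "A \<in> fmeasurable (lborel_n n)" and C: "C \<in> fmeasurable (lborel_n n)"
    and S: "S \<in> sets (lborel_n n)" "S \<subseteq> A" "\<And>x. x \<in> S \<Longrightarrow> vec_add n x y \<in> C"
    and S': "S' \<in> sets (lborel_n n)" "S' \<subseteq> A" "\<And>x. x \<in> S' \<Longrightarrow> vec_add n x y' \<in> C"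
    and t: "t \<le> measure (lborel_n n) S" "t \<le> measure (lborel_n n) S'"
  shows "defect n A (\<lambda>i\<in>{..<n}. y i - y' i) \<le> measure (lborel_n n) A + measure (lborel_n n) C - 2 * t"
proof -
  let ?L = "lborel_n n" and ?h = "\<lambda>i\<in>{..<n}. y i - y' i"
  have ext: "X \<subseteq> extensional {..<n}" if "X \<in> fmeasurable ?L" for X
    using sets.sets_into_space[OF fmeasurableD[OF that]] by (simp add: space_lborel_n)
  have Sf: "S \<in> fmeasurable ?L" "S' \<in> fmeasurable ?L"
    using S S' by (auto intro: fmeasurableI2[OF A])
  \<comment> \<open>\<open>S + y\<close> and \<open>S' + y'\<close> are large subsets of \<open>C\<close>, so they overlap; pull the overlap back by \<open>y\<close>.\<close>
  define T where "T = {z \<in> extensional {..<n}. vec_add n z (\<lambda>i. - y i) \<in> S}"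
  define T' where "T' = {z \<in> extensional {..<n}. vec_add n z (\<lambda>i. - y' i) \<in> S'}"
  have T: "T \<in> fmeasurable ?L" "measure ?L T = measure ?L S"
    using measure_affine_map[OF Sf(1), of 1 "\<lambda>i. - y i"] by (auto simp: T_def vec_add_affine)
  have T': "T' \<in> fmeasurable ?L" "measure ?L T' = measure ?L S'"
    using measure_affine_map[OF Sf(2), of 1 "\<lambda>i. - y' i"] by (auto simp: T'_def vec_add_affine)
  have cancel: "vec_add n (vec_add n z (\<lambda>i. - u i)) u = z" if "z \<in> extensional {..<n}" for z u
    using that by (auto simp: vec_add_def fun_eq_iff extensional_def restrict_def)
  have TC: "T \<subseteq> C" "T' \<subseteq> C" using S(3) S'(3) cancel by (force simp: T_def T'_def)+
  define V where "V = {x \<in> extensional {..<n}. vec_add n x y \<in> T \<inter> T'}"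
  have TT: "T \<inter> T' \<in> fmeasurable ?L" using T T' by auto
  have V: "V \<in> fmeasurable ?L" "measure ?L V = measure ?L (T \<inter> T')"
    using measure_affine_map[OF TT, of 1 y] by (auto simp: V_def vec_add_affine)
  have "measure ?L (T \<union> T') \<le> measure ?L C" using TC C T T' by (intro measure_mono_fmeasurable) auto
  moreover have "measure ?L (T \<union> T') = measure ?L T + measure ?L T' - measure ?L (T \<inter> T')"
    using T(1) T'(1) by (rule measure_Un3)
  ultimately have "2 * t - measure ?L C \<le> measure ?L V" using t T T' V by linarith
  have Vsub: "V \<subseteq> A - {x \<in> A. vec_add n x ?h \<notin> A}"
  proof
    fix x assume x: "x \<in> V"
    then have xe: "x \<in> extensional {..<n}" by (simp add: V_def)
    have "vec_add n (vec_add n x y) (\<lambda>i. - y i) = x" "vec_add n (vec_add n x y) (\<lambda>i. - y' i) = vec_add n x ?h"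
      using xe by (auto simp: vec_add_def fun_eq_iff extensional_def restrict_def)
    then have "x \<in> S" "vec_add n x ?h \<in> S'" using x by (auto simp: V_def T_def T'_def)
    then show "x \<in> A - {x \<in> A. vec_add n x ?h \<notin> A}" using S(2) S'(2) by auto
  qed
  have Df: "{x \<in> A. vec_add n x ?h \<notin> A} \<in> fmeasurable ?L"
    by (rule fmeasurableI2[OF A _ defect_sets(1)]) (use A in auto)
  have "measure ?L V \<le> measure ?L (A - {x \<in> A. vec_add n x ?h \<notin> A})"
    using Vsub V(1) A Df by (intro measure_mono_fmeasurable) auto
  also have "\<dots> = measure ?L A - defect n A ?h"
    unfolding defect_def using Df A by (intro measurable_measure_Diff) auto
  finally show ?thesis using \<open>2 * t - measure ?L C \<le> measure ?L V\<close> by linarith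
qed

section \<open>Sets of very different sizes\<close>

lemma exp_minus_one_le:
  fixes x :: real assumes "0 \<le> x" "x \<le> 1" shows "exp x - 1 \<le> 2 * x"
  using exp_bound[OF assms] assms mult_left_mono[OF assms(2,1)] by (simp add: power2_eq_square)

text \<open>Failure of the conclusion gives |C| \<le> |A| (1 + \<tau>^2), and the chosen slices of
  \<Theta> miss at most 2\<eta>|A|; hence the differences y - y0 have defect at most |A| (\<tau>^2 +
  4\<eta>). Dilation multiplies this by about 1/\<tau>, which is still a small multiple of |A|. So
  almost all pairs in A \<times> H have their sum in \<open>A\<close>, and
  \<open>restricted_sum_large\<close> with \<open>A\<close> itself in the role of \<open>C\<close>
  yields |A| \<ge> (a^2 + h^2)^(n/2) > |A|.\<close>

lemma restricted_sum_small:
  assumes n: "1 \<le> n"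
    and A: "A \<in> fmeasurable (lborel_n n)" "0 < measure (lborel_n n) A"
    and B: "B \<in> fmeasurable (lborel_n n)" "0 < measure (lborel_n n) B"
    and \<Theta>: "\<Theta> \<in> sets (lborel_n n \<Otimes>\<^sub>M lborel_n n)" "\<Theta> \<subseteq> A \<times> B"
    and C: "C \<in> fmeasurable (lborel_n n)" "restricted_sum n \<Theta> \<subseteq> C"
  defines "a \<equiv> measure (lborel_n n) A powr (1 / n)" and "b \<equiv> measure (lborel_n n) B powr (1 / n)"
  defines "\<tau> \<equiv> b / a * sqrt n"
  assumes \<tau>: "\<tau> \<le> 1 / 2 ^ 19"
    and big: "(1 - \<tau> / 2 ^ 21) * measure (lborel_n n) A * measure (lborel_n n) B \<le>
      measure (lborel_n n \<Otimes>\<^sub>M lborel_n n) \<Theta>"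
  shows "(a\<^sup>2 + b\<^sup>2) powr (n / 2) \<le> measure (lborel_n n) C"
proof (rule ccontr)
  assume neg: "\<not> (a\<^sup>2 + b\<^sup>2) powr (n / 2) \<le> measure (lborel_n n) C"
  let ?L = "lborel_n n"
  let ?A = "measure ?L A" and ?B = "measure ?L B"
  have small: "measure ?L C < (a\<^sup>2 + b\<^sup>2) powr (n / 2)" using neg by simp
  have n0: "0 < real n" using n by simp
  have a0: "0 < a" and b0: "0 < b" using A B by (auto simp: a_def b_def)
  have an: "a ^ n = ?A" and bn: "b ^ n = ?B"
    using A B n0 by (auto simp: a_def b_def powr_realpow[symmetric] powr_powr simp del: powr_realpow)
  define r where "r = b / a"
  have r0: "0 < r" using a0 b0 by (simp add: r_def)
  have \<tau>r: "\<tau> = r * sqrt n" by (simp add: \<tau>_def r_def)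
  have \<tau>0: "0 < \<tau>" using r0 n0 by (simp add: \<tau>r)
  have \<tau>sq: "\<tau>\<^sup>2 = r\<^sup>2 * n" using n0 by (simp add: \<tau>r power_mult_distrib)
  have \<tau>1: "\<tau> \<le> 1" using \<tau> by simp
  \<comment> \<open>The bound (1 + r^2)^(n/2) \<le> exp (n r^2 / 2) = exp (\<tau>^2 / 2) is uniform
    in n.\<close>
  have Cle: "measure ?L C \<le> ?A * (1 + \<tau>\<^sup>2)"
  proof -
    have "a\<^sup>2 + b\<^sup>2 = a\<^sup>2 * (1 + r\<^sup>2)" using a0 by (simp add: r_def power_divide distrib_left)
    then have "(a\<^sup>2 + b\<^sup>2) powr (n / 2) = (a\<^sup>2 * (1 + r\<^sup>2)) powr (n / 2)" by simp
    also have "\<dots> = (a\<^sup>2) powr (n / 2) * (1 + r\<^sup>2) powr (n / 2)"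
      by (rule powr_mult)
    also have "(a\<^sup>2) powr (n / 2) = ?A"
    proof -
      have "(a\<^sup>2) powr (n / 2) = (a powr 2) powr (n / 2)" using a0 by simp
      also have "\<dots> = a powr n" by (simp add: powr_powr)
      finally show ?thesis using a0 an by (simp add: powr_realpow)
    qed
    also have "(1 + r\<^sup>2) powr (n / 2) \<le> exp (r\<^sup>2) powr (n / 2)"
      by (intro powr_mono2) (auto simp: add_nonneg_nonneg)
    also have "exp (r\<^sup>2) powr (n / 2) = exp (\<tau>\<^sup>2 / 2)" by (simp add: \<tau>sq powr_def)
    also have "exp (\<tau>\<^sup>2 / 2) \<le> 1 + \<tau>\<^sup>2"
    proof -
      have "\<tau>\<^sup>2 \<le> 1" using \<tau>0 \<tau>1 by (simp add: power_le_one)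
      then show ?thesis using exp_minus_one_le[of "\<tau>\<^sup>2 / 2"] by simp
    qed
    finally show ?thesis using small A(2) by (simp add: mult_left_mono)
  qed
  define \<eta> where "\<eta> = \<tau> / 2 ^ 21"
  have \<eta>: "0 < \<eta>" "2 * \<eta> \<le> 1" using \<tau>0 \<tau> by (auto simp: \<eta>_def)
  obtain B' where B': "B' \<subseteq> B" "B' \<in> sets ?L" "?B / 2 \<le> measure ?L B'"
    "\<And>y. y \<in> B' \<Longrightarrow> (1 - 2 * \<eta>) * ?A \<le> measure ?L {x. (x, y) \<in> \<Theta>}"
    using many_large_slices[OF \<Theta> A B(1) \<eta> big[folded \<eta>_def]] by blast
  have B'f: "B' \<in> fmeasurable ?L" by (rule fmeasurableI2[OF B(1) B'(1,2)])
  have "B' \<noteq> {}" using B'(3) B(2) by auto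
  then obtain y0 where y0: "y0 \<in> B'" by blast
  have def1: "defect n A (\<lambda>i\<in>{..<n}. y i - y0 i) \<le> ?A * (\<tau>\<^sup>2 + 4 * \<eta>)" if y: "y \<in> B'" for y
  proof -
    have "defect n A (\<lambda>i\<in>{..<n}. y i - y0 i) \<le> ?A + measure ?L C - 2 * ((1 - 2 * \<eta>) * ?A)"
      using \<Theta>(2) C(2)
      by (intro defect_difference[OF A(1) C(1) slice_sets[OF \<Theta>(1)] _ _ slice_sets[OF \<Theta>(1)] _ _ B'(4)[OF y] B'(4)[OF y0]])
        (auto simp: restricted_sum_def)
    then show ?thesis using Cle by (simp add: algebra_simps)
  qed
  \<comment> \<open>\<open>Suc k\<close> is the ceiling of 1/\<tau>, in the successor form of
    \<open>defect_multiple\<close>; its product with \<tau> lies between 1 and 2.\<close>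
  define k where "k = nat \<lceil>1 / \<tau>\<rceil> - 1"
  have k: "real (Suc k) * \<tau> \<le> 2" "1 \<le> real (Suc k) * \<tau>"
  proof -
    have "0 < 1 / \<tau>" using \<tau>0 by simp
    then have "1 \<le> \<lceil>1 / \<tau>\<rceil>" by linarith
    then have "int (Suc k) = \<lceil>1 / \<tau>\<rceil>" unfolding k_def by linarith
    then have c: "real (Suc k) = real_of_int \<lceil>1 / \<tau>\<rceil>" by (metis of_int_of_nat_eq)
    have "real (Suc k) \<le> 1 / \<tau> + 1" "1 / \<tau> \<le> real (Suc k)" unfolding c by linarith+
    then have "real (Suc k) * \<tau> \<le> (1 / \<tau> + 1) * \<tau>" "1 / \<tau> * \<tau> \<le> real (Suc k) * \<tau>"
      using \<tau>0 by (intro mult_right_mono; simp)+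
    moreover have "(1 / \<tau> + 1) * \<tau> = 1 + \<tau>" "1 / \<tau> * \<tau> = 1" using \<tau>0 by (simp_all add: field_simps)
    ultimately show "real (Suc k) * \<tau> \<le> 2" "1 \<le> real (Suc k) * \<tau>" using \<tau>1 by linarith+
  qed
  let ?k = "real (Suc k)"
  have k0: "0 < 1 / ?k" by simp
  \<comment> \<open>The dilate of B' - y0 by the factor \<open>Suc k\<close>, written as a preimage
    to suit \<open>measure_affine_map\<close>.\<close>
  define H where "H = {x \<in> extensional {..<n}. affine_map n (1 / ?k) y0 x \<in> B'}"
  note Hm = measure_affine_map[OF B'f k0, of y0, folded H_def]
  have Hf: "H \<in> fmeasurable ?L" by (rule Hm(1))
  have mH: "measure ?L H = ?k ^ n * measure ?L B'"
    unfolding Hm(2) by (simp add: power_one_over)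
  have defH: "defect n A x \<le> ?k * (?A * (\<tau>\<^sup>2 + 4 * \<eta>))" if x: "x \<in> H" for x
  proof -
    let ?y = "affine_map n (1 / ?k) y0 x"
    have "(\<lambda>i\<in>{..<n}. ?k * (\<lambda>i\<in>{..<n}. ?y i - y0 i) i) = x"
      using x by (auto simp: H_def affine_map_def fun_eq_iff restrict_def extensional_def)
    then have "defect n A x \<le> ?k * defect n A (\<lambda>i\<in>{..<n}. ?y i - y0 i)"
      using defect_multiple[OF A(1), of k "\<lambda>i\<in>{..<n}. ?y i - y0 i"] by simp
    also have "\<dots> \<le> ?k * (?A * (\<tau>\<^sup>2 + 4 * \<eta>))"
      using x by (intro mult_left_mono def1) (auto simp: H_def)
    finally show ?thesis .
  qed
  \<comment> \<open>The thresholds 2^-19 for \<tau> and 2^-21 for \<eta>/\<tau> bound the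
    accumulated loss by 2^-17, below the 2^-16 that \<open>restricted_sum_large\<close> tolerates
    for \<delta> = 1/4.\<close>
  have loss: "?k * (\<tau>\<^sup>2 + 4 * \<eta>) \<le> (1 / 4) ^ 4 / 256"
  proof -
    have "?k * (\<tau>\<^sup>2 + 4 * \<eta>) = (?k * \<tau>) * (\<tau> + 4 / 2 ^ 21)"
      by (simp add: \<eta>_def power2_eq_square algebra_simps)
    also have "\<dots> \<le> 2 * (1 / 2 ^ 19 + 4 / 2 ^ 21)"
      using k \<tau> \<tau>0 by (intro mult_mono) auto
    also have "\<dots> \<le> (1 / 4) ^ 4 / 256" by (simp add: power_divide)
    finally show ?thesis .
  qed
  define E where "E = {p \<in> A \<times> H. vec_add n (fst p) (snd p) \<in> A}"
  have As: "A \<in> sets ?L" and Hs: "H \<in> sets ?L" using A Hf by auto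
  have Es: "E \<in> sets (?L \<Otimes>\<^sub>M ?L)"
  proof -
    have "(\<lambda>p. vec_add n (fst p) (snd p)) \<in> ?L \<Otimes>\<^sub>M ?L \<rightarrow>\<^sub>M ?L"
      unfolding vec_add_def by (intro measurable_restrict) simp
    from measurable_sets[OF this As]
    have "(\<lambda>p. vec_add n (fst p) (snd p)) -` A \<inter> space (?L \<Otimes>\<^sub>M ?L) \<in> sets (?L \<Otimes>\<^sub>M ?L)" .
    moreover have AH: "A \<times> H \<in> sets (?L \<Otimes>\<^sub>M ?L)" using As Hs by (rule pair_measureI)
    moreover have "E = (A \<times> H) \<inter> ((\<lambda>p. vec_add n (fst p) (snd p)) -` A \<inter> space (?L \<Otimes>\<^sub>M ?L))"
      using sets.sets_into_space[OF AH] by (auto simp: E_def)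
    ultimately show ?thesis by simp
  qed
  have EA: "E \<subseteq> A \<times> H" by (auto simp: E_def)
  have "(1 - (1 / 4) ^ 4 / 256) * (?A * measure ?L H) \<le> measure (?L \<Otimes>\<^sub>M ?L) E"
  proof -
    have "((1 - (1 / 4) ^ 4 / 256) * ?A) * measure ?L H \<le> measure (?L \<Otimes>\<^sub>M ?L) E"
    proof (rule measure_slices_ge[OF Es EA A(1) Hf])
      fix x assume x: "x \<in> H"
      have "{z. (z, x) \<in> E} = A - {z \<in> A. vec_add n z x \<notin> A}" using x by (auto simp: E_def)
      also have "measure ?L \<dots> = ?A - defect n A x"
        unfolding defect_def using A(1) defect_sets(1)[OF As] by (intro measurable_measure_Diff) auto
      finally have "measure ?L {z. (z, x) \<in> E} = ?A - defect n A x" .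
      moreover have "?A * (?k * (\<tau>\<^sup>2 + 4 * \<eta>)) \<le> ?A * ((1 / 4) ^ 4 / 256)"
        using A(2) by (intro mult_left_mono loss) auto
      ultimately show "(1 - (1 / 4) ^ 4 / 256) * ?A \<le> measure ?L {z. (z, x) \<in> E}"
        using defH[OF x] by (simp add: algebra_simps)
    qed (use A(2) in \<open>simp add: power_divide\<close>)
    then show ?thesis by (simp only: mult.assoc)
  qed
  note bigE = this
  have mH0: "0 < measure ?L H" using mH B'(3) B(2) by simp
  define h where "h = measure ?L H powr (1 / n)"
  have h0: "0 < h" using mH0 by (simp add: h_def)
  have hn: "h ^ n = measure ?L H" using mH0 n0 by (simp add: h_def powr_realpow[symmetric] powr_powr del: powr_realpow)
  have hle: "h \<le> ?k * b"
  proof -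
    have "h ^ n \<le> (?k * b) ^ n"
      unfolding hn mH power_mult_distrib bn
      using B'(1,2) B(1) by (intro mult_left_mono measure_mono_fmeasurable) auto
    then show ?thesis using b0 n by (subst (asm) power_mono_iff) (use h0 in auto)
  qed
  \<comment> \<open>\<open>B'\<close> has at least half the measure of \<open>B\<close>, and (1/2)^n
    \<le> 1/2 turns this into at least half the n-th root in every dimension.\<close>
  have hge: "?k * b / 2 \<le> h"
  proof -
    have "(1 / 2 :: real) ^ n \<le> 1 / 2" using n power_decreasing[of 1 n "1/2::real"] by simp
    then have "?B * (1 / 2) ^ n \<le> ?B * (1 / 2)" using B(2) by (intro mult_left_mono) auto
    then have "?B * (1 / 2) ^ n \<le> measure ?L B'" using B'(3) by simp
    then have "?k ^ n * (?B * (1 / 2) ^ n) \<le> ?k ^ n * measure ?L B'" by (intro mult_left_mono) auto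
    then have "(?k * b / 2) ^ n \<le> h ^ n"
      unfolding hn mH bn[symmetric] by (simp add: power_mult_distrib power_divide mult_ac)
    then show ?thesis using b0 n h0 by (subst (asm) power_mono_iff) auto
  qed
  define s where "s = h / a * sqrt n"
  have sk: "?k * b / a * sqrt n = ?k * \<tau>" by (simp add: \<tau>_def)
  have s: "1 / 2 \<le> s" "s \<le> 2"
  proof -
    have "?k * b / 2 / a * sqrt n \<le> s" unfolding s_def using hge a0 by (intro mult_right_mono divide_right_mono) auto
    moreover have "?k * b / 2 / a * sqrt n = ?k * \<tau> / 2" using sk by simp
    ultimately show "1 / 2 \<le> s" using k by linarith
    have "s \<le> ?k * b / a * sqrt n" unfolding s_def using hle a0 by (intro mult_right_mono divide_right_mono) auto
    then show "s \<le> 2" using k sk by linarith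
  qed
  \<comment> \<open>Since s = (h / a) sqrt n lies in [1/2, 2], the product (s - 1/2)(2 - s) is
    nonnegative, which gives 1 + s^2 \<le> 4s. With h / a \<le> s this is the ratio condition for
    \<delta> = 1/4.\<close>
  have cond: "1 / 4 * (a\<^sup>2 + h\<^sup>2) \<le> a * h * sqrt n"
  proof -
    have "h / a \<le> s"
    proof -
      have "h / a * 1 \<le> h / a * sqrt n" using a0 h0 n by (intro mult_left_mono) auto
      then show ?thesis by (simp add: s_def)
    qed
    define w where "w = (h / a)\<^sup>2"
    from \<open>h / a \<le> s\<close> have "w \<le> s\<^sup>2" unfolding w_def using a0 h0 by (intro power_mono) auto
    moreover have "1 + s\<^sup>2 \<le> 4 * s"
    proof -
      have "0 \<le> (s - 1 / 2) * (2 - s)" using s by simp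
      moreover have "(s - 1 / 2) * (2 - s) = 5 / 2 * s - s\<^sup>2 - 1"
        by (simp add: power2_eq_square field_simps)
      ultimately show ?thesis using s by linarith
    qed
    ultimately have "1 + w \<le> 4 * s" by (meson add_left_mono order_trans)
    then have "1 / 4 * (1 + w) \<le> s" by simp
    then have "a\<^sup>2 * (1 / 4 * (1 + w)) \<le> a\<^sup>2 * s" by (intro mult_left_mono) auto
    moreover have "a\<^sup>2 * (1 / 4 * (1 + w)) = 1 / 4 * (a\<^sup>2 + h\<^sup>2)"
      using a0 by (simp add: w_def power_divide distrib_left)
    moreover have "a\<^sup>2 * s = a * h * sqrt n" using a0 by (simp add: s_def power2_eq_square)
    ultimately show ?thesis by simp
  qed
  have EC: "restricted_sum n E \<subseteq> A" by (auto simp: restricted_sum_def E_def)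
  have fA: "emeasure ?L A < \<infinity>" and fH: "emeasure ?L H < \<infinity>" using A Hf by (auto simp: fmeasurable_def)
  have "(a\<^sup>2 + h\<^sup>2) powr (n / 2) \<le> ?A"
    using restricted_sum_large[OF n _ _ As fA A(2) Hs fH mH0 Es EA As fA EC bigE, folded a_def h_def] cond
    by (simp add: power2_eq_square)
  moreover have "?A < (a\<^sup>2 + h\<^sup>2) powr (n / 2)"
  proof -
    have "?A = (a powr 2) powr (n / 2)" using a0 an by (simp add: powr_powr powr_realpow del: powr_numeral)
    also have "a powr 2 = a\<^sup>2" using a0 by simp
    also have "(a\<^sup>2) powr (n / 2) < (a\<^sup>2 + h\<^sup>2) powr (n / 2)"
      using a0 h0 n0 by (intro powr_less_mono2) auto
    finally show ?thesis .
  qed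
  ultimately show False by simp
qed

text \<open>The second case dictates the constant: \<tau> > 2^-19 and b \<le> a give the ratio
  condition of \<open>restricted_sum_large\<close> for \<delta> = 2^-20, whose tolerated loss is
  \<delta>^4/256 = 2^-88. This is far below the loss \<tau> / 2^21 tolerated in the first
  case.\<close>

proposition restricted_sum_ordered:
  assumes n: "1 \<le> n"
    and A: "A \<in> fmeasurable (lborel_n n)"
    and B: "B \<in> fmeasurable (lborel_n n)" "0 < measure (lborel_n n) B"
    and BA: "measure (lborel_n n) B \<le> measure (lborel_n n) A"
    and \<Theta>: "\<Theta> \<in> sets (lborel_n n \<Otimes>\<^sub>M lborel_n n)" "\<Theta> \<subseteq> A \<times> B"
    and C: "C \<in> fmeasurable (lborel_n n)" "restricted_sum n \<Theta> \<subseteq> C"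
  defines "a \<equiv> measure (lborel_n n) A powr (1 / n)" and "b \<equiv> measure (lborel_n n) B powr (1 / n)"
  assumes big: "(1 - 1 / 2 ^ 88 * min (b / a * sqrt n) 1) * measure (lborel_n n) A * measure (lborel_n n) B \<le>
      measure (lborel_n n \<Otimes>\<^sub>M lborel_n n) \<Theta>"
  shows "(a\<^sup>2 + b\<^sup>2) powr (n / 2) \<le> measure (lborel_n n) C"
proof -
  let ?L = "lborel_n n"
  have A0: "0 < measure ?L A" using BA B(2) by linarith
  have a0: "0 < a" and b0: "0 < b" using A0 B by (auto simp: a_def b_def)
  have ba: "b \<le> a" unfolding a_def b_def using BA B(2) n by (intro powr_mono2) auto
  define \<tau> where "\<tau> = b / a * sqrt n"
  have \<tau>0: "0 < \<tau>" using a0 b0 n by (simp add: \<tau>_def)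
  have weaken: "(1 - \<epsilon>) * (measure ?L A * measure ?L B) \<le> measure (?L \<Otimes>\<^sub>M ?L) \<Theta>" if "1 / 2 ^ 88 * min \<tau> 1 \<le> \<epsilon>" for \<epsilon>
  proof -
    have "(1 - \<epsilon>) * (measure ?L A * measure ?L B) \<le> (1 - 1 / 2 ^ 88 * min \<tau> 1) * (measure ?L A * measure ?L B)"
      using that by (intro mult_right_mono) auto
    then show ?thesis using big by (simp add: \<tau>_def mult.assoc)
  qed
  show ?thesis
  proof (cases "\<tau> \<le> 1 / 2 ^ 19")
    case True
    have "1 / 2 ^ 88 * min \<tau> 1 \<le> \<tau> / 2 ^ 21" using \<tau>0 by (simp add: min_def)
    from weaken[OF this] show ?thesis
      using restricted_sum_small[OF n A A0 B \<Theta> C] True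
      by (simp add: a_def b_def \<tau>_def mult.assoc)
  next
    case False
    define \<delta> :: real where "\<delta> = 1 / 2 ^ 20"
    have "1 / 2 ^ 88 * min \<tau> 1 \<le> \<delta> ^ 4 / 256" by (simp add: \<delta>_def power_divide min_def)
    note big' = weaken[OF this]
    have "\<delta> * (a\<^sup>2 + b\<^sup>2) \<le> a * b * sqrt n"
    proof -
      have "b\<^sup>2 \<le> a\<^sup>2" using ba b0 by (intro power_mono) auto
      then have "\<delta> * (a\<^sup>2 + b\<^sup>2) \<le> \<delta> * (2 * a\<^sup>2)" by (intro mult_left_mono) (auto simp: \<delta>_def)
      also have "\<dots> = 1 / 2 ^ 19 * a\<^sup>2" by (simp add: \<delta>_def)
      also have "\<dots> \<le> \<tau> * a\<^sup>2" using False by (intro mult_right_mono) auto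
      also have "\<dots> = a * b * sqrt n" using a0 by (simp add: \<tau>_def power2_eq_square)
      finally show ?thesis .
    qed
    moreover have "0 < \<delta>" "\<delta>\<^sup>2 \<le> 1 / 2" by (auto simp: \<delta>_def power_divide)
    moreover have "A \<in> sets ?L" "emeasure ?L A < \<infinity>" "B \<in> sets ?L" "emeasure ?L B < \<infinity>" "C \<in> sets ?L" "emeasure ?L C < \<infinity>"
      using A B C by (auto simp: fmeasurable_def)
    ultimately show ?thesis
      unfolding a_def b_def using n A0 B(2) \<Theta> C(2) big' by (intro restricted_sum_large[of n \<delta> A B \<Theta> C]) auto
  qed
qed

section \<open>Exchange of the two sets, and passage to the completion\<close>

lemma restricted_sum_swap: "restricted_sum n (prod.swap ` \<Theta>) = restricted_sum n \<Theta>"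
proof -
  have "vec_add n x y = vec_add n y x" for x y by (simp add: vec_add_def add.commute)
  then show ?thesis by (auto simp: restricted_sum_def)
qed

lemma swap_measure:
  assumes "\<Theta> \<in> sets (lborel_n n \<Otimes>\<^sub>M lborel_n n)"
  shows "prod.swap ` \<Theta> \<in> sets (lborel_n n \<Otimes>\<^sub>M lborel_n n)"
    "measure (lborel_n n \<Otimes>\<^sub>M lborel_n n) (prod.swap ` \<Theta>) = measure (lborel_n n \<Otimes>\<^sub>M lborel_n n) \<Theta>"
proof -
  let ?L2 = "lborel_n n \<Otimes>\<^sub>M lborel_n n"
  interpret P: pair_sigma_finite "lborel_n n" "lborel_n n" by (rule pair_sigma_finite_lborel_n)
  have "\<Theta> \<subseteq> space ?L2" by (rule sets.sets_into_space[OF assms])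
  then have e: "prod.swap ` \<Theta> = (\<lambda>(x, y). (y, x)) -` \<Theta> \<inter> space ?L2"
    by (force simp: space_pair_measure)
  show s: "prod.swap ` \<Theta> \<in> sets ?L2" unfolding e by (rule measurable_sets[OF measurable_pair_swap' assms])
  have "emeasure ?L2 \<Theta> = emeasure (distr ?L2 ?L2 (\<lambda>(x, y). (y, x))) \<Theta>"
    using P.distr_pair_swap by simp
  also have "\<dots> = emeasure ?L2 (prod.swap ` \<Theta>)"
    unfolding e by (rule emeasure_distr[OF measurable_pair_swap' assms])
  finally show "measure ?L2 (prod.swap ` \<Theta>) = measure ?L2 \<Theta>" by (simp add: measure_def)
qed

text \<open>The two-sided bound on the ratio says that \<rho> is at most b/a and at most a/b, so the
  hypothesis on \<Theta> remains true with either quotient in place of \<rho>. Hence the sets may be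
  exchanged so that the larger one comes first.\<close>

proposition restricted_sum_borel:
  assumes n: "1 \<le> n"
    and A: "A \<in> fmeasurable (lborel_n n)" "0 < measure (lborel_n n) A"
    and B: "B \<in> fmeasurable (lborel_n n)" "0 < measure (lborel_n n) B"
    and \<Theta>: "\<Theta> \<in> sets (lborel_n n \<Otimes>\<^sub>M lborel_n n)" "\<Theta> \<subseteq> A \<times> B"
    and C: "C \<in> fmeasurable (lborel_n n)" "restricted_sum n \<Theta> \<subseteq> C"
    and \<rho>: "0 < \<rho>" "\<rho> \<le> (measure (lborel_n n) B / measure (lborel_n n) A) powr (1 / n)"
      "(measure (lborel_n n) B / measure (lborel_n n) A) powr (1 / n) \<le> inverse \<rho>"
    and big: "(1 - 1 / 2 ^ 88 * min (\<rho> * sqrt n) 1) * measure (lborel_n n) A * measure (lborel_n n) B \<le>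
      measure (lborel_n n \<Otimes>\<^sub>M lborel_n n) \<Theta>"
  shows "measure (lborel_n n) A powr (2 / n) + measure (lborel_n n) B powr (2 / n) \<le> measure (lborel_n n) C powr (2 / n)"
proof -
  let ?L = "lborel_n n"
  let ?A = "measure ?L A" and ?B = "measure ?L B"
  let ?a = "?A powr (1 / n)" and ?b = "?B powr (1 / n)"
  have n0: "0 < real n" using n by simp
  have a0: "0 < ?a" and b0: "0 < ?b" using A B by auto
  have quot: "(?B / ?A) powr (1 / n) = ?b / ?a" by (simp add: powr_divide)
  have \<rho>1: "\<rho> \<le> ?b / ?a" using \<rho>(2) unfolding quot .
  have \<rho>2: "\<rho> \<le> ?a / ?b"
  proof -
    have "?b / ?a \<le> inverse \<rho>" using \<rho>(3) unfolding quot .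
    then have "inverse (inverse \<rho>) \<le> inverse (?b / ?a)" using a0 b0 by (intro le_imp_inverse_le) auto
    then show ?thesis by (simp add: inverse_divide)
  qed
  have weaken: "(1 - 1 / 2 ^ 88 * min (t * sqrt n) 1) * (?A * ?B) \<le> measure (?L \<Otimes>\<^sub>M ?L) \<Theta>" if "\<rho> \<le> t" for t
  proof -
    have "\<rho> * sqrt n \<le> t * sqrt n" using that by (intro mult_right_mono) auto
    then have "min (\<rho> * sqrt n) 1 \<le> min (t * sqrt n) 1" by (rule min.mono) simp
    then have "(1 - 1 / 2 ^ 88 * min (t * sqrt n) 1) * (?A * ?B) \<le> (1 - 1 / 2 ^ 88 * min (\<rho> * sqrt n) 1) * (?A * ?B)"
      by (intro mult_right_mono diff_left_mono mult_left_mono) auto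
    then show ?thesis using big by (simp add: mult.assoc)
  qed
  have main: "(?a\<^sup>2 + ?b\<^sup>2) powr (n / 2) \<le> measure ?L C"
  proof (cases "?B \<le> ?A")
    case True
    show ?thesis
      using restricted_sum_ordered[OF n A(1) B True \<Theta> C] weaken[OF \<rho>1] by (simp add: mult.assoc)
  next
    case False
    then have le: "?A \<le> ?B" by simp
    note S = swap_measure[OF \<Theta>(1)]
    have sub: "prod.swap ` \<Theta> \<subseteq> B \<times> A" using \<Theta>(2) by auto
    have C': "restricted_sum n (prod.swap ` \<Theta>) \<subseteq> C" using C(2) by (simp add: restricted_sum_swap)
    show ?thesis
      using restricted_sum_ordered[OF n B(1) A le S(1) sub C(1) C'] weaken[OF \<rho>2] S(2)
      by (simp add: mult_ac add.commute)
  qed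
  have s0: "0 \<le> ?a\<^sup>2 + ?b\<^sup>2" by simp
  have sq: "(x powr (1 / n))\<^sup>2 = x powr (2 / n)" if "0 < x" for x :: real
    using that by (simp add: power2_eq_square powr_add[symmetric])
  have "?a\<^sup>2 + ?b\<^sup>2 = ((?a\<^sup>2 + ?b\<^sup>2) powr (n / 2)) powr (2 / n)"
    using n0 s0 by (simp add: powr_powr)
  also have "\<dots> \<le> measure ?L C powr (2 / n)" by (intro powr_mono2 main) auto
  finally show ?thesis using sq A(2) B(2) by simp
qed

theorem theorem1p2:
  shows "\<exists>c::real. c > 0 \<and>
    (\<forall>(\<rho>::real) (n::nat) (A::(nat \<Rightarrow> real) set) (B::(nat \<Rightarrow> real) set)
      (\<Theta>::((nat \<Rightarrow> real) \<times> (nat \<Rightarrow> real)) set).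
      0 < \<rho> \<longrightarrow> \<rho> < 1 \<longrightarrow> 1 \<le> n \<longrightarrow>
      A \<in> sets (lebesgue_n n) \<longrightarrow> B \<in> sets (lebesgue_n n) \<longrightarrow>
      \<Theta> \<in> sets (lebesgue_2n n) \<longrightarrow> \<Theta> \<subseteq> A \<times> B \<longrightarrow>
      restricted_sum n \<Theta> \<in> sets (lebesgue_n n) \<longrightarrow>
      0 < emeasure (lebesgue_n n) A \<longrightarrow> emeasure (lebesgue_n n) A < \<infinity> \<longrightarrow>
      0 < emeasure (lebesgue_n n) B \<longrightarrow> emeasure (lebesgue_n n) B < \<infinity> \<longrightarrow>
      \<rho> \<le> (measure (lebesgue_n n) B / measure (lebesgue_n n) A) powr (1 / real n) \<longrightarrow>
      (measure (lebesgue_n n) B / measure (lebesgue_n n) A) powr (1 / real n) \<le> inverse \<rho> \<longrightarrow>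
      measure (lebesgue_2n n) \<Theta>
        \<ge> (1 - c * min (\<rho> * sqrt (real n)) 1)
            * measure (lebesgue_n n) A * measure (lebesgue_n n) B \<longrightarrow>
      ennpowr (emeasure (lebesgue_n n) (restricted_sum n \<Theta>)) (2 / real n)
        \<ge> ennpowr (emeasure (lebesgue_n n) A) (2 / real n)
          + ennpowr (emeasure (lebesgue_n n) B) (2 / real n))"
proof (intro exI[of _ "1 / 2 ^ 88"] conjI allI impI)
  fix \<rho> :: real and n :: nat and A B :: "(nat \<Rightarrow> real) set" and \<Theta> :: "((nat \<Rightarrow> real) \<times> (nat \<Rightarrow> real)) set"
  assume \<rho>: "0 < \<rho>" "\<rho> < 1" and n: "1 \<le> n"
    and sets: "A \<in> sets (lebesgue_n n)" "B \<in> sets (lebesgue_n n)" "\<Theta> \<in> sets (lebesgue_2n n)"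
    and sub: "\<Theta> \<subseteq> A \<times> B" and sum: "restricted_sum n \<Theta> \<in> sets (lebesgue_n n)"
    and A: "0 < emeasure (lebesgue_n n) A" "emeasure (lebesgue_n n) A < \<infinity>"
    and B: "0 < emeasure (lebesgue_n n) B" "emeasure (lebesgue_n n) B < \<infinity>"
    and \<rho>12: "\<rho> \<le> (measure (lebesgue_n n) B / measure (lebesgue_n n) A) powr (1 / real n)"
      "(measure (lebesgue_n n) B / measure (lebesgue_n n) A) powr (1 / real n) \<le> inverse \<rho>"
    and big: "measure (lebesgue_2n n) \<Theta> \<ge> (1 - 1 / 2 ^ 88 * min (\<rho> * sqrt (real n)) 1)
            * measure (lebesgue_n n) A * measure (lebesgue_n n) B"
  let ?C = "restricted_sum n \<Theta>"
  let ?L = "lborel_n n"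
  show "ennpowr (emeasure (lebesgue_n n) ?C) (2 / real n)
        \<ge> ennpowr (emeasure (lebesgue_n n) A) (2 / real n) + ennpowr (emeasure (lebesgue_n n) B) (2 / real n)"
  proof (cases "emeasure (lebesgue_n n) ?C = \<infinity>")
    case True
    then show ?thesis by (simp add: ennpowr_def)
  next
    case False
    \<comment> \<open>\<open>A\<close>, \<open>B\<close> and the sum are enlarged to measurable
      envelopes, but \<Theta> is shrunk to its main part: then T \<subseteq> A1 \<times> B1, the sum
      over T stays in C1, and all four measures are unchanged. The sum over T itself may fail to be
      measurable before completion, which is why the preceding propositions speak of a superset
      \<open>C\<close>.\<close>
    have up: "\<exists>X'\<in>sets ?L. X \<subseteq> X' \<and> emeasure (lebesgue_n n) X = emeasure ?L X'" if "X \<in> sets (lebesgue_n n)" for X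
      unfolding lebesgue_n_def by (rule completion_upper[OF that[unfolded lebesgue_n_def]]) blast
    obtain A1 where A1: "A1 \<in> sets ?L" "A \<subseteq> A1" "emeasure (lebesgue_n n) A = emeasure ?L A1"
      using up[OF sets(1)] by blast
    obtain B1 where B1: "B1 \<in> sets ?L" "B \<subseteq> B1" "emeasure (lebesgue_n n) B = emeasure ?L B1"
      using up[OF sets(2)] by blast
    obtain C1 where C1: "C1 \<in> sets ?L" "?C \<subseteq> C1" "emeasure (lebesgue_n n) ?C = emeasure ?L C1"
      using up[OF sum] by blast
    define T where "T = main_part (?L \<Otimes>\<^sub>M ?L) \<Theta>"
    have \<Theta>: "\<Theta> \<in> sets (completion (?L \<Otimes>\<^sub>M ?L))" using sets(3) by (simp add: lebesgue_2n_def)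
    have T: "T \<in> sets (?L \<Otimes>\<^sub>M ?L)" "T \<subseteq> \<Theta>" "emeasure (lebesgue_2n n) \<Theta> = emeasure (?L \<Otimes>\<^sub>M ?L) T"
      using main_part_sets[OF \<Theta>] main_part_null_part_Un[OF \<Theta>] emeasure_completion[OF \<Theta>]
      by (auto simp: T_def lebesgue_2n_def)
    have m: "measure (lebesgue_n n) A = measure ?L A1" "measure (lebesgue_n n) B = measure ?L B1"
      "measure (lebesgue_2n n) \<Theta> = measure (?L \<Otimes>\<^sub>M ?L) T"
      by (simp_all add: measure_def A1 B1 T)
    have fm: "A1 \<in> fmeasurable ?L" "B1 \<in> fmeasurable ?L" "C1 \<in> fmeasurable ?L"
      using A1 B1 C1 A B False by (auto intro!: fmeasurableI simp: less_top)
    have pos: "0 < measure ?L A1" "0 < measure ?L B1"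
      using A B A1 B1 by (auto simp: measure_def enn2real_positive_iff)
    have TAB: "T \<subseteq> A1 \<times> B1" using T(2) sub A1(2) B1(2) by auto
    have TC: "restricted_sum n T \<subseteq> C1" using T(2) C1(2) by (auto simp: restricted_sum_def)
    have "measure ?L A1 powr (2 / n) + measure ?L B1 powr (2 / n) \<le> measure ?L C1 powr (2 / n)"
      using restricted_sum_borel[OF n fm(1) pos(1) fm(2) pos(2) T(1) TAB fm(3) TC \<rho>(1) \<rho>12[unfolded m] big[unfolded m]] .
    then have "ennreal (measure ?L A1 powr (2 / n)) + ennreal (measure ?L B1 powr (2 / n)) \<le> ennreal (measure ?L C1 powr (2 / n))"
      by (simp add: ennreal_plus[symmetric] ennreal_leI del: ennreal_plus)
    moreover have "ennpowr (emeasure ?L X) p = ennreal (measure ?L X powr p)" if "X \<in> fmeasurable ?L" for X p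
      using that by (auto simp: ennpowr_def measure_def fmeasurable_def)
    ultimately show ?thesis using fm by (simp add: A1(3) B1(3) C1(3))
  qed
qed simp

end
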